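(* Let $n\ge1$ and regard $S^2$ as an embedded submanifold of $\mathbb{P}(\mathbb{C}^{n+1})$ via the map $pr\circ\Psi$. Every Kähler function $f$ on $S^2$ extends uniquely as a Kähler function $\widehat f$ on $\mathbb{P}(\mathbb{C}^{n+1})$, and the resulting linear map $\mathscr{K}(S^2)\to\mathscr{K}(\mathbb{P}(\mathbb{C}^{n+1}))$, $f\mapsto\widehat f$, satisfies $$\widehat{\{f,g\}}=\frac14\{\widehat f,\widehat g\}$$ for all $f,g\in\mathscr{K}(S^2)$.
   Context: **Kähler functions.** On a Kähler manifold $(N,g,J,\omega)$, $\mathscr{K}(N)$ is the space of smooth functions $f:N\to\mathbb{R}$ with $\mathscr{L}_{X_f}g=0$, where $\omega(X_f,\cdot)=df$; it is a Lie algebra for $\{f,g\}:=\omega(X_f,X_g)$. **Sphere.** $S^2=\{(x,y,z)\in\mathbb{R}^3\mid x^2+y^2+z^2=1\}$ carries the Kähler structure $(n\,g_{S^2},J_{S^2},n\,\omega_{S^2})$, where $g_{S^2}$ is the round metric, $J_{S^2}v=v\times p$ for $v\in T_pS^2$, and $\omega_{S^2}=g_{S^2}(J_{S^2}\cdot,\cdot)$ (the structure coming from the Kählerification of the binomial distributions on $\{0,\dots,n\}$). Its space of Kähler functions is $\mathscr{K}(S^2)=\mathrm{Vect}_{\mathbb{R}}\{1,x,y,z\}$, and with these conventions $\{x,y\}=-\frac1nz$, $\{y,z\}=-\frac1nx$, $\{z,x\}=-\frac1ny$. **Projective space.** $\langle\cdot,\cdot\rangle$ is the Hermitian product on $\mathbb{C}^{n+1}$,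 linear in the second argument. For a unit vector $u$, the chart $[z]\mapsto\frac1{\langle u,z\rangle}z-u\in[u]^\perp$ identifies $T_{[u]}\mathbb{P}(\mathbb{C}^{n+1})$ with $[u]^\perp$; $\mathbb{P}(\mathbb{C}^{n+1})$ carries the Fubini–Study Kähler structure $g_{FS}(\xi_1,\xi_2)=\mathrm{Re}\langle\xi_1,\xi_2\rangle$, $\omega_{FS}(\xi_1,\xi_2)=\mathrm{Im}\langle\xi_1,\xi_2\rangle$ and its natural complex structure; the bracket on $\mathscr{K}(\mathbb{P}(\mathbb{C}^{n+1}))$ is that of $\omega_{FS}$. **The map.** Parametrize $S^2$ by $x=\cos\alpha$, $y=\sin\alpha\cos\beta$, $z=\sin\alpha\sin\beta$, $\alpha\in[0,\pi]$, $\beta\in[0,2\pi]$. $\Psi(\alpha,\beta)\in\mathbb{C}^{n+1}$ is the unit vector with components $\Psi(\alpha,\beta)_k=\binom nk^{1/2}(\cos(\alpha/2))^k(\sin(\alpha/2))^{n-k}e^{i\beta k}$, $k=0,\dots,n$ (with $0^0=1$), and $pr:\mathbb{C}^{n+1}\setminus\{0\}\to\mathbb{P}(\mathbb{C}^{n+1})$ is the projection; $pr\circ\Psi$ is well defined on $S^2$. *)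

theory Defs
  imports "HOL-Analysis.Analysis"
begin

section \<open>Kaehler functions in charts\<close>

text \<open>
  A Kaehler manifold with point type \<open>'p\<close> is presented by an atlas.  Every chart \<open>c\<close> has a
  real linear subspace \<open>model c\<close> of a Euclidean space as its coordinate domain (a subspace rather
  than a type, since for projective space the coordinate domain is the varying hyperplane
  \<open>[u]\<^sup>\<bottom>\<close>) and is given by its inverse \<open>param c\<close>, which maps \<open>model c\<close> into the
  manifold.  The terms \<open>metric c x v w\<close> and \<open>sympl c x v w\<close> are the values of the metric and of the
  symplectic form at the point \<open>param c x\<close>, applied to the tangent vectors with coordinates
  \<open>v\<close> and \<open>w\<close>.  Only values at arguments from \<open>model c\<close> matter.
\<close>

record ('c, 'e, 'p) kahler =
  charts :: "'c set"
  model  :: "'c \<Rightarrow> 'e set"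
  param  :: "'c \<Rightarrow> 'e \<Rightarrow> 'p"
  metric :: "'c \<Rightarrow> 'e \<Rightarrow> 'e \<Rightarrow> 'e \<Rightarrow> real"
  sympl  :: "'c \<Rightarrow> 'e \<Rightarrow> 'e \<Rightarrow> 'e \<Rightarrow> real"

definition dird :: "('e::real_normed_vector \<Rightarrow> 'b::real_normed_vector) \<Rightarrow> 'e \<Rightarrow> 'e \<Rightarrow> 'b" where
  "dird h x v = vector_derivative (\<lambda>t. h (x + t *\<^sub>R v)) (at 0)"

text \<open>Functions of class \<open>C\<^sup>k\<close> on a linear subspace \<open>V\<close>; only the restriction to \<open>V\<close> matters.\<close>

fun Ck_on :: "nat \<Rightarrow> 'e::real_normed_vector set \<Rightarrow> ('e \<Rightarrow> 'b::real_normed_vector) \<Rightarrow> bool" where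
  "Ck_on 0 V h \<longleftrightarrow> continuous_on V h"
| "Ck_on (Suc k) V h \<longleftrightarrow>
     (\<forall>x\<in>V. h differentiable (at x within V)) \<and> (\<forall>v\<in>V. Ck_on k V (\<lambda>x. dird h x v))"

definition smooth_function ::
    "('c, 'e::real_normed_vector, 'p) kahler \<Rightarrow> ('p \<Rightarrow> real) \<Rightarrow> bool" where
  "smooth_function K f \<longleftrightarrow> (\<forall>c\<in>charts K. \<forall>k. Ck_on k (model K c) (f \<circ> param K c))"

text \<open>The Hamiltonian vector field \<open>X\<close> of \<open>f\<close>, defined by \<open>\<omega>(X, \<cdot>) = df\<close>, in the chart \<open>c\<close>.\<close>

definition ham ::
    "('c, 'e::real_normed_vector, 'p) kahler \<Rightarrow> ('p \<Rightarrow> real) \<Rightarrow> 'c \<Rightarrow> 'e \<Rightarrow> 'e" where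
  "ham K f c x = (THE X. X \<in> model K c \<and>
     (\<forall>v\<in>model K c. sympl K c x X v = dird (f \<circ> param K c) x v))"

text \<open>
  The Lie derivative of the metric along a vector field \<open>X\<close>, in the chart \<open>c\<close>: this is
  \<open>(L\<^sub>X g)(v, w) = X (g(v, w)) - g([X, v], w) - g(v, [X, w])\<close> for the coordinate vector fields
  with constant components \<open>v\<close> and \<open>w\<close>, for which \<open>[X, v] = - DX(v)\<close>.
\<close>

definition lie_metric ::
    "('c, 'e::real_normed_vector, 'p) kahler \<Rightarrow> 'c \<Rightarrow> ('e \<Rightarrow> 'e) \<Rightarrow> 'e \<Rightarrow> 'e \<Rightarrow> 'e \<Rightarrow> real" where
  "lie_metric K c X x v w =
     dird (\<lambda>y. metric K c y v w) x (X x)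
     + metric K c x (dird X x v) w + metric K c x v (dird X x w)"

definition kahler_functions ::
    "('c, 'e::real_normed_vector, 'p) kahler \<Rightarrow> ('p \<Rightarrow> real) set" where
  "kahler_functions K = {f. smooth_function K f \<and>
     (\<forall>c\<in>charts K. \<forall>x\<in>model K c. \<forall>v\<in>model K c. \<forall>w\<in>model K c.
        lie_metric K c (ham K f c) x v w = 0)}"

text \<open>
  The Poisson bracket \<open>\<omega>(X\<^sub>f, X\<^sub>g)\<close>; for an atlas covering the manifold, with compatible charts,
  the value does not depend on the chart and so the description is satisfied by exactly one number.
\<close>

definition pbracket ::
    "('c, 'e::real_normed_vector, 'p) kahler \<Rightarrow> ('p \<Rightarrow> real) \<Rightarrow> ('p \<Rightarrow> real) \<Rightarrow> 'p \<Rightarrow> real" where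
  "pbracket K f g p = (THE r. \<exists>c\<in>charts K. \<exists>x\<in>model K c.
     param K c x = p \<and> r = sympl K c x (ham K f c x) (ham K g c x))"


section \<open>The sphere\<close>

typedef S2 = "sphere (0 :: real^3) 1"
  by (rule exI [of _ "axis 1 1"]) simp

text \<open>
  Charts are the central projections onto the tangent planes: for a unit vector \<open>p\<close>, the plane
  \<open>T\<^sub>p S\<^sup>2 = p\<^sup>\<bottom>\<close> parametrizes the open hemisphere around \<open>p\<close> by
  \<open>x \<mapsto> (p + x) / \<bar>p + x\<bar>\<close>.
\<close>

definition sphere_par :: "real^3 \<Rightarrow> real^3 \<Rightarrow> real^3" where
  "sphere_par p x = sgn (p + x)"

definition J_sphere :: "real^3 \<Rightarrow> real^3 \<Rightarrow> real^3" where
  "J_sphere p v = cross3 v p"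

definition omega_sphere :: "real^3 \<Rightarrow> real^3 \<Rightarrow> real^3 \<Rightarrow> real" where
  "omega_sphere p v w = J_sphere p v \<bullet> w"

text \<open>The Kaehler structure \<open>(n g, J, n \<omega>)\<close>; coordinate vectors are pushed forward by \<open>sphere_par\<close>.\<close>

definition sphere_kahler :: "nat \<Rightarrow> (real^3, real^3, S2) kahler" where
  "sphere_kahler n = \<lparr>
     charts = sphere 0 1,
     model  = (\<lambda>p. {x. p \<bullet> x = 0}),
     param  = (\<lambda>p x. Abs_S2 (sphere_par p x)),
     metric = (\<lambda>p x v w. real n * (dird (sphere_par p) x v \<bullet> dird (sphere_par p) x w)),
     sympl  = (\<lambda>p x v w. real n *
       omega_sphere (sphere_par p x) (dird (sphere_par p) x v) (dird (sphere_par p) x w)) \<rparr>"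


section \<open>Complex projective space\<close>

quotient_type 'm cproj = "complex^'m::finite" / partial:
  "\<lambda>z w. z \<noteq> 0 \<and> w \<noteq> 0 \<and> (\<exists>c. w = c *s z)"
proof (rule part_equivpI)
  show "\<exists>z::complex^'m. z \<noteq> 0 \<and> z \<noteq> 0 \<and> (\<exists>c. z = c *s z)"
    by (rule exI [of _ "\<chi> i. 1"]) (auto simp: vec_eq_iff intro!: exI [of _ 1])
  show "symp (\<lambda>z w::complex^'m. z \<noteq> 0 \<and> w \<noteq> 0 \<and> (\<exists>c. w = c *s z))"
  proof (rule sympI, safe)
    fix z :: "complex^'m" and c assume "c *s z \<noteq> 0"
    then have "c \<noteq> 0" by auto
    then have "z = inverse c *s (c *s z)" by (simp add: vector_smult_assoc)
    then show "\<exists>d. z = d *s (c *s z)" ..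
  qed
  show "transp (\<lambda>z w::complex^'m. z \<noteq> 0 \<and> w \<noteq> 0 \<and> (\<exists>c. w = c *s z))"
    by (rule transpI) (metis vector_smult_assoc)
qed

definition pr :: "complex^'m::finite \<Rightarrow> 'm cproj" where
  "pr z = abs_cproj z"

lemma pr_eq_iff:
  assumes "z \<noteq> 0" "w \<noteq> 0"
  shows "pr z = pr w \<longleftrightarrow> (\<exists>c. w = c *s z)"
  using assms Quotient3_rel_abs [OF Quotient3_cproj, of z w]
    Quotient3_rel [OF Quotient3_cproj, of z w]
  unfolding pr_def by (auto intro: exI [of _ 1])

definition herm :: "complex^'m::finite \<Rightarrow> complex^'m \<Rightarrow> complex" where
  "herm z w = (\<Sum>i\<in>UNIV. cnj (z $ i) * w $ i)"

text \<open>The chart at a unit vector \<open>u\<close>, with values in \<open>[u]\<^sup>\<bottom>\<close>; its inverse is \<open>x \<mapsto> [u + x]\<close>.\<close>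

definition cproj_chart :: "complex^'m::finite \<Rightarrow> complex^'m \<Rightarrow> complex^'m" where
  "cproj_chart u z = (1 / herm u z) *s z - u"

text \<open>
  The tangent vector at \<open>[u + x]\<close> with coordinates \<open>v\<close> in the chart at \<open>u\<close>, as an element of
  \<open>[u']\<^sup>\<bottom>\<close> where \<open>u' = (u + x) / \<bar>u + x\<bar>\<close>: the identification of the tangent space at \<open>[u']\<close>
  with \<open>[u']\<^sup>\<bottom>\<close> is by the chart at \<open>u'\<close>.  Another choice of the unit representative \<open>u'\<close>
  multiplies the result by a phase, which changes neither \<open>g\<close> nor \<open>\<omega>\<close>.
\<close>

definition cproj_tangent :: "complex^'m::finite \<Rightarrow> complex^'m \<Rightarrow> complex^'m \<Rightarrow> complex^'m" where
  "cproj_tangent u x v = dird (\<lambda>y. cproj_chart (sgn (u + x)) (u + y)) x v"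

definition fubini_study :: "(complex^'m::finite, complex^'m, 'm cproj) kahler" where
  "fubini_study = \<lparr>
     charts = sphere 0 1,
     model  = (\<lambda>u. {x. herm u x = 0}),
     param  = (\<lambda>u x. pr (u + x)),
     metric = (\<lambda>u x v w. Re (herm (cproj_tangent u x v) (cproj_tangent u x w))),
     sympl  = (\<lambda>u x v w. Im (herm (cproj_tangent u x v) (cproj_tangent u x w))) \<rparr>"


section \<open>The embedding and the extension map\<close>

definition sphere_point :: "real \<Rightarrow> real \<Rightarrow> S2" where
  "sphere_point \<alpha> \<beta> = Abs_S2 (vector [cos \<alpha>, sin \<alpha> * cos \<beta>, sin \<alpha> * sin \<beta>])"

text \<open>
  The coordinates of \<open>\<complex>\<^sup>n\<^sup>+\<^sup>1\<close> are indexed by a finite type \<open>'m\<close>; the bijection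
  \<open>\<iota> : 'm \<rightarrow> {0..n}\<close> gives the position of an index.
\<close>

definition Psi :: "nat \<Rightarrow> ('m::finite \<Rightarrow> nat) \<Rightarrow> real \<Rightarrow> real \<Rightarrow> complex^'m" where
  "Psi n \<iota> \<alpha> \<beta> = (\<chi> j. let k = \<iota> j in
     complex_of_real (sqrt (real (n choose k)) * cos (\<alpha> / 2) ^ k * sin (\<alpha> / 2) ^ (n - k))
     * exp (\<i> * complex_of_real (\<beta> * real k)))"

definition emb :: "nat \<Rightarrow> ('m::finite \<Rightarrow> nat) \<Rightarrow> S2 \<Rightarrow> 'm cproj" where
  "emb n \<iota> p = (THE q. \<exists>\<alpha>\<in>{0..pi}. \<exists>\<beta>\<in>{0..2*pi}. p = sphere_point \<alpha> \<beta> \<and> q = pr (Psi n \<iota> \<alpha> \<beta>))"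

lemma Rep_sphere_point:
  "Rep_S2 (sphere_point \<alpha> \<beta>) = vector [cos \<alpha>, sin \<alpha> * cos \<beta>, sin \<alpha> * sin \<beta>]"
proof -
  have "(cos \<alpha>)\<^sup>2 + ((sin \<alpha> * cos \<beta>)\<^sup>2 + (sin \<alpha> * sin \<beta>)\<^sup>2) = 1"
    by (simp add: power_mult_distrib flip: distrib_left)
  then have "norm (vector [cos \<alpha>, sin \<alpha> * cos \<beta>, sin \<alpha> * sin \<beta>] :: real^3) = 1"
    by (simp add: norm_vec_def L2_set_def sum_3 add.assoc)
  then show ?thesis
    unfolding sphere_point_def by (simp add: Abs_S2_inverse)
qed

lemma Psi_nonzero:
  fixes \<iota> :: "'m::finite \<Rightarrow> nat"
  assumes \<iota>: "bij_betw \<iota> UNIV {0..n}"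
  shows "Psi n \<iota> \<alpha> \<beta> \<noteq> 0"
proof
  assume 0: "Psi n \<iota> \<alpha> \<beta> = 0"
  from \<iota> have "n \<in> range \<iota>" "0 \<in> range \<iota>"
    by (auto simp: bij_betw_def)
  then obtain i j where "\<iota> i = n" "\<iota> j = 0" by (metis rangeE)
  moreover have "Psi n \<iota> \<alpha> \<beta> $ i = 0" "Psi n \<iota> \<alpha> \<beta> $ j = 0"
    using 0 by simp_all
  ultimately have "cos (\<alpha> / 2) = 0" "sin (\<alpha> / 2) = 0"
    by (auto simp: Psi_def)
  then show False
    using sin_cos_squared_add [of "\<alpha> / 2"] by simp
qed

lemma pr_Psi_well_defined:
  fixes \<iota> :: "'m::finite \<Rightarrow> nat"
  assumes \<iota>: "bij_betw \<iota> UNIV {0..n}"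
    and "\<alpha> \<in> {0..pi}" "\<alpha>' \<in> {0..pi}"
    and eq: "sphere_point \<alpha> \<beta> = sphere_point \<alpha>' \<beta>'"
  shows "pr (Psi n \<iota> \<alpha> \<beta>) = pr (Psi n \<iota> \<alpha>' \<beta>')"
proof -
  have vec: "(vector [cos \<alpha>, sin \<alpha> * cos \<beta>, sin \<alpha> * sin \<beta>] :: real^3)
      = vector [cos \<alpha>', sin \<alpha>' * cos \<beta>', sin \<alpha>' * sin \<beta>']"
    using arg_cong [OF eq, of Rep_S2] by (simp add: Rep_sphere_point)
  then have eqs: "cos \<alpha> = cos \<alpha>'" "sin \<alpha> * cos \<beta> = sin \<alpha>' * cos \<beta>'"
      "sin \<alpha> * sin \<beta> = sin \<alpha>' * sin \<beta>'"
    by (metis vector_3)+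
  have \<alpha>: "\<alpha>' = \<alpha>"
    using eqs(1) assms(2,3) by (auto intro: cos_inj_pi)
  have "\<exists>c. Psi n \<iota> \<alpha> \<beta>' = c *s Psi n \<iota> \<alpha> \<beta>"
  proof (cases "sin \<alpha> = 0")
    case False
    then have "exp (\<i> * complex_of_real \<beta>) = exp (\<i> * complex_of_real \<beta>')"
      using eqs by (simp add: \<alpha> exp_eq_polar complex_eq_iff cis_conv_exp [symmetric])
    then have "exp (\<i> * complex_of_real (\<beta> * real k)) = exp (\<i> * complex_of_real (\<beta>' * real k))" for k
      by (metis (no_types, opaque_lifting) exp_of_nat2_mult mult.assoc of_real_mult of_real_of_nat_eq)
    then have "Psi n \<iota> \<alpha> \<beta>' = 1 *s Psi n \<iota> \<alpha> \<beta>"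
      by (simp add: Psi_def)
    then show ?thesis ..
  next
    case True
    have le: "\<iota> j \<le> n" for j
      using \<iota> by (auto simp: bij_betw_def)
    have "2 * sin (\<alpha> / 2) * cos (\<alpha> / 2) = 0"
      using True sin_double [of "\<alpha> / 2"] by simp
    then consider "sin (\<alpha> / 2) = 0" | "cos (\<alpha> / 2) = 0" by auto
    then show ?thesis
    proof cases
      case 1
      have "Psi n \<iota> \<alpha> \<beta>' $ j
          = exp (\<i> * complex_of_real ((\<beta>' - \<beta>) * real n)) * Psi n \<iota> \<alpha> \<beta> $ j" for j
      proof (cases "\<iota> j = n")
        case True
        have "exp (\<i> * complex_of_real (\<beta>' * real n))
          = exp (\<i> * complex_of_real ((\<beta>' - \<beta>) * real n)) * exp (\<i> * complex_of_real (\<beta> * real n))"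
          by (simp add: exp_add [symmetric] algebra_simps)
        then show ?thesis using True by (simp add: Psi_def)
      next
        case False
        then show ?thesis using 1 le [of j] by (simp add: Psi_def Let_def)
      qed
      then show ?thesis
        by (metis vec_eq_iff vector_smult_component)
    next
      case 2
      have "Psi n \<iota> \<alpha> \<beta>' $ j = Psi n \<iota> \<alpha> \<beta> $ j" for j
        using 2 by (cases "\<iota> j = 0") (simp_all add: Psi_def Let_def)
      then have "Psi n \<iota> \<alpha> \<beta>' = 1 *s Psi n \<iota> \<alpha> \<beta>"
        by (simp add: vec_eq_iff)
      then show ?thesis ..
    qed
  qed
  then show ?thesis
    using pr_eq_iff Psi_nonzero [OF \<iota>] \<alpha> by metis
qed

lemma emb_sphere_point:
  fixes \<iota> :: "'m::finite \<Rightarrow> nat"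
  assumes "bij_betw \<iota> UNIV {0..n}" "\<alpha> \<in> {0..pi}" "\<beta> \<in> {0..2*pi}"
  shows "emb n \<iota> (sphere_point \<alpha> \<beta>) = pr (Psi n \<iota> \<alpha> \<beta>)"
  unfolding emb_def using assms pr_Psi_well_defined [OF assms(1)]
  by (intro the_equality) metis+

text \<open>The Kaehler function on projective space extending a Kaehler function on the sphere.\<close>

definition extend_kahler :: "nat \<Rightarrow> ('m::finite \<Rightarrow> nat) \<Rightarrow> (S2 \<Rightarrow> real) \<Rightarrow> 'm cproj \<Rightarrow> real" where
  "extend_kahler n \<iota> f = (THE F. F \<in> kahler_functions fubini_study \<and> F \<circ> emb n \<iota> = f)"

end

theory Submission
  imports Defs
begin

text \<open>
  Both spaces of Kaehler functions can be determined explicitly, and the extension is then a matter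
  of linear algebra.

  On projective space, in the chart \<open>x \<mapsto> [u + x]\<close> on \<open>V = [u]\<^sup>\<bottom>\<close> put
  \<open>h x = (1 + \<bar>x\<bar>\<^sup>2) f [u + x]\<close>.  The Hamiltonian field of \<open>f\<close> is a polynomial in \<open>x\<close>, \<open>h x\<close> and
  the gradient of \<open>h\<close>, and the Lie derivative of the metric collapses to
  \<open>(D\<^sup>2h(v, iw) + D\<^sup>2h(iv, w)) / (1 + \<bar>x\<bar>\<^sup>2)\<close> (\<open>fs_lie_metric_eq\<close>).  So \<open>f\<close> is Kaehler in the chart
  exactly if the Hessian of \<open>h\<close> is invariant under \<open>i\<close> at every point.  Then the third derivative is
  a symmetric trilinear form from which \<open>i\<close> can be moved between any two slots at the price of a
  sign; three such moves return to the start with the opposite sign, so it vanishes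
  (\<open>third_derivative_zero\<close>).  Hence \<open>h\<close> is a quadratic polynomial, and \<open>f\<close> is the Rayleigh quotient
  \<open>[z] \<mapsto> \<langle>z, Az\<rangle> / \<bar>z\<bar>\<^sup>2\<close> of a Hermitian operator (\<open>kahler_functions_fubini_study\<close>).  The bracket of two
  such functions is \<open>[z] \<mapsto> 4 Im \<langle>Az, Bz\<rangle> / \<bar>z\<bar>\<^sup>2\<close>.

  On the sphere, the same plan works in central projection with \<open>h = \<rho> f\<close>, \<open>\<rho> x = sqrt (1 + \<bar>x\<bar>\<^sup>2)\<close>.
  Central projection maps great circles to lines, and the Killing condition says that the Hessian
  of \<open>h\<close> is at every point a multiple of that of \<open>\<rho>\<close>.  The symmetry of the third derivatives forces
  the factor to be constant, so that \<open>h\<close> is \<open>c \<rho>\<close> plus an affine function, and \<open>f\<close> is the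
  restriction of an affine function \<open>a + b \<bullet> q\<close> of \<open>\<real>\<^sup>3\<close> (\<open>kahler_functions_sphere\<close>).

  The image of the sphere consists of the spin coherent states, in which the
  three rescaled spin operators have the expectation values \<open>x, y, z\<close> (\<open>rayleigh_hat_Psi\<close>); this gives
  the extension.  It is unique because a Hermitian operator whose expectation value vanishes in
  every coherent state is zero (\<open>hermitian_zero_of_Psi\<close>): the expectation value is, up to a factor,
  a polynomial in a complex variable and its conjugate.  The bracket relation reduces to the
  commutators of the spin operators (\<open>Im_herm_hat\<close>).
\<close>

section \<open>Calculus on a linear subspace\<close>

definition smooth_on :: "'e::real_normed_vector set \<Rightarrow> ('e \<Rightarrow> 'b::real_normed_vector) \<Rightarrow> bool" where
  "smooth_on V h \<longleftrightarrow> (\<forall>k. Ck_on k V h)"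

text \<open>
  The squared norm of \<open>p + x\<close> for a unit vector \<open>p\<close> orthogonal to \<open>x\<close>.
\<close>

abbreviation nsq :: "'e::real_inner \<Rightarrow> real" where
  "nsq x \<equiv> 1 + x \<bullet> x"

text \<open>
  The direction \<open>v\<close> is that of the outer derivative.
\<close>

abbreviation hess :: "('e::real_normed_vector \<Rightarrow> 'b::real_normed_vector) \<Rightarrow> 'e \<Rightarrow> 'e \<Rightarrow> 'e \<Rightarrow> 'b" where
  "hess h x v w \<equiv> dird (\<lambda>y. dird h y w) x v"

text \<open>
  Directional derivatives along a subspace see only the restriction of a function to it: this is
  what connects \<^const>\<open>dird\<close>, which is taken in the whole space, with derivatives within the subspace.
\<close>

lemma has_derivative_along_line:
  assumes "subspace V" "x \<in> V" "v \<in> V" "(h has_derivative D) (at x within V)"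
  shows "((\<lambda>t. h (x + t *\<^sub>R v)) has_vector_derivative D v) (at 0)"
proof -
  have lin: "linear D"
    using assms(4) by (rule has_derivative_linear)
  have 1: "((\<lambda>t::real. x + t *\<^sub>R v) has_derivative (\<lambda>t. t *\<^sub>R v)) (at 0)"
    by (auto intro!: derivative_eq_intros)
  have "range (\<lambda>t::real. x + t *\<^sub>R v) \<subseteq> V"
    using assms by (auto intro: subspace_add subspace_scale)
  then have 2: "(h has_derivative D) (at (x + 0 *\<^sub>R v) within range (\<lambda>t::real. x + t *\<^sub>R v))"
    using assms(4) by (auto intro: has_derivative_subset)
  show ?thesis
    using has_derivative_in_compose[OF 1 2] lin
    by (simp add: has_vector_derivative_def linear_cmul)
qed

lemma dird_cong:
  assumes "subspace V" "x \<in> V" "v \<in> V" "\<And>y. y \<in> V \<Longrightarrow> f y = g y"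
  shows "dird f x v = dird g x v"
proof -
  have "f (x + t *\<^sub>R v) = g (x + t *\<^sub>R v)" for t
    using assms by (auto intro: subspace_add subspace_scale)
  then show ?thesis by (simp add: dird_def)
qed

lemma dird_eqI: "((\<lambda>t. h (x + t *\<^sub>R v)) has_vector_derivative d) (at 0) \<Longrightarrow> dird h x v = d"
  by (simp add: dird_def vector_derivative_at)

lemma dird_has_derivative:
  assumes "subspace V" "x \<in> V" "v \<in> V" "(h has_derivative D) (at x within V)"
  shows "dird h x v = D v"
  by (rule dird_eqI[OF has_derivative_along_line[OF assms]])

lemma Ck_on_cong:
  assumes "subspace V" "\<And>x. x \<in> V \<Longrightarrow> f x = g x" "Ck_on k V f"
  shows "Ck_on k V g"
  using assms(2,3)
proof (induction k arbitrary: f g)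
  case 0
  then show ?case by (auto cong: continuous_on_cong)
next
  case (Suc k)
  have "g differentiable (at x within V)" if "x \<in> V" for x
    using Suc.prems that unfolding differentiable_def
    by (metis Ck_on.simps(2) has_derivative_transform differentiable_def)
  moreover have "Ck_on k V (\<lambda>x. dird g x v)" if "v \<in> V" for v
    by (rule Suc.IH[of "\<lambda>x. dird f x v"])
      (use Suc.prems that dird_cong[OF assms(1) _ that Suc.prems(1)] in auto)
  ultimately show ?case by simp
qed

lemma Ck_on_SucD: "Ck_on (Suc k) V f \<Longrightarrow> Ck_on k V f"
proof (induction k arbitrary: f)
  case 0
  then show ?case
    by (auto simp: continuous_on_eq_continuous_within intro: differentiable_imp_continuous_within)
next
  case (Suc k)
  then show ?case by (metis Ck_on.simps(2))
qed

text \<open>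
  The form in which the recursion is used: the derivative \<open>D x v\<close> may be guessed and differentiated
  as a function of \<open>x\<close>.
\<close>

lemma Ck_on_SucI:
  assumes "subspace V" "\<And>x. x \<in> V \<Longrightarrow> (f has_derivative D x) (at x within V)"
    "\<And>v. v \<in> V \<Longrightarrow> Ck_on k V (\<lambda>x. D x v)"
  shows "Ck_on (Suc k) V f"
proof -
  have "Ck_on k V (\<lambda>x. dird f x v)" if "v \<in> V" for v
    by (rule Ck_on_cong[OF assms(1) _ assms(3)[OF that]])
       (use dird_has_derivative[OF assms(1) _ that assms(2)] in auto)
  then show ?thesis using assms(2) by (auto simp: differentiable_def)
qed

lemma Ck_on_SucE:
  assumes "subspace V" "Ck_on (Suc k) V f"
  obtains D where "\<And>x. x \<in> V \<Longrightarrow> (f has_derivative D x) (at x within V)"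
    "\<And>v. v \<in> V \<Longrightarrow> Ck_on k V (\<lambda>x. D x v)"
proof -
  have "\<forall>x\<in>V. \<exists>D. (f has_derivative D) (at x within V)"
    using assms by (auto simp: differentiable_def)
  then obtain D where D: "\<And>x. x \<in> V \<Longrightarrow> (f has_derivative D x) (at x within V)"
    by metis
  show ?thesis
  proof (rule that[OF D])
    fix v assume v: "v \<in> V"
    show "Ck_on k V (\<lambda>x. D x v)"
      by (rule Ck_on_cong[OF assms(1), of "\<lambda>x. dird f x v"])
         (use dird_has_derivative[OF assms(1) _ v D] v assms(2) in auto)
  qed
qed

lemma Ck_on_const: "subspace V \<Longrightarrow> Ck_on k V (\<lambda>x. c)"
proof (induction k arbitrary: c)
  case 0
  show ?case by simp
next
  case (Suc k)
  show ?case
    by (rule Ck_on_SucI[OF Suc.prems, where D = "\<lambda>x v. 0"]) (auto intro: Suc)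
qed

lemma Ck_on_bounded_linear:
  assumes "subspace V" "bounded_linear L"
  shows "Ck_on k V L"
proof (cases k)
  case 0
  then show ?thesis using assms by (simp add: linear_continuous_on)
next
  case (Suc m)
  show ?thesis unfolding Suc
    by (rule Ck_on_SucI[OF assms(1), where D = "\<lambda>x. L"])
      (auto intro: bounded_linear_imp_has_derivative assms Ck_on_const)
qed

lemma Ck_on_add:
  assumes "subspace V" "Ck_on k V f" "Ck_on k V g"
  shows "Ck_on k V (\<lambda>x. f x + g x)"
  using assms(2,3)
proof (induction k arbitrary: f g)
  case 0
  then show ?case by (auto intro: continuous_intros)
next
  case (Suc k)
  obtain D where D: "\<And>x. x \<in> V \<Longrightarrow> (f has_derivative D x) (at x within V)"
    "\<And>v. v \<in> V \<Longrightarrow> Ck_on k V (\<lambda>x. D x v)"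
    using Ck_on_SucE[OF assms(1) Suc.prems(1)] by blast
  obtain E where E: "\<And>x. x \<in> V \<Longrightarrow> (g has_derivative E x) (at x within V)"
    "\<And>v. v \<in> V \<Longrightarrow> Ck_on k V (\<lambda>x. E x v)"
    using Ck_on_SucE[OF assms(1) Suc.prems(2)] by blast
  show ?case
    by (rule Ck_on_SucI[OF assms(1), where D = "\<lambda>x v. D x v + E x v"])
      (auto intro!: has_derivative_add D E Suc.IH)
qed

lemma Ck_on_mult:
  fixes f g :: "'e::real_normed_vector \<Rightarrow> real"
  assumes "subspace V" "Ck_on k V f" "Ck_on k V g"
  shows "Ck_on k V (\<lambda>x. f x * g x)"
  using assms(2,3)
proof (induction k arbitrary: f g)
  case 0
  then show ?case by (auto intro: continuous_intros)
next
  case (Suc k)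
  obtain D where D: "\<And>x. x \<in> V \<Longrightarrow> (f has_derivative D x) (at x within V)"
    "\<And>v. v \<in> V \<Longrightarrow> Ck_on k V (\<lambda>x. D x v)"
    using Ck_on_SucE[OF assms(1) Suc.prems(1)] by blast
  obtain E where E: "\<And>x. x \<in> V \<Longrightarrow> (g has_derivative E x) (at x within V)"
    "\<And>v. v \<in> V \<Longrightarrow> Ck_on k V (\<lambda>x. E x v)"
    using Ck_on_SucE[OF assms(1) Suc.prems(2)] by blast
  show ?case
    by (rule Ck_on_SucI[OF assms(1), where D = "\<lambda>x v. f x * E x v + D x v * g x"])
      (auto intro!: has_derivative_mult D E Suc.IH Ck_on_add assms(1) Ck_on_SucD[OF Suc.prems(1)]
         Ck_on_SucD[OF Suc.prems(2)])
qed

lemma smooth_on_cong: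
  "subspace V \<Longrightarrow> (\<And>x. x \<in> V \<Longrightarrow> f x = g x) \<Longrightarrow> smooth_on V f \<Longrightarrow> smooth_on V g"
  unfolding smooth_on_def using Ck_on_cong by blast

lemma smooth_on_const: "subspace V \<Longrightarrow> smooth_on V (\<lambda>x. c)"
  by (simp add: smooth_on_def Ck_on_const)

lemma smooth_on_bounded_linear: "subspace V \<Longrightarrow> bounded_linear L \<Longrightarrow> smooth_on V L"
  by (simp add: smooth_on_def Ck_on_bounded_linear)

lemma smooth_on_add:
  "subspace V \<Longrightarrow> smooth_on V f \<Longrightarrow> smooth_on V g \<Longrightarrow> smooth_on V (\<lambda>x. f x + g x)"
  by (simp add: smooth_on_def Ck_on_add)

lemma smooth_on_mult:
  fixes f g :: "'e::real_normed_vector \<Rightarrow> real"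
  shows "subspace V \<Longrightarrow> smooth_on V f \<Longrightarrow> smooth_on V g \<Longrightarrow> smooth_on V (\<lambda>x. f x * g x)"
  by (simp add: smooth_on_def Ck_on_mult)

lemma smooth_on_sum:
  assumes "subspace V" "\<And>i. i \<in> I \<Longrightarrow> smooth_on V (f i)"
  shows "smooth_on V (\<lambda>x. \<Sum>i\<in>I. f i x)"
  using assms(2)
  by (induction I rule: infinite_finite_induct) (auto intro!: smooth_on_add smooth_on_const assms(1))

lemma smooth_on_inner:
  fixes f :: "'e::euclidean_space \<Rightarrow> 'b::euclidean_space"
  assumes "subspace V" "bounded_linear f" "bounded_linear g"
  shows "smooth_on V (\<lambda>x. f x \<bullet> g x)"
proof -
  have "smooth_on V (\<lambda>x. \<Sum>b\<in>Basis. (f x \<bullet> b) * (g x \<bullet> b))"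
    by (intro smooth_on_sum smooth_on_mult smooth_on_bounded_linear assms
        bounded_linear_compose[OF bounded_linear_inner_left])
  then show ?thesis by (simp flip: euclidean_inner)
qed

text \<open>
  The derivative of \<open>r x = (1 + \<bar>x\<bar>\<^sup>2)\<^sup>-\<^sup>1\<^sup>/\<^sup>2\<close> in the direction \<open>v\<close> is \<open>- (x \<bullet> v) (r x)\<^sup>3\<close>, a product of a
  linear function and copies of \<open>r\<close>; so each order of differentiability implies the next.
\<close>

lemma smooth_on_rsqrt:
  fixes V :: "'e::euclidean_space set"
  assumes "subspace V"
  shows "smooth_on V (\<lambda>x. inverse (sqrt (nsq x)))"
proof -
  have "Ck_on k V (\<lambda>x. inverse (sqrt (nsq x)))" for k
  proof (induction k)
    case 0
    have "nsq x \<noteq> 0" for x :: 'e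
      using inner_ge_zero[of x] by linarith
    then show ?case by (auto intro!: continuous_intros)
  next
    case (Suc k)
    let ?r = "\<lambda>x::'e. inverse (sqrt (nsq x))"
    have pos: "nsq x > 0" for x :: 'e
      using inner_ge_zero[of x] by linarith
    have "Ck_on k V (\<lambda>x. (- (x \<bullet> v)) * (?r x * (?r x * ?r x)))" for v
      by (intro Ck_on_mult assms Suc.IH Ck_on_bounded_linear bounded_linear_minus
            bounded_linear_inner_left)
    moreover have "(?r has_derivative (\<lambda>v. (- (x \<bullet> v)) * (?r x * (?r x * ?r x)))) (at x within V)"
      for x
      using pos[of x]
      by (auto intro!: derivative_eq_intros simp: fun_eq_iff field_simps inner_commute)
    ultimately show ?case by (intro Ck_on_SucI[OF assms]) auto
  qed
  then show ?thesis by (simp add: smooth_on_def)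
qed

lemma smooth_on_inverse_sq:
  fixes V :: "'e::euclidean_space set"
  assumes "subspace V"
  shows "smooth_on V (\<lambda>x. inverse (nsq x))"
proof -
  have "inverse (nsq x) = inverse (sqrt (nsq x)) * inverse (sqrt (nsq x))" for x::'e
    using inner_ge_zero[of x] by (simp flip: inverse_mult_distrib)
  then show ?thesis
    using smooth_on_mult[OF assms smooth_on_rsqrt[OF assms] smooth_on_rsqrt[OF assms]] by simp
qed

lemma smooth_on_imp_continuous_on: "smooth_on V h \<Longrightarrow> continuous_on V h"
  unfolding smooth_on_def by (metis Ck_on.simps(1))

lemma smooth_on_dird: "smooth_on V h \<Longrightarrow> v \<in> V \<Longrightarrow> smooth_on V (\<lambda>x. dird h x v)"
  unfolding smooth_on_def by (metis Ck_on.simps(2))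

lemma smooth_on_has_derivative:
  assumes "subspace V" "smooth_on V h"
  obtains D where "\<And>x. x \<in> V \<Longrightarrow> (h has_derivative D x) (at x within V)"
    "\<And>x v. x \<in> V \<Longrightarrow> v \<in> V \<Longrightarrow> dird h x v = D x v"
proof -
  have "Ck_on (Suc 0) V h" using assms(2) by (simp add: smooth_on_def del: Ck_on.simps)
  then obtain D where D: "\<And>x. x \<in> V \<Longrightarrow> (h has_derivative D x) (at x within V)"
    using Ck_on_SucE[OF assms(1)] by blast
  show ?thesis
    using that[OF D dird_has_derivative[OF assms(1) _ _ D]] by blast
qed

lemma smooth_on_line:
  assumes "subspace V" "smooth_on V h" "x \<in> V" "v \<in> V"
  shows "((\<lambda>t. h (x + t *\<^sub>R v)) has_vector_derivative dird h (x + t *\<^sub>R v) v) (at t)"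
proof -
  obtain D where D: "\<And>x. x \<in> V \<Longrightarrow> (h has_derivative D x) (at x within V)"
    "\<And>x v. x \<in> V \<Longrightarrow> v \<in> V \<Longrightarrow> dird h x v = D x v"
    using smooth_on_has_derivative[OF assms(1,2)] by blast
  have y: "x + t *\<^sub>R v \<in> V"
    using assms by (auto intro: subspace_add subspace_scale)
  have "((\<lambda>s. h ((x + t *\<^sub>R v) + s *\<^sub>R v)) has_derivative
      (\<lambda>s. s *\<^sub>R dird h (x + t *\<^sub>R v) v)) (at (t - t))"
    using has_derivative_along_line[OF assms(1) y assms(4) D(1)[OF y]] D(2)[OF y assms(4)]
    by (simp add: has_vector_derivative_def)
  moreover have "((\<lambda>s. s - t) has_derivative (\<lambda>s. s)) (at t)"
    by (auto intro!: derivative_eq_intros)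
  ultimately have "((\<lambda>s. h ((x + t *\<^sub>R v) + (s - t) *\<^sub>R v)) has_derivative
      (\<lambda>s. s *\<^sub>R dird h (x + t *\<^sub>R v) v)) (at t)"
    using has_derivative_compose by fastforce
  moreover have "(x + t *\<^sub>R v) + (s - t) *\<^sub>R v = x + s *\<^sub>R v" for s
    by (simp add: algebra_simps)
  ultimately show ?thesis by (simp add: has_vector_derivative_def)
qed

lemma smooth_on_line_real:
  fixes h :: "_ \<Rightarrow> real"
  assumes "subspace V" "smooth_on V h" "x \<in> V" "v \<in> V"
  shows "((\<lambda>t. h (x + t *\<^sub>R v)) has_real_derivative dird h (x + t *\<^sub>R v) v) (at t)"
  using smooth_on_line[OF assms] by (simp add: has_real_derivative_iff_has_vector_derivative)

lemma dird_linear: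
  assumes "subspace V" "smooth_on V h" "x \<in> V" "v \<in> V" "w \<in> V"
  shows "dird h x (v + w) = dird h x v + dird h x w"
    "dird h x (c *\<^sub>R v) = c *\<^sub>R dird h x v"
    "dird h x 0 = 0" "dird h x (- v) = - dird h x v"
proof -
  obtain D where D: "\<And>x. x \<in> V \<Longrightarrow> (h has_derivative D x) (at x within V)"
    "\<And>x v. x \<in> V \<Longrightarrow> v \<in> V \<Longrightarrow> dird h x v = D x v"
    using smooth_on_has_derivative[OF assms(1,2)] by blast
  have "linear (D x)" using D(1) assms has_derivative_linear by blast
  then show "dird h x (v + w) = dird h x v + dird h x w" "dird h x (c *\<^sub>R v) = c *\<^sub>R dird h x v"
    "dird h x 0 = 0" "dird h x (- v) = - dird h x v"
    using D(2) assms by (auto simp: linear_add linear_cmul linear_0 linear_neg subspace_add subspace_scale subspace_neg subspace_0)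
qed

lemma dird_sum:
  assumes "subspace V" "smooth_on V h" "x \<in> V" "finite I" "\<And>i. i \<in> I \<Longrightarrow> w i \<in> V"
  shows "dird h x (\<Sum>i\<in>I. c i *\<^sub>R w i) = (\<Sum>i\<in>I. c i *\<^sub>R dird h x (w i))"
  using assms(4,5)
proof (induction I rule: finite_induct)
  case empty
  show ?case using dird_linear(3)[OF assms(1-3,3,3)] by simp
next
  case (insert i I)
  have "(\<Sum>i\<in>I. c i *\<^sub>R w i) \<in> V"
    by (intro subspace_sum[OF assms(1)] subspace_scale[OF assms(1)]) (use insert in auto)
  then show ?case using insert
    by (simp add: dird_linear[OF assms(1-3)] subspace_scale[OF assms(1)])
qed

text \<open>
  The mean value theorem, applied first along \<open>v\<close> and then along \<open>w\<close>.  The left-hand side is symmetric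
  in \<open>v\<close> and \<open>w\<close>; the limit \<open>e \<rightarrow> 0\<close> thus yields the symmetry of second derivatives.
\<close>

lemma mean_value_second_difference:
  fixes h :: "'e::real_normed_vector \<Rightarrow> real"
  assumes V: "subspace V" and h: "smooth_on V h" and xvw: "x \<in> V" "v \<in> V" "w \<in> V" and e: "e > 0"
  shows "\<exists>s t. 0 < s \<and> s < e \<and> 0 < t \<and> t < e \<and>
    h (x + e *\<^sub>R v + e *\<^sub>R w) - h (x + e *\<^sub>R v) - h (x + e *\<^sub>R w) + h x
      = e\<^sup>2 * dird (\<lambda>y. dird h y v) (x + s *\<^sub>R v + t *\<^sub>R w) w"
proof -
  note [simp] = subspace_add[OF V] subspace_scale[OF V] xvw
  define \<phi> where "\<phi> s = h (x + s *\<^sub>R v + e *\<^sub>R w) - h (x + s *\<^sub>R v)" for s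
  have "(\<phi> has_real_derivative
      dird h (x + s *\<^sub>R v + e *\<^sub>R w) v - dird h (x + s *\<^sub>R v) v) (at s)" for s
    unfolding \<phi>_def
    using smooth_on_line_real[OF V h, of "x + e *\<^sub>R w" v s] smooth_on_line_real[OF V h, of x v s]
    by (intro DERIV_diff) (simp_all add: algebra_simps)
  from MVT2[OF e this] obtain s where s: "0 < s" "s < e"
    "\<phi> e - \<phi> 0 = e * (dird h (x + s *\<^sub>R v + e *\<^sub>R w) v - dird h (x + s *\<^sub>R v) v)"
    by auto
  have "((\<lambda>t. dird h (x + s *\<^sub>R v + t *\<^sub>R w) v) has_real_derivative
      dird (\<lambda>y. dird h y v) (x + s *\<^sub>R v + t *\<^sub>R w) w) (at t)" for t
    by (rule smooth_on_line_real[OF V smooth_on_dird[OF h]]) auto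
  from MVT2[OF e this] obtain t where t: "0 < t" "t < e"
    "dird h (x + s *\<^sub>R v + e *\<^sub>R w) v - dird h (x + s *\<^sub>R v + 0 *\<^sub>R w) v
       = e * dird (\<lambda>y. dird h y v) (x + s *\<^sub>R v + t *\<^sub>R w) w"
    by (metis diff_zero)
  have "\<phi> e - \<phi> 0 = e\<^sup>2 * dird (\<lambda>y. dird h y v) (x + s *\<^sub>R v + t *\<^sub>R w) w"
    using s(3) t(3) by (simp add: power2_eq_square)
  then have "h (x + e *\<^sub>R v + e *\<^sub>R w) - h (x + e *\<^sub>R v) - h (x + e *\<^sub>R w) + h x
      = e\<^sup>2 * dird (\<lambda>y. dird h y v) (x + s *\<^sub>R v + t *\<^sub>R w) w"
    by (simp add: \<phi>_def)
  then show ?thesis using s(1,2) t(1,2) by blast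
qed

lemma dird_symmetric:
  fixes h :: "'e::real_normed_vector \<Rightarrow> real"
  assumes V: "subspace V" and h: "smooth_on V h" and xvw: "x \<in> V" "v \<in> V" "w \<in> V"
  shows "hess h x w v = hess h x v w"
proof -
  note [simp] = subspace_add[OF V] subspace_scale[OF V] xvw
  define \<Delta> where "\<Delta> e = h (x + e *\<^sub>R v + e *\<^sub>R w) - h (x + e *\<^sub>R v) - h (x + e *\<^sub>R w) + h x" for e
  define e where "e n = inverse (real (Suc n))" for n
  have e: "e n > 0" for n by (simp add: e_def)
  have e0: "e \<longlonglongrightarrow> 0" unfolding e_def by (rule LIMSEQ_inverse_real_of_nat)
  have lim: "(\<lambda>n. \<Delta> (e n) / (e n)\<^sup>2) \<longlonglongrightarrow> hess h x b a"
    if ab: "a \<in> V" "b \<in> V"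
      and \<Delta>: "\<And>e. \<Delta> e = h (x + e *\<^sub>R a + e *\<^sub>R b) - h (x + e *\<^sub>R a) - h (x + e *\<^sub>R b) + h x" for a b
  proof -
    have "\<forall>n. \<exists>s t. 0 < s \<and> s < e n \<and> 0 < t \<and> t < e n \<and>
       \<Delta> (e n) = (e n)\<^sup>2 * dird (\<lambda>y. dird h y a) (x + s *\<^sub>R a + t *\<^sub>R b) b"
      unfolding \<Delta> using mean_value_second_difference[OF V h xvw(1) ab e] by blast
    then obtain s t where st: "\<And>n. 0 < s n" "\<And>n. s n < e n" "\<And>n. 0 < t n" "\<And>n. t n < e n"
      "\<And>n. \<Delta> (e n) = (e n)\<^sup>2 * dird (\<lambda>y. dird h y a) (x + s n *\<^sub>R a + t n *\<^sub>R b) b"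
      by metis
    have "s \<longlonglongrightarrow> 0" "t \<longlonglongrightarrow> 0"
      by (rule real_tendsto_sandwich[OF _ _ tendsto_const e0];
          use st in \<open>auto intro!: always_eventually less_imp_le\<close>)+
    then have "(\<lambda>n. x + s n *\<^sub>R a + t n *\<^sub>R b) \<longlonglongrightarrow> x + 0 *\<^sub>R a + 0 *\<^sub>R b"
      by (intro tendsto_intros)
    moreover have "continuous_on V (\<lambda>y. hess h y b a)"
      using smooth_on_dird[OF smooth_on_dird[OF h ab(1)] ab(2)] by (rule smooth_on_imp_continuous_on)
    ultimately have "(\<lambda>n. dird (\<lambda>y. dird h y a) (x + s n *\<^sub>R a + t n *\<^sub>R b) b)
        \<longlonglongrightarrow> hess h x b a"
      using ab by (auto simp: continuous_on_sequentially o_def)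
    moreover have "\<Delta> (e n) / (e n)\<^sup>2 = dird (\<lambda>y. dird h y a) (x + s n *\<^sub>R a + t n *\<^sub>R b) b" for n
      using st(5)[of n] e[of n] by simp
    ultimately show ?thesis by simp
  qed
  show ?thesis
    by (rule LIMSEQ_unique[OF lim lim]) (auto simp: \<Delta>_def algebra_simps)
qed

text \<open>
  Taylor expansion of order two along the line through \<open>0\<close> and \<open>x\<close>, integrated step by step.
\<close>

lemma quadratic_on_subspace:
  fixes h :: "'e::real_normed_vector \<Rightarrow> real"
  assumes V: "subspace V" and h: "smooth_on V h"
    and third: "\<And>x v. x \<in> V \<Longrightarrow> v \<in> V \<Longrightarrow> hess (\<lambda>y. dird h y v) x v v = 0"
    and x: "x \<in> V"
  shows "h x = h 0 + dird h 0 x + hess h 0 x x / 2"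
proof -
  have V0: "0 \<in> V" by (simp add: V subspace_0)
  note h1 = smooth_on_dird[OF h x] note h2 = smooth_on_dird[OF h1 x]
  define c where "c = hess h 0 x x"
  note d0 = smooth_on_line_real[OF V h V0 x, simplified]
  note d1 = smooth_on_line_real[OF V h1 V0 x, simplified]
  note d2 = smooth_on_line_real[OF V h2 V0 x, simplified]
  have tx: "t *\<^sub>R x \<in> V" for t using V x by (simp add: subspace_scale)
  have c: "dird (\<lambda>y. dird h y x) (t *\<^sub>R x) x = c" for t
    using DERIV_isconst_all[of "\<lambda>t. dird (\<lambda>y. dird h y x) (t *\<^sub>R x) x" t 0] d2 third[OF tx x]
    by (simp add: c_def)
  have "((\<lambda>t. dird h (t *\<^sub>R x) x - c * t) has_real_derivative 0) (at t)" for t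
    using d1[of t] by (auto intro!: derivative_eq_intros simp: c)
  from DERIV_isconst_all[OF allI[OF this], of _ 0]
  have l: "dird h (t *\<^sub>R x) x = dird h 0 x + c * t" for t by (simp add: algebra_simps)
  have "((\<lambda>t. h (t *\<^sub>R x) - dird h 0 x * t - c * t\<^sup>2 / 2) has_real_derivative 0) (at t)" for t
    using d0[of t] by (auto intro!: derivative_eq_intros simp: l)
  from DERIV_isconst_all[OF allI[OF this], of 1 0]
  show ?thesis by (simp add: c_def)
qed

section \<open>The Hermitian product\<close>

lemma scaleR_complex: "r *\<^sub>R c = of_real r * (c :: complex)"
  by (rule scaleR_conv_of_real)

lemma scaleR_eq_smult: "r *\<^sub>R z = complex_of_real r *s z" for z :: "complex^'m"
  by (simp add: vec_eq_iff scaleR_complex)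

lemma herm_simps:
  "herm (z + z') w = herm z w + herm z' w" "herm z (w + w') = herm z w + herm z w'"
  "herm (z - z') w = herm z w - herm z' w" "herm z (w - w') = herm z w - herm z w'"
  "herm (- z) w = - herm z w" "herm z (- w) = - herm z w"
  "herm (c *s z) w = cnj c * herm z w" "herm z (c *s w) = c * herm z w"
  "herm (r *\<^sub>R z) w = of_real r * herm z w" "herm z (r *\<^sub>R w) = of_real r * herm z w"
  "herm 0 w = 0" "herm z 0 = 0"
  by (simp_all add: herm_def sum.distrib sum_subtractf sum_negf sum_distrib_left algebra_simps
      scaleR_complex)

lemma cnj_herm: "cnj (herm z w) = herm w z"
  by (simp add: herm_def mult.commute)

lemma Re_herm: "Re (herm z w) = z \<bullet> w"
  by (simp add: herm_def inner_vec_def inner_complex_def)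

lemma herm_self: "herm z z = of_real (z \<bullet> z)"
  by (metis cnj_herm Re_herm Reals_cnj_iff of_real_Re)

lemma Im_herm: "Im (herm z w) = (\<i> *s z) \<bullet> w"
  by (simp add: herm_simps flip: Re_herm)

lemma inner_i: "(\<i> *s z) \<bullet> w = - (z \<bullet> (\<i> *s w))"
  by (simp add: herm_simps flip: Re_herm)

lemma i_i [simp]: "\<i> *s (\<i> *s z) = - z" for z :: "complex^'m"
  by (simp add: vec_eq_iff)

lemma norm_smult: "norm (c *s z) = norm c * norm z" for z :: "complex^'m"
proof -
  have "complex_of_real ((c *s z) \<bullet> (c *s z)) = of_real ((norm c)\<^sup>2 * (z \<bullet> z))"
    unfolding of_real_mult herm_self[symmetric] herm_simps complex_norm_square by simp
  then have "(norm (c *s z))\<^sup>2 = (norm c * norm z)\<^sup>2"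
    unfolding power_mult_distrib dot_square_norm[symmetric] of_real_eq_iff .
  then show ?thesis by simp
qed

lemma bounded_bilinear_smult: "bounded_bilinear (\<lambda>(c::complex) (z::complex^'m). c *s z)"
  by (rule bounded_bilinear.intro)
    (auto simp: vec_eq_iff algebra_simps scaleR_complex norm_smult intro!: exI[of _ 1])

lemma norm_herm_le: "norm (herm z w) \<le> norm z * norm w * of_nat CARD('m)" for z w :: "complex^'m"
proof -
  have "norm (herm z w) \<le> (\<Sum>i\<in>(UNIV::'m set). norm (cnj (z $ i) * w $ i))"
    unfolding herm_def by (rule norm_sum)
  also have "\<dots> \<le> (\<Sum>i\<in>(UNIV::'m set). norm z * norm w)"
    by (intro sum_mono) (auto simp: norm_mult intro!: mult_mono Finite_Cartesian_Product.norm_nth_le)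
  finally show ?thesis by (simp add: mult_ac)
qed

lemma bounded_bilinear_herm: "bounded_bilinear (herm :: complex^'m \<Rightarrow> _)"
  by (rule bounded_bilinear.intro)
    (auto simp: herm_simps scaleR_complex intro: exI[of _ "of_nat CARD('m)"] norm_herm_le)

lemmas herm_vector_derivative = bounded_bilinear.has_vector_derivative[OF bounded_bilinear_herm]
lemmas smult_vector_derivative = bounded_bilinear.has_vector_derivative[OF bounded_bilinear_smult]

lemma herm_eqI: "(\<And>z. herm z a = herm z b) \<Longrightarrow> a = b"
  using herm_self[of "a - b"] by (simp add: herm_simps)

section \<open>Hermitian operators\<close>

definition hermitian :: "(complex^'m \<Rightarrow> complex^'m) \<Rightarrow> bool" where
  "hermitian A \<longleftrightarrow> (\<forall>z w. herm z (A w) = herm (A z) w)"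

text \<open>
  A map with a formal adjoint is automatically complex linear.
\<close>

lemma hermitian_add: "hermitian A \<Longrightarrow> A (z + w) = A z + A w"
  by (rule herm_eqI) (simp add: hermitian_def herm_simps)

lemma hermitian_smult: "hermitian A \<Longrightarrow> A (c *s w) = c *s A w"
  by (rule herm_eqI) (simp add: hermitian_def herm_simps)

lemma hermitian_bounded_linear: "hermitian A \<Longrightarrow> bounded_linear A"
  by (simp add: linear_conv_bounded_linear[symmetric] linear_iff hermitian_add hermitian_smult
      scaleR_eq_smult)

lemma hermitian_inner: "hermitian A \<Longrightarrow> z \<bullet> A w = A z \<bullet> w"
  by (simp add: hermitian_def flip: Re_herm)

lemma hermitian_herm_self: "hermitian A \<Longrightarrow> herm z (A z) = of_real (z \<bullet> A z)"
  by (metis hermitian_def cnj_herm Re_herm Reals_cnj_iff of_real_Re)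

text \<open>
  The real part of \<open>\<langle>z, w\<rangle>\<close> is the inner product, so a symmetric real form is represented by a
  symmetric real linear operator; the invariance under \<open>i\<close> makes it commute with \<open>i\<close>.
\<close>

lemma hermitian_of_invariant_form:
  fixes b :: "complex^'m \<Rightarrow> complex^'m \<Rightarrow> real"
  assumes bil: "bilinear b" and sym: "\<And>z w. b z w = b w z"
    and inv: "\<And>z w. b (\<i> *s z) (\<i> *s w) = b z w"
  obtains A where "hermitian A" "\<And>z w. z \<bullet> A w = b z w"
proof -
  define A where "A w = (\<Sum>e\<in>Basis. b e w *\<^sub>R e)" for w
  have A: "z \<bullet> A w = b z w" for z w
  proof -
    have "b (\<Sum>e\<in>Basis. (z \<bullet> e) *\<^sub>R e) w = (\<Sum>e\<in>Basis. (z \<bullet> e) * b e w)"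
      using linear_sum[of "\<lambda>z. b z w" "\<lambda>e. (z \<bullet> e) *\<^sub>R e" Basis]
        linear_cmul[of "\<lambda>z. b z w"] bil
      unfolding bilinear_def by (simp del: euclidean_representation)
    then show ?thesis by (simp add: A_def inner_sum_right euclidean_representation mult.commute)
  qed
  have neg: "b (\<i> *s z) w = - b z (\<i> *s w)" for z w
    using inv[of z "\<i> *s w"] bil by (simp add: bilinear_rneg)
  have "herm z (A w) = herm (A z) w" for z w
  proof (rule complex_eqI)
    show "Re (herm z (A w)) = Re (herm (A z) w)"
      by (simp add: Re_herm A sym inner_commute[of "A z"])
    show "Im (herm z (A w)) = Im (herm (A z) w)"
      by (simp add: Im_herm A inner_i neg inner_commute[of "A z"] sym[of z])
  qed
  then show ?thesis using that A by (auto simp: hermitian_def)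
qed

definition rayleigh :: "(complex^'m \<Rightarrow> complex^'m) \<Rightarrow> complex^'m \<Rightarrow> real" where
  "rayleigh A z = (z \<bullet> A z) / (z \<bullet> z)"

lemma rayleigh_smult:
  assumes "hermitian A" "c \<noteq> 0" shows "rayleigh A (c *s z) = rayleigh A z"
proof -
  have "(c *s z) \<bullet> (c *s w) = (cmod c)\<^sup>2 * (z \<bullet> w)" for w
  proof -
    have "herm (c *s z) (c *s w) = of_real ((cmod c)\<^sup>2) * herm z w"
      unfolding herm_simps complex_norm_square by simp
    then show ?thesis by (simp flip: Re_herm of_real_power)
  qed
  then show ?thesis using assms by (simp add: rayleigh_def hermitian_smult)
qed

section \<open>The Fubini-Study structure in the affine charts\<close>

text \<open>
  The Fubini-Study Hermitian form at \<open>[u + x]\<close> in the coordinates of the chart; it no longer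
  depends on \<open>u\<close>.
\<close>

definition fs_form :: "complex^'m \<Rightarrow> complex^'m \<Rightarrow> complex^'m \<Rightarrow> complex" where
  "fs_form x v w = herm v w / of_real (nsq x)
     - herm v x * herm x w / (of_real (nsq x))\<^sup>2"

definition fs_model :: "complex^'m \<Rightarrow> (complex^'m) set" where
  "fs_model u = {x. herm u x = 0}"

lemma subspace_fs_model: "subspace (fs_model u)"
  by (auto simp: subspace_def fs_model_def herm_simps)

lemma fs_model_smult: "x \<in> fs_model u \<Longrightarrow> c *s x \<in> fs_model u"
  by (simp add: fs_model_def herm_simps)

lemma one_plus_inner_pos: "nsq x > (0::real)" for x :: "'a::real_inner"
  using inner_ge_zero[of x] by linarith

lemma chart_norm:
  assumes "norm u = 1" "x \<in> fs_model u"
  shows "(u + x) \<bullet> (u + x) = nsq x"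
proof -
  have "u \<bullet> x = 0" using assms(2) Re_herm[of u x] by (simp add: fs_model_def)
  moreover have "u \<bullet> u = 1" using assms(1) by (simp add: dot_square_norm)
  ultimately show ?thesis by (simp add: inner_add inner_commute)
qed

lemma chart_nonzero:
  assumes "norm u = 1" "x \<in> fs_model u"
  shows "u + x \<noteq> 0"
  using chart_norm[OF assms] one_plus_inner_pos[of x] by auto

text \<open>
  Up to the factor \<open>1 / \<bar>u + x\<bar>\<close>, the tangent vector is the component of \<open>v\<close> orthogonal to \<open>u + x\<close>.
\<close>

lemma cproj_tangent_eq:
  assumes u: "norm u = 1" and x: "x \<in> fs_model u" and v: "v \<in> fs_model u"
  defines "s \<equiv> nsq x"
  shows "cproj_tangent u x v
    = of_real (1 / sqrt s) *s (v - (herm x v / of_real s) *s (u + x))"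
proof -
  have s: "s > 0" by (simp add: s_def one_plus_inner_pos)
  define u' where "u' = sgn (u + x)"
  have n: "norm (u + x) = sqrt s"
    using chart_norm[OF u x] by (simp add: s_def norm_eq_sqrt_inner)
  have hu': "herm u' (u + (x + t *\<^sub>R v)) = of_real (sqrt s) + t *\<^sub>R (herm x v / of_real (sqrt s))" for t
  proof -
    have zz: "herm (u + x) (u + x) = of_real s"
      using chart_norm[OF u x] by (simp add: herm_self s_def)
    have zv: "herm (u + x) v = herm x v" using v by (simp add: fs_model_def herm_simps)
    have "herm (u + x) (u + (x + t *\<^sub>R v)) = of_real s + of_real t * herm x v"
      unfolding add.assoc[symmetric] herm_simps(2)[of _ "u + x"] zz herm_simps(10) zv ..
    moreover have "of_real (sqrt s) * of_real (sqrt s) = (of_real s :: complex)"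
      using s by (simp flip: of_real_mult)
    ultimately show ?thesis
      using s unfolding u'_def sgn_div_norm n herm_simps(9) scaleR_complex
      by (simp add: field_simps)
  qed
  have "((\<lambda>t. cproj_chart u' (u + (x + t *\<^sub>R v))) has_vector_derivative
      (1 / of_real (sqrt s)) *s v
       + (- (herm x v / of_real (sqrt s)) / (of_real (sqrt s))\<^sup>2) *s (u + x)) (at 0)"
  proof -
    have 1: "((\<lambda>t. 1 / (of_real (sqrt s) + t *\<^sub>R (herm x v / of_real (sqrt s)))) has_vector_derivative
       - (herm x v / of_real (sqrt s)) / (of_real (sqrt s))\<^sup>2) (at 0)"
      using s unfolding has_vector_derivative_def
      by (auto intro!: derivative_eq_intros simp: fun_eq_iff power2_eq_square divide_inverse
          scaleR_complex)
    have 2: "((\<lambda>t. u + (x + t *\<^sub>R v)) has_vector_derivative v) (at 0)"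
      by (auto intro!: derivative_eq_intros)
    show ?thesis
      unfolding cproj_chart_def hu'
      using has_vector_derivative_diff[OF smult_vector_derivative[OF 1 2]
          has_vector_derivative_const[of u']]
      by (simp only: scaleR_zero_left add_0_right diff_0_right)
  qed
  then have "cproj_tangent u x v = (1 / of_real (sqrt s)) *s v
       + (- (herm x v / of_real (sqrt s)) / (of_real (sqrt s))\<^sup>2) *s (u + x)"
    unfolding cproj_tangent_def u'_def[symmetric] by (rule dird_eqI)
  also have "(of_real (sqrt s) :: complex)\<^sup>2 = of_real s" using s by (simp flip: of_real_power)
  finally show ?thesis by (simp add: vec_eq_iff field_simps)
qed

lemma herm_cproj_tangent:
  assumes u: "norm u = 1" and x: "x \<in> fs_model u" and v: "v \<in> fs_model u" and w: "w \<in> fs_model u"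
  shows "herm (cproj_tangent u x v) (cproj_tangent u x w) = fs_form x v w"
proof -
  define s where "s = nsq x"
  have s: "s > 0" by (simp add: s_def one_plus_inner_pos)
  have zz: "herm (u + x) (u + x) = of_real s"
    using chart_norm[OF u x] by (simp add: herm_self s_def)
  have zw: "herm (u + x) w = herm x w" using w by (simp add: fs_model_def herm_simps)
  have vz: "herm v (u + x) = herm v x"
    using v cnj_herm[of u v] by (simp add: fs_model_def herm_simps)
  have "herm (v - (herm x v / of_real s) *s (u + x)) (w - (herm x w / of_real s) *s (u + x))
     = herm v w - herm v x * herm x w / of_real s"
    unfolding herm_simps(3,4,7,8) zz zw vz using s by (simp add: cnj_herm)
  moreover have "of_real (sqrt s) * of_real (sqrt s) = (of_real s :: complex)"
    using s by (simp flip: of_real_mult)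
  ultimately show ?thesis
    using s unfolding cproj_tangent_eq[OF u x v] cproj_tangent_eq[OF u x w] fs_form_def
      s_def[symmetric] herm_simps(7)[of "of_real _"] herm_simps(8)[of _ "of_real _"]
    by (simp add: field_simps power2_eq_square)
qed

lemma fubini_study_simps:
  "charts fubini_study = sphere 0 1" "model fubini_study = fs_model"
  "param fubini_study = (\<lambda>u x. pr (u + x))"
  "metric fubini_study u x v w = Re (herm (cproj_tangent u x v) (cproj_tangent u x w))"
  "sympl fubini_study u x v w = Im (herm (cproj_tangent u x v) (cproj_tangent u x w))"
  by (simp_all add: fubini_study_def fs_model_def fun_eq_iff)

lemma fs_form_simps:
  "fs_form x (v + v') w = fs_form x v w + fs_form x v' w"
  "fs_form x v (w + w') = fs_form x v w + fs_form x v w'"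
  "fs_form x (v - v') w = fs_form x v w - fs_form x v' w"
  "fs_form x v (w - w') = fs_form x v w - fs_form x v w'"
  "fs_form x (c *s v) w = cnj c * fs_form x v w"
  "fs_form x v (c *s w) = c * fs_form x v w"
  "fs_form x (r *\<^sub>R v) w = of_real r * fs_form x v w"
  "fs_form x v (r *\<^sub>R w) = of_real r * fs_form x v w"
  by (simp_all add: fs_form_def herm_simps algebra_simps add_divide_distrib diff_divide_distrib)

lemma one_plus_inner_complex: "(1 + of_real (x \<bullet> x) :: complex) \<noteq> 0" for x :: "'a::real_inner"
  using one_plus_inner_pos[of x] by (metis of_real_1 of_real_add of_real_eq_0_iff less_irrefl)

lemma fs_form_base:
  "fs_form x x w = herm x w / (of_real (nsq x))\<^sup>2"
  "fs_form x v x = herm v x / (of_real (nsq x))\<^sup>2"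
proof -
  define s where "s = complex_of_real (nsq x)"
  have s: "s \<noteq> 0" "herm x x = s - 1"
    using one_plus_inner_complex[of x] by (simp_all add: s_def herm_self)
  show "fs_form x x w = herm x w / (of_real (nsq x))\<^sup>2"
    "fs_form x v x = herm v x / (of_real (nsq x))\<^sup>2"
    unfolding fs_form_def s_def[symmetric] s(2) using s(1)
    by (simp_all add: field_simps power2_eq_square)
qed

text \<open>
  The form is inverted by \<open>v \<mapsto> v + \<langle>x, v\<rangle> x\<close>, up to the factor \<open>1 + \<bar>x\<bar>\<^sup>2\<close>.  This gives both the
  nondegeneracy of the symplectic form and explicit Hamiltonian fields.
\<close>

lemma fs_form_sharp:
  "fs_form x (v + herm x v *s x) w = herm v w / of_real (nsq x)"
  "fs_form x v (w + herm x w *s x) = herm v w / of_real (nsq x)"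
  by (simp_all add: fs_form_simps fs_form_base cnj_herm)
    (simp_all add: fs_form_def)

lemma fs_ham_unique:
  assumes u: "norm u = 1" and x: "x \<in> fs_model u" and X: "X \<in> fs_model u"
    and eq: "\<And>v. v \<in> fs_model u \<Longrightarrow> Im (fs_form x X v) = dird (\<lambda>y. f (pr (u + y))) x v"
  shows "ham fubini_study f u x = X"
  unfolding ham_def fubini_study_simps
proof (rule the_equality)
  show "X \<in> fs_model u \<and> (\<forall>v\<in>fs_model u. Im (herm (cproj_tangent u x X) (cproj_tangent u x v))
      = dird (f \<circ> (\<lambda>x. pr (u + x))) x v)"
    using X eq herm_cproj_tangent[OF u x X] by (simp add: o_def)
next
  fix Y assume Y: "Y \<in> fs_model u \<and> (\<forall>v\<in>fs_model u. Im (herm (cproj_tangent u x Y) (cproj_tangent u x v))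
      = dird (f \<circ> (\<lambda>x. pr (u + x))) x v)"
  define Z where "Z = Y - X"
  have Z: "Z \<in> fs_model u" unfolding Z_def using Y X subspace_fs_model by (auto intro: subspace_diff)
  define v where "v = \<i> *s (Z + herm x Z *s x)"
  have v: "v \<in> fs_model u" unfolding v_def
    using Z x by (auto intro!: fs_model_smult subspace_add subspace_fs_model)
  have "Im (fs_form x Z v) = 0"
    unfolding Z_def fs_form_simps using eq[OF v] Y[THEN conjunct2, rule_format, OF v] herm_cproj_tangent[OF u x _ v, of Y] Y
    by (simp add: o_def)
  moreover have "fs_form x Z v = \<i> * (herm Z Z / of_real (nsq x))"
    unfolding v_def fs_form_simps(6) fs_form_sharp ..
  ultimately have "Im (\<i> * complex_of_real (Z \<bullet> Z / nsq x)) = 0"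
    by (simp add: herm_self)
  then have "Z \<bullet> Z / nsq x = 0"
    by (simp only: Im_i_times Re_complex_of_real)
  then show "Y = X" using one_plus_inner_pos[of x] by (simp add: Z_def)
qed

lemma dird_one_plus_inner_mult:
  fixes \<phi> :: "'e::euclidean_space \<Rightarrow> real"
  assumes V: "subspace V" and \<phi>: "smooth_on V \<phi>" and "x \<in> V" "v \<in> V"
  shows "dird (\<lambda>y. (nsq y) * \<phi> y) x v = (nsq x) * dird \<phi> x v + 2 * (x \<bullet> v) * \<phi> x"
proof (rule dird_eqI)
  show "((\<lambda>t. (nsq (x + t *\<^sub>R v)) * \<phi> (x + t *\<^sub>R v)) has_vector_derivative
      (nsq x) * dird \<phi> x v + 2 * (x \<bullet> v) * \<phi> x) (at 0)"
    using smooth_on_line_real[OF assms, of 0]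
    unfolding has_real_derivative_iff_has_vector_derivative[symmetric] inner_add inner_scaleR_left inner_scaleR_right
    by (auto intro!: derivative_eq_intros simp: inner_commute algebra_simps)
qed

text \<open>
  In terms of the homogenized function \<open>h = (1 + \<bar>x\<bar>\<^sup>2) f\<close> the Hamiltonian field has no denominators.
\<close>

lemma fs_ham_eq:
  fixes f :: "'m::finite cproj \<Rightarrow> real"
  assumes u: "norm u = 1" and sm: "smooth_on (fs_model u) (\<lambda>y. f (pr (u + y)))"
    and x: "x \<in> fs_model u" and B: "B \<in> fs_model u"
  defines "h \<equiv> (\<lambda>y. (nsq y) * f (pr (u + y)))"
  assumes grad: "\<And>v. v \<in> fs_model u \<Longrightarrow> B \<bullet> v = dird h x v"
  shows "ham fubini_study f u x = (- \<i>) *s (B + herm x B *s x - (2 * h x) *\<^sub>R x)"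
proof (rule fs_ham_unique[OF u x])
  show "(- \<i>) *s (B + herm x B *s x - (2 * h x) *\<^sub>R x) \<in> fs_model u"
    using B x by (intro fs_model_smult subspace_diff subspace_add subspace_scale subspace_fs_model)
next
  fix v assume v: "v \<in> fs_model u"
  define s where "s = nsq x"
  have s: "s > 0" by (simp add: s_def one_plus_inner_pos)
  have "Im (fs_form x ((- \<i>) *s (B + herm x B *s x - (2 * h x) *\<^sub>R x)) v)
      = Re (herm B v / of_real s - of_real (2 * h x) * (herm x v / (of_real s)\<^sup>2))"
    unfolding fs_form_simps(3,5,7) fs_form_sharp fs_form_base s_def[symmetric] by simp
  also have "\<dots> = B \<bullet> v / s - 2 * h x * (x \<bullet> v) / s\<^sup>2"
    by (simp add: Re_herm Re_divide_of_real flip: of_real_power of_real_mult)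
  also have "\<dots> = dird (\<lambda>y. f (pr (u + y))) x v"
    unfolding grad[OF v]  using s
    unfolding h_def dird_one_plus_inner_mult[OF subspace_fs_model sm x v] s_def[symmetric]
    by (simp add: field_simps power2_eq_square)
  finally show "Im (fs_form x ((- \<i>) *s (B + herm x B *s x - (2 * h x) *\<^sub>R x)) v)
    = dird (\<lambda>y. f (pr (u + y))) x v" .
qed

text \<open>
  The gradient \<open>B\<close> of \<open>h\<close> within the subspace and its derivative \<open>S\<close>, both written in an orthonormal
  basis so that the differentiability of \<open>B\<close> follows from that of the directional derivatives of \<open>h\<close>.
\<close>

lemma subspace_gradient:
  fixes h :: "'e::euclidean_space \<Rightarrow> real"
  assumes V: "subspace V" and h: "smooth_on V h"
  obtains B S where "\<forall>x\<in>V. B x \<in> V" "\<forall>x\<in>V. \<forall>v\<in>V. B x \<bullet> v = dird h x v"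
    "\<forall>x\<in>V. \<forall>v\<in>V. S x v \<in> V" "\<forall>x\<in>V. \<forall>v\<in>V. \<forall>w\<in>V. S x v \<bullet> w = hess h x v w"
    "\<forall>x\<in>V. \<forall>v\<in>V. ((\<lambda>t. B (x + t *\<^sub>R v)) has_vector_derivative S x v) (at 0)"
proof -
  obtain E where E: "E \<subseteq> V" "pairwise orthogonal E" "\<And>e. e \<in> E \<Longrightarrow> norm e = 1"
      "independent E" "span E = V"
    using orthonormal_basis_subspace[OF V] by metis
  have fin: "finite E" using E(4) by (simp add: independent_imp_finite)
  define B where "B x = (\<Sum>e\<in>E. dird h x e *\<^sub>R e)" for x
  define S where "S x v = (\<Sum>e\<in>E. hess h x v e *\<^sub>R e)" for x v
  have on: "e \<bullet> e' = (if e = e' then 1 else 0)" if "e \<in> E" "e' \<in> E" for e e'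
    using that E(2,3) by (auto simp: pairwise_def orthogonal_def dot_square_norm)
  have rep: "(\<Sum>e\<in>E. (v \<bullet> e) *\<^sub>R e) = v" if v: "v \<in> V" for v
  proof -
    obtain c where c: "v = (\<Sum>e\<in>E. c e *\<^sub>R e)"
      using v E(5) span_finite[OF fin] by auto
    have "v \<bullet> e' = c e'" if "e' \<in> E" for e'
      using that fin by (simp add: c inner_sum_left on if_distrib cong: if_cong)
    then show ?thesis using c by simp
  qed
  show ?thesis
  proof (rule that[of B S]; intro ballI)
    show "B x \<in> V" if "x \<in> V" for x
      unfolding B_def using E(1) by (intro subspace_sum[OF V] subspace_scale[OF V]) auto
    show "S x v \<in> V" if "x \<in> V" "v \<in> V" for x v
      unfolding S_def using E(1) by (intro subspace_sum[OF V] subspace_scale[OF V]) auto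
    show "B x \<bullet> v = dird h x v" if x: "x \<in> V" and v: "v \<in> V" for x v
    proof -
      have "dird h x v = dird h x (\<Sum>e\<in>E. (v \<bullet> e) *\<^sub>R e)" by (simp add: rep[OF v])
      also have "\<dots> = B x \<bullet> v"
        using dird_sum[OF V h x fin, of "\<lambda>e. e" "\<lambda>e. v \<bullet> e"] E(1)
        by (simp add: B_def inner_sum_left inner_commute[of v] mult.commute subset_eq)
      finally show ?thesis ..
    qed
    show "S x v \<bullet> w = hess h x v w" if x: "x \<in> V" and v: "v \<in> V" and w: "w \<in> V" for x v w
    proof -
      have *: "hess h x v a = hess h x a v" if "a \<in> V" for a
        using dird_symmetric[OF V h x that v] .
      have "hess h x w v = hess h x (\<Sum>e\<in>E. (w \<bullet> e) *\<^sub>R e) v"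
        by (simp add: rep[OF w])
      also have "\<dots> = S x v \<bullet> w"
        using dird_sum[OF V smooth_on_dird[OF h v] x fin, of "\<lambda>e. e" "\<lambda>e. w \<bullet> e"] E(1) *
        by (simp add: S_def inner_sum_left inner_commute[of w] mult.commute subset_eq)
      finally show ?thesis using *[OF w] by simp
    qed
    show "((\<lambda>t. B (x + t *\<^sub>R v)) has_vector_derivative S x v) (at 0)" if "x \<in> V" "v \<in> V" for x v
      unfolding B_def S_def
    proof (intro has_vector_derivative_sum)
      fix e assume "e \<in> E"
      then have "((\<lambda>t. dird h (x + t *\<^sub>R v) e) has_vector_derivative hess h x v e) (at 0)"
        using smooth_on_line[OF V smooth_on_dird[OF h] that, of e 0] E(1) by auto
      then show "((\<lambda>t. dird h (x + t *\<^sub>R v) e *\<^sub>R e) has_vector_derivative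
          hess h x v e *\<^sub>R e) (at 0)"
        by (auto intro!: derivative_eq_intros simp: has_real_derivative_iff_has_vector_derivative)
    qed
  qed
qed

lemma smooth_on_homogenized:
  fixes V :: "'e::euclidean_space set"
  assumes V: "subspace V" and "smooth_on V \<phi>"
  shows "smooth_on V (\<lambda>y. (nsq y) * \<phi> y)"
  by (intro smooth_on_mult smooth_on_add smooth_on_const smooth_on_inner assms bounded_linear_ident)

lemma fs_metric_deriv:
  "((\<lambda>t. Re (fs_form (x + t *\<^sub>R \<xi>) v w)) has_vector_derivative
     Re (- herm v w * of_real (2 * (x \<bullet> \<xi>)) / (of_real (nsq x))\<^sup>2
      - (herm v \<xi> * herm x w + herm v x * herm \<xi> w) / (of_real (nsq x))\<^sup>2
      + herm v x * herm x w * of_real (4 * (x \<bullet> \<xi>)) / (of_real (nsq x))^3)) (at 0)"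
proof -
  define s where "s = nsq x"
  have s: "s > 0" by (simp add: s_def one_plus_inner_pos)
  define c where "c = x \<bullet> \<xi>"
  define d where "d = \<xi> \<bullet> \<xi>"
  have *: "nsq (x + t *\<^sub>R \<xi>) = s + 2 * t * c + t\<^sup>2 * d" for t
    by (simp add: s_def c_def d_def inner_add inner_commute power2_eq_square)
  have **: "fs_form (x + t *\<^sub>R \<xi>) v w = herm v w * of_real (1 / (s + 2 * t * c + t\<^sup>2 * d))
     - (herm v x + of_real t * herm v \<xi>) * (herm x w + of_real t * herm \<xi> w)
        * of_real ((1 / (s + 2 * t * c + t\<^sup>2 * d))\<^sup>2)" for t
    by (simp add: fs_form_def * herm_simps power_divide)
  have R: "((\<lambda>t. 1 / (s + 2 * t * c + t\<^sup>2 * d)) has_real_derivative - (2 * c) / s\<^sup>2) (at 0)"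
    using s by (auto intro!: derivative_eq_intros simp: power2_eq_square)
  have R2: "((\<lambda>t. (1 / (s + 2 * t * c + t\<^sup>2 * d))\<^sup>2) has_real_derivative - (4 * c) / s^3) (at 0)"
    using s by (auto intro!: derivative_eq_intros R simp: field_simps power2_eq_square power3_eq_cube)
  have "((\<lambda>t. fs_form (x + t *\<^sub>R \<xi>) v w) has_vector_derivative
     (herm v w * of_real (- (2 * c) / s\<^sup>2)
      - ((herm v \<xi> * herm x w + herm v x * herm \<xi> w) * of_real ((1/s)\<^sup>2)
      + herm v x * herm x w * of_real (- (4 * c) / s^3)))) (at 0)"
    unfolding **
    by (rule derivative_eq_intros R[THEN has_vector_derivative_of_real] R2[THEN has_vector_derivative_of_real] refl)+
       (simp add: algebra_simps)
  moreover have "herm v w * of_real (- (2 * c) / s\<^sup>2)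
      - ((herm v \<xi> * herm x w + herm v x * herm \<xi> w) * of_real ((1/s)\<^sup>2)
      + herm v x * herm x w * of_real (- (4 * c) / s^3))
    = - herm v w * of_real (2 * c) / (of_real s)\<^sup>2
      - (herm v \<xi> * herm x w + herm v x * herm \<xi> w) / (of_real s)\<^sup>2
      + herm v x * herm x w * of_real (4 * c) / (of_real s)^3"
    using s by (simp add: field_simps power2_eq_square power3_eq_cube)
  ultimately show ?thesis
    unfolding s_def[symmetric] c_def[symmetric]
    using bounded_linear.has_vector_derivative[OF bounded_linear_Re] by metis
qed

text \<open>
  The Lie derivative at a point depends linearly on the value, the gradient and the Hessian of \<open>h\<close>
  there.  It vanishes if \<open>h\<close> is affine, as the Hamiltonian field is then Killing, so only the Hessian
  remains.  The proof computes all terms: those with \<open>h x\<close> and with the gradient \<open>B x\<close> cancel.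
\<close>

lemma fs_lie_metric_eq:
  fixes f :: "'m::finite cproj \<Rightarrow> real"
  assumes u: "norm u = 1" and sm: "smooth_on (fs_model u) (\<lambda>y. f (pr (u + y)))"
    and x: "x \<in> fs_model u" and v: "v \<in> fs_model u" and w: "w \<in> fs_model u"
  defines "h \<equiv> (\<lambda>y. (nsq y) * f (pr (u + y)))"
  shows "lie_metric fubini_study u (ham fubini_study f u) x v w =
    (hess h x v (\<i> *s w) + hess h x w (\<i> *s v)) / nsq x"
proof -
  define V where "V = fs_model u"
  have V: "subspace V" unfolding V_def by (rule subspace_fs_model)
  note [simp] = x[folded V_def] v[folded V_def] w[folded V_def]
  have iV: "\<i> *s y \<in> V" if "y \<in> V" for y using that by (simp add: V_def fs_model_smult)
  have h: "smooth_on V h" unfolding h_def V_def by (rule smooth_on_homogenized[OF subspace_fs_model sm])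
  obtain B S where B [rule_format]: "\<forall>x\<in>V. B x \<in> V" "\<forall>x\<in>V. \<forall>v\<in>V. B x \<bullet> v = dird h x v"
    and S [rule_format]: "\<forall>x\<in>V. \<forall>v\<in>V. S x v \<in> V" "\<forall>x\<in>V. \<forall>v\<in>V. \<forall>w\<in>V. S x v \<bullet> w = hess h x v w"
    "\<forall>x\<in>V. \<forall>v\<in>V. ((\<lambda>t. B (x + t *\<^sub>R v)) has_vector_derivative S x v) (at 0)"
    using subspace_gradient[OF V h] .
  define X where "X y = (- \<i>) *s (B y + herm y (B y) *s y - (2 * h y) *\<^sub>R y)" for y
  have ham: "ham fubini_study f u y = X y" if y: "y \<in> V" for y
    unfolding X_def h_def
    using fs_ham_eq[OF u sm y[unfolded V_def]] B y unfolding V_def h_def by blast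
  have XV: "X y \<in> V" if "y \<in> V" for y
    unfolding X_def V_def using B(1)[OF that] that
    by (intro fs_model_smult subspace_diff subspace_add subspace_scale subspace_fs_model)
      (simp_all add: V_def)
  have metric: "metric fubini_study u y a b = Re (fs_form y a b)" if "y \<in> V" "a \<in> V" "b \<in> V" for y a b
    using that herm_cproj_tangent[OF u] by (simp add: fubini_study_simps V_def)
  have dX: "dird X x a = (- \<i>) *s (S x a + herm x (S x a) *s x + herm x (B x) *s a
      - herm (B x) a *s x - (2 * h x) *\<^sub>R a)" if a: "a \<in> V" for a
  proof (rule dird_eqI)
    have l: "((\<lambda>t::real. x + t *\<^sub>R a) has_vector_derivative a) (at 0)"
      by (auto intro!: derivative_eq_intros)
    note SB = S(3)[of x a, simplified, OF a]
    have dh: "((\<lambda>t. h (x + t *\<^sub>R a)) has_real_derivative B x \<bullet> a) (at 0)"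
      using smooth_on_line_real[OF V h _ a, of x 0] B(2)[of x a] a by simp
    have "((\<lambda>t. X (x + t *\<^sub>R a)) has_vector_derivative
      (- \<i>) *s (S x a + (herm x (B x) *s a + (herm x (S x a) + herm a (B x)) *s x)
        - ((2 * h x) *\<^sub>R a + (2 * (B x \<bullet> a)) *\<^sub>R x))) (at 0)"
    proof -
      have 1: "((\<lambda>t. herm (x + t *\<^sub>R a) (B (x + t *\<^sub>R a))) has_vector_derivative
          herm x (S x a) + herm a (B x)) (at 0)"
        using herm_vector_derivative[OF l SB] by simp
      have 2: "((\<lambda>t. herm (x + t *\<^sub>R a) (B (x + t *\<^sub>R a)) *s (x + t *\<^sub>R a)) has_vector_derivative
          herm x (B x) *s a + (herm x (S x a) + herm a (B x)) *s x) (at 0)"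
        using smult_vector_derivative[OF 1 l] by simp
      have 3: "((\<lambda>t. (2 * h (x + t *\<^sub>R a)) *\<^sub>R (x + t *\<^sub>R a)) has_vector_derivative
          (2 * h x) *\<^sub>R a + (2 * (B x \<bullet> a)) *\<^sub>R x) (at 0)"
        using has_vector_derivative_scaleR[OF DERIV_cmult[OF dh, of 2] l] by simp
      show ?thesis unfolding X_def
        by (rule bounded_linear.has_vector_derivative[OF
              bounded_bilinear.bounded_linear_right[OF bounded_bilinear_smult]
              has_vector_derivative_diff[OF has_vector_derivative_add[OF SB 2] 3]])
    qed
    moreover have "of_real (2 * (B x \<bullet> a)) = herm (B x) a + herm a (B x)"
      by (simp add: complex_eq_iff Re_herm inner_commute flip: cnj_herm[of "B x" a])
    ultimately show "((\<lambda>t. X (x + t *\<^sub>R a)) has_vector_derivative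
       (- \<i>) *s (S x a + herm x (S x a) *s x + herm x (B x) *s a
      - herm (B x) a *s x - (2 * h x) *\<^sub>R a)) (at 0)"
      unfolding scaleR_eq_smult by (simp add: vec_eq_iff algebra_simps)
  qed
  have "lie_metric fubini_study u (ham fubini_study f u) x v w =
    dird (\<lambda>y. Re (fs_form y v w)) x (X x) + Re (fs_form x (dird X x v) w) + Re (fs_form x v (dird X x w))"
  proof -
    have "dird (ham fubini_study f u) x a = dird X x a" if "a \<in> V" for a
      using that by (intro dird_cong[OF V]) (auto simp: ham)
    moreover have "dird X x a \<in> V" if "a \<in> V" for a
      unfolding dX[OF that] using that S(1)[of x a] unfolding V_def
      by (intro fs_model_smult subspace_diff subspace_add subspace_scale subspace_fs_model)
       (simp_all flip: V_def)
    moreover have "dird (\<lambda>y. metric fubini_study u y v w) x (X x) = dird (\<lambda>y. Re (fs_form y v w)) x (X x)"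
      by (intro dird_cong[OF V]) (auto simp: metric XV)
    ultimately show ?thesis
      unfolding lie_metric_def by (simp add: ham metric)
  qed
  also have "\<dots> = (S x v \<bullet> (\<i> *s w) + S x w \<bullet> (\<i> *s v)) / nsq x"
  proof -
    define s where "s = nsq x"
    have s: "s > 0" by (simp add: s_def one_plus_inner_pos)
    define F where "F = fs_form x v w"
    define \<beta> where "\<beta> = Im (herm x (B x))"
    define m where "m = herm v w"
    define a where "a = herm v x"
    define b where "b = herm x w"
    define p where "p = herm v (B x)"
    define q where "q = herm (B x) w"
    have F: "F = m / of_real s - a * b / (of_real s)\<^sup>2"
      by (simp add: F_def fs_form_def m_def a_def b_def s_def)
    have \<xi>: "X x = (- \<i>) *s (B x + herm x (B x) *s x - (2 * h x) *\<^sub>R x)" by (rule X_def)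
    have x\<xi>: "x \<bullet> X x = s * \<beta>"
    proof -
      have "herm x (X x) = - \<i> * (of_real s * herm x (B x) - of_real (2 * h x * (x \<bullet> x)))"
        unfolding \<xi> herm_simps herm_self by (simp add: s_def algebra_simps)
      then have "Re (herm x (X x)) = s * \<beta>"
        by (simp add: \<beta>_def)
      then show ?thesis by (simp only: Re_herm)
    qed
    have v\<xi>: "herm v (X x) = - \<i> * (p + (herm x (B x) - of_real (2 * h x)) * a)"
      unfolding \<xi> herm_simps by (simp add: p_def a_def algebra_simps)
    have \<xi>w: "herm (X x) w = \<i> * (q + (cnj (herm x (B x)) - of_real (2 * h x)) * b)"
      unfolding \<xi> herm_simps by (simp add: q_def b_def algebra_simps)
    have 1: "dird (\<lambda>y. Re (fs_form y v w)) x (X x)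
      = Re (- m * of_real (2 * (s * \<beta>)) / (of_real s)\<^sup>2
      - (herm v (X x) * b + a * herm (X x) w) / (of_real s)\<^sup>2
      + a * b * of_real (4 * (s * \<beta>)) / (of_real s)^3)"
      using dird_eqI[OF fs_metric_deriv[of x "X x" v w]]
      unfolding x\<xi> s_def[symmetric] m_def a_def b_def .
    have 2: "fs_form x (dird X x v) w = \<i> * (herm (S x v) w / of_real s + cnj (herm x (B x)) * F
        - p * (b / (of_real s)\<^sup>2) - of_real (2 * h x) * F)"
      by (simp only: dX[OF v[folded V_def]] fs_form_simps fs_form_sharp fs_form_base F_def s_def p_def b_def
         cnj_herm complex_cnj_minus complex_cnj_i minus_minus)
        (simp add: fs_form_def[of x "S x v"])
    have 3: "fs_form x v (dird X x w) = - \<i> * (herm v (S x w) / of_real s + herm x (B x) * F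
        - q * (a / (of_real s)\<^sup>2) - of_real (2 * h x) * F)"
      by (simp only: dX[OF w[folded V_def]] fs_form_simps fs_form_sharp fs_form_base F_def s_def q_def a_def)
        (simp add: fs_form_def[of x v "S x w"])
    have 4: "S x v \<bullet> (\<i> *s w) = - Im (herm (S x v) w)" "S x w \<bullet> (\<i> *s v) = Im (herm v (S x w))"
      using inner_i[of "S x v" w] inner_commute[of "S x w"] by (simp_all only: Im_herm minus_minus)
    have C: "cnj (herm x (B x)) = herm x (B x) - of_real (2 * \<beta>) * \<i>"
      by (simp add: complex_eq_iff \<beta>_def)
    have 5: "herm v (X x) * b + a * herm (X x) w = \<i> * (a * q - p * b) + of_real (2 * \<beta>) * (a * b)"
      unfolding v\<xi> \<xi>w C by (simp add: algebra_simps)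
    have "dird (\<lambda>y. Re (fs_form y v w)) x (X x)
        = - 2 * \<beta> * Re m / s + 2 * \<beta> * Re (a * b) / s\<^sup>2 + Im (a * q - p * b) / s\<^sup>2"
    proof -
      have "- m * of_real (2 * (s * \<beta>)) / (of_real s)\<^sup>2
          - (\<i> * (a * q - p * b) + of_real (2 * \<beta>) * (a * b)) / (of_real s)\<^sup>2
          + a * b * of_real (4 * (s * \<beta>)) / (of_real s)^3
        = of_real (- 2 * \<beta> / s) * m + of_real (2 * \<beta> / s\<^sup>2) * (a * b)
          - of_real (1 / s\<^sup>2) * (\<i> * (a * q - p * b))"
        using s by (simp add: field_simps power2_eq_square power3_eq_cube)
      then show ?thesis unfolding 1 5
        by (simp only: minus_complex.sel plus_complex.sel Re_complex_of_real Im_complex_of_real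
            times_complex.sel imaginary_unit.sel)
          (simp add: add_divide_distrib diff_divide_distrib algebra_simps)
    qed
    moreover have "fs_form x (dird X x v) w + fs_form x v (dird X x w)
        = of_real (1 / s) * (\<i> * (herm (S x v) w - herm v (S x w)))
          + of_real (2 * \<beta> / s) * m - of_real (2 * \<beta> / s\<^sup>2) * (a * b)
          + of_real (1 / s\<^sup>2) * (\<i> * (a * q - p * b))"
      unfolding 2 3 C F using s by (simp add: field_simps power2_eq_square power3_eq_cube)
    then have "Re (fs_form x (dird X x v) w) + Re (fs_form x v (dird X x w))
        = (- Im (herm (S x v) w) + Im (herm v (S x w))) / s + 2 * \<beta> * Re m / s
          - 2 * \<beta> * Re (a * b) / s\<^sup>2 - Im (a * q - p * b) / s\<^sup>2"
      unfolding plus_complex.sel(1)[symmetric]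
      by (simp only: minus_complex.sel plus_complex.sel Re_complex_of_real Im_complex_of_real
            times_complex.sel imaginary_unit.sel)
          (simp add: add_divide_distrib diff_divide_distrib algebra_simps)
    ultimately show ?thesis unfolding 4 s_def[symmetric] by simp
  qed
  also have "\<dots> = (hess h x v (\<i> *s w) + hess h x w (\<i> *s v)) / nsq x"
    by (simp add: S(2) iV)
  finally show ?thesis .
qed

section \<open>Kaehler functions on projective space\<close>

text \<open>
  By the symmetry, \<open>J\<close> moves between any two slots at the price of a sign.  Moving it from the first
  slot to the third, then to the second, and back to the first takes three moves.
\<close>

lemma third_derivative_zero:
  fixes T :: "'v \<Rightarrow> 'v \<Rightarrow> 'v \<Rightarrow> real"
  assumes J: "\<And>v. v \<in> V \<Longrightarrow> J v \<in> V"
    and cyc: "\<And>a v w. a \<in> V \<Longrightarrow> v \<in> V \<Longrightarrow> w \<in> V \<Longrightarrow> T a v w = T v a w"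
    and sym: "\<And>a v w. a \<in> V \<Longrightarrow> v \<in> V \<Longrightarrow> w \<in> V \<Longrightarrow> T a v w = T a w v"
    and inv: "\<And>a v w. a \<in> V \<Longrightarrow> v \<in> V \<Longrightarrow> w \<in> V \<Longrightarrow> T a (J v) w = - T a v (J w)"
    and abc: "a \<in> V" "b \<in> V" "c \<in> V"
  shows "T (J a) b c = 0"
proof -
  have "T (J a) b c = T b (J a) c" using abc J by (simp add: cyc)
  also have "\<dots> = - T b a (J c)" using abc J by (simp add: inv)
  also have "\<dots> = - T a (J c) b" using abc J by (simp add: cyc[of b a] sym[of a b])
  also have "\<dots> = T a c (J b)" using abc J by (simp add: inv)
  also have "\<dots> = T c (J b) a" using abc J by (simp add: cyc[of a c] sym[of c a])
  also have "\<dots> = - T c b (J a)" using abc J by (simp add: inv)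
  also have "\<dots> = - T (J a) b c" using abc J by (metis cyc sym)
  finally show ?thesis by simp
qed

lemma fs_homogenized_quadratic:
  fixes f :: "'m::finite cproj \<Rightarrow> real"
  assumes f: "f \<in> kahler_functions fubini_study" and u: "norm u = 1"
  defines "h \<equiv> (\<lambda>y. (nsq y) * f (pr (u + y)))"
  shows "smooth_on (fs_model u) h"
    and "\<And>x v w. x \<in> fs_model u \<Longrightarrow> v \<in> fs_model u \<Longrightarrow> w \<in> fs_model u \<Longrightarrow>
      hess h x v (\<i> *s w) = - hess h x (\<i> *s v) w"
    and "\<And>x. x \<in> fs_model u \<Longrightarrow> h x = h 0 + dird h 0 x + hess h 0 x x / 2"
proof -
  define V where "V = fs_model u"
  have V: "subspace V" unfolding V_def by (rule subspace_fs_model)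
  have iV: "\<i> *s y \<in> V" if "y \<in> V" for y using that by (simp add: V_def fs_model_smult)
  have sm: "smooth_on V (\<lambda>y. f (pr (u + y)))"
    using f u unfolding kahler_functions_def smooth_function_def smooth_on_def V_def
    by (simp add: fubini_study_simps o_def)
  show h: "smooth_on (fs_model u) h" unfolding h_def using smooth_on_homogenized[OF V sm] by (simp add: V_def)
  note h = h[folded V_def]
  define D2 where "D2 v w x = hess h x v w" for v w x
  have D2h: "smooth_on V (D2 v w)" if "v \<in> V" "w \<in> V" for v w
    unfolding D2_def using that by (intro smooth_on_dird h)
  have D2sym: "D2 v w x = D2 w v x" if "v \<in> V" "w \<in> V" "x \<in> V" for v w x
    unfolding D2_def using dird_symmetric[OF V h that(3,2,1)] .
  have inv: "D2 (\<i> *s v) w x = - D2 v (\<i> *s w) x" if "v \<in> V" "w \<in> V" "x \<in> V" for v w x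
  proof -
    have "lie_metric fubini_study u (ham fubini_study f u) x v w = 0"
      using f u that unfolding kahler_functions_def by (simp add: fubini_study_simps V_def)
    then have "D2 v (\<i> *s w) x + D2 w (\<i> *s v) x = 0"
      using fs_lie_metric_eq[OF u sm[unfolded V_def], of x v w] that one_plus_inner_pos[of x]
      by (simp add: V_def h_def D2_def)
    then show ?thesis using D2sym[of w "\<i> *s v" x] that iV by simp
  qed
  then show "\<And>x v w. x \<in> fs_model u \<Longrightarrow> v \<in> fs_model u \<Longrightarrow> w \<in> fs_model u \<Longrightarrow>
      hess h x v (\<i> *s w) = - hess h x (\<i> *s v) w"
    by (simp add: D2_def V_def)
  define T where "T x a v w = dird (D2 v w) x a" for x a v w
  have Jneg: "T x a (\<i> *s v) w = - T x a v (\<i> *s w)" if "x \<in> V" "a \<in> V" "v \<in> V" "w \<in> V" for x a v w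
  proof -
    have "T x a (\<i> *s v) w = dird (\<lambda>y. (-1) * D2 v (\<i> *s w) y) x a"
      unfolding T_def by (rule dird_cong[OF V]) (simp_all add: that inv)
    also have "\<dots> = - T x a v (\<i> *s w)"
      unfolding T_def
      by (rule dird_eqI)
        (use smooth_on_line_real[OF V D2h[OF that(3) iV[OF that(4)]] that(1,2), of 0] in
          \<open>auto simp flip: has_real_derivative_iff_has_vector_derivative intro!: derivative_eq_intros\<close>)
    finally show ?thesis .
  qed
  have Tsym: "T x a v w = T x a w v" if "x \<in> V" "a \<in> V" "v \<in> V" "w \<in> V" for x a v w
    unfolding T_def by (rule dird_cong[OF V]) (simp_all add: that D2sym)
  have Tcyc: "T x a v w = T x v a w" if "x \<in> V" "a \<in> V" "v \<in> V" "w \<in> V" for x a v w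
    unfolding T_def D2_def using dird_symmetric[OF V smooth_on_dird[OF h that(4)]  that(1,3,2)] .
  have T0: "T x a v w = 0" if "x \<in> V" "a \<in> V" "v \<in> V" "w \<in> V" for x a v w
  proof -
    have "T x (\<i> *s (- \<i> *s a)) v w = 0"
      by (rule third_derivative_zero[of V "\<lambda>v. \<i> *s v" "T x", OF iV Tcyc[OF that(1)]
            Tsym[OF that(1)] Jneg[OF that(1)] _ that(3,4)])
        (use that(2) in \<open>simp_all add: V_def fs_model_smult subspace_neg[OF subspace_fs_model]\<close>)
    then show ?thesis by simp
  qed
  show "h x = h 0 + dird h 0 x + hess h 0 x x / 2" if "x \<in> fs_model u" for x
  proof (rule quadratic_on_subspace[OF V h _ that[folded V_def]])
    show "hess (\<lambda>y. dird h y v) x v v = 0" if "x \<in> V" "v \<in> V" for x v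
      using T0[OF that(1,2,2,2)] by (simp add: T_def D2_def[abs_def])
  qed
qed

text \<open>
  The quadratic polynomial \<open>h\<close> is turned into a Hermitian form in \<open>z = \<zeta> u + y\<close>, \<open>y \<in> [u]\<^sup>\<bottom>\<close>, by
  homogenizing: the linear part is evaluated at \<open>cnj \<zeta> *s y\<close>, which is unchanged when \<open>z\<close> is multiplied by a
  phase, and the quadratic part is invariant under \<open>i\<close> already.
\<close>

lemma kahler_fubini_study_local:
  fixes f :: "'m::finite cproj \<Rightarrow> real"
  assumes f: "f \<in> kahler_functions fubini_study" and u: "norm u = 1"
  obtains A where "hermitian A" "\<And>z. herm u z \<noteq> 0 \<Longrightarrow> f (pr z) = rayleigh A z"
proof -
  define h where "h = (\<lambda>y. (nsq y) * f (pr (u + y)))"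
  define V where "V = fs_model u"
  have V: "subspace V" unfolding V_def by (rule subspace_fs_model)
  have iV: "\<i> *s y \<in> V" if "y \<in> V" for y using that by (simp add: V_def fs_model_smult)
  note H = fs_homogenized_quadratic[OF f u, folded h_def V_def]
  have H3: "h x = h 0 + dird h 0 x + hess h 0 x x / 2" if "x \<in> V" for x
    using fs_homogenized_quadratic(3)[OF f u that[unfolded V_def]] by (simp only: h_def)
  have V0: "0 \<in> V" by (simp add: V subspace_0)
  define L where "L v = dird h 0 v" for v
  define Q where "Q v w = hess h 0 v w" for v w
  define P where "P z = z - herm u z *s u" for z
  have uu: "herm u u = 1" using u by (simp add: herm_self dot_square_norm)
  have PV: "P z \<in> V" for z
    by (simp add: P_def V_def fs_model_def herm_simps uu)
  have Padd: "P (z + w) = P z + P w" and Psc: "P (r *\<^sub>R z) = r *\<^sub>R P z"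
    and Pi: "P (c *s z) = c *s P z" for z w r c
    by (simp_all add: P_def herm_simps vec_eq_iff algebra_simps scaleR_complex)
  have Ladd: "L (v + w) = L v + L w" and Lsc: "L (r *\<^sub>R v) = r * L v" if "v \<in> V" "w \<in> V" for v w r
    using dird_linear[OF V H(1) V0] that by (simp_all add: L_def)
  have Qsym: "Q v w = Q w v" if "v \<in> V" "w \<in> V" for v w
    unfolding Q_def by (rule dird_symmetric[OF V H(1) V0 that(2,1)])
  have Qadd: "Q (v + v') w = Q v w + Q v' w" and Qsc: "Q (r *\<^sub>R v) w = r * Q v w"
    if "v \<in> V" "v' \<in> V" "w \<in> V" for v v' w r
    using dird_linear[OF V smooth_on_dird[OF H(1) that(3)] V0] that by (simp_all add: Q_def)
  have Qadd2: "Q w (v + v') = Q w v + Q w v'" and Qsc2: "Q w (r *\<^sub>R v) = r * Q w v"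
    if "v \<in> V" "v' \<in> V" "w \<in> V" for v v' w r
    using that Qsym[of w] Qadd Qsc V by (simp_all add: subspace_add subspace_scale)
  have Qinv: "Q (\<i> *s v) (\<i> *s w) = Q v w" if "v \<in> V" "w \<in> V" for v w
  proof -
    have "Q (\<i> *s v) (\<i> *s w) = - Q (\<i> *s (\<i> *s v)) w"
      using H(2)[OF V0 iV[OF that(1)] that(2)] by (simp add: Q_def)
    also have "\<dots> = - Q ((-1) *\<^sub>R v) w" by simp
    also have "\<dots> = Q v w" unfolding Qsc[OF that(1,1,2)] by simp
    finally show ?thesis .
  qed
  define b where "b z w = h 0 * Re (cnj (herm u z) * herm u w)
    + L (cnj (herm u z) *s P w + cnj (herm u w) *s P z) / 2 + Q (P z) (P w) / 2" for z w
  have sV: "c *s y \<in> V" if "y \<in> V" for y c using that by (simp add: V_def fs_model_smult)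
  have "linear (b z)" for z
  proof (rule linearI)
    fix w w'
    have "cnj (herm u z) *s P (w + w') + cnj (herm u (w + w')) *s P z
      = (cnj (herm u z) *s P w + cnj (herm u w) *s P z) + (cnj (herm u z) *s P w' + cnj (herm u w') *s P z)"
      by (simp add: Padd herm_simps vec_eq_iff algebra_simps)
    then show "b z (w + w') = b z w + b z w'"
      by (simp add: b_def Ladd PV sV subspace_add[OF V] Padd Qadd2 herm_simps algebra_simps add_divide_distrib)
  next
    fix r w
    have "cnj (herm u z) *s P (r *\<^sub>R w) + cnj (herm u (r *\<^sub>R w)) *s P z
      = r *\<^sub>R (cnj (herm u z) *s P w + cnj (herm u w) *s P z)"
      by (simp add: Psc herm_simps vec_eq_iff algebra_simps scaleR_complex)
    then have "L (cnj (herm u z) *s P (r *\<^sub>R w) + cnj (herm u (r *\<^sub>R w)) *s P z)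
      = r * L (cnj (herm u z) *s P w + cnj (herm u w) *s P z)"
      using Lsc V0 by (simp only: PV sV subspace_add[OF V])
    then show "b z (r *\<^sub>R w) = r *\<^sub>R b z w"
      using Qsc2[OF PV PV PV] by (simp add: b_def Psc herm_simps algebra_simps add_divide_distrib)
  qed
  moreover have bsym: "b z w = b w z" for z w
    using Qsym[OF PV PV, of z w] by (simp add: b_def add.commute algebra_simps)
  ultimately have "bilinear b" unfolding bilinear_def by (metis (no_types, lifting) ext)
  moreover have "b (\<i> *s z) (\<i> *s w) = b z w" for z w
    by (simp add: b_def Pi Qinv PV herm_simps algebra_simps)
  ultimately obtain A where A: "hermitian A" "\<And>z w. z \<bullet> A w = b z w"
    using bsym hermitian_of_invariant_form[of b] by metis
  show ?thesis
  proof (rule that[OF A(1)])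
    fix z assume nz: "herm u z \<noteq> 0"
    define x where "x = (1 / herm u z) *s P z"
    have x: "x \<in> V" by (simp add: x_def sV PV)
    have z: "z = herm u z *s (u + x)"
      using nz by (simp add: x_def P_def vec_eq_iff algebra_simps)
    have ux0: "u + x \<noteq> 0" using chart_nonzero[OF u x[unfolded V_def]] .
    have "pr z = pr (u + x)"
      using pr_eq_iff[OF ux0, of z] ux0 z nz by (metis herm_simps(12))
    moreover have "f (pr (u + x)) = rayleigh A (u + x)"
    proof -
      have hu: "herm u (u + x) = 1" using x uu by (simp add: V_def fs_model_def herm_simps)
      have Pu: "P (u + x) = x" unfolding P_def hu by simp
      have "b (u + x) (u + x) = h 0 + L x + Q x x / 2"
        using Lsc[OF x x, of 2] unfolding b_def hu Pu by (simp flip: scaleR_2)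
      also have "\<dots> = h x" using H3[OF x] by (simp add: L_def Q_def)
      finally have "b (u + x) (u + x) = (nsq x) * f (pr (u + x))" by (simp add: h_def)
      then show ?thesis
        using one_plus_inner_pos[of x] chart_norm[OF u x[unfolded V_def]]
        by (simp add: rayleigh_def A(2))
    qed
    moreover have "rayleigh A z = rayleigh A (u + x)"
      using rayleigh_smult[OF A(1) nz, of "u + x"] z by simp
    ultimately show "f (pr z) = rayleigh A z" by simp
  qed
qed

lemma continuous_rayleigh_line:
  assumes A: "hermitian A" and "z \<noteq> 0"
  shows "((\<lambda>t::real. rayleigh A (z + t *\<^sub>R v)) \<longlongrightarrow> rayleigh A z) (at 0)"
proof -
  interpret A: bounded_linear A by (rule hermitian_bounded_linear[OF A])
  have "((\<lambda>t::real. z + t *\<^sub>R v) \<longlongrightarrow> z + 0 *\<^sub>R v) (at 0)"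
    by (intro tendsto_intros)
  then show ?thesis
    unfolding rayleigh_def using assms(2)
    by (intro tendsto_intros A.tendsto) auto
qed

text \<open>
  One affine chart misses only the hyperplane \<open>\<langle>u, z\<rangle> = 0\<close>, which its complement approaches along the
  lines \<open>z + tu\<close>; so the formula extends by continuity.
\<close>

lemma kahler_fubini_study_imp_rayleigh:
  fixes f :: "'m::finite cproj \<Rightarrow> real"
  assumes f: "f \<in> kahler_functions fubini_study"
  obtains A where "hermitian A" "\<And>z. z \<noteq> 0 \<Longrightarrow> f (pr z) = rayleigh A z"
proof -
  obtain u :: "complex^'m" where u: "norm u = 1" using vector_choose_size[of 1] by auto
  obtain A where A: "hermitian A" "\<And>z. herm u z \<noteq> 0 \<Longrightarrow> f (pr z) = rayleigh A z"
    using kahler_fubini_study_local[OF f u] by blast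
  have uu: "herm u u = 1" using u by (simp add: herm_self dot_square_norm)
  have "f (pr z) = rayleigh A z" if z: "z \<noteq> 0" and uz: "herm u z = 0" for z
  proof -
    define c where "c = sgn z"
    have c: "norm c = 1" using z by (simp add: c_def norm_sgn)
    have cz: "c = of_real (inverse (norm z)) *s z"
      by (simp add: c_def sgn_div_norm scaleR_eq_smult)
    have cu: "herm u c = 0" by (simp add: cz herm_simps uz)
    have uV: "u \<in> fs_model c" using cu cnj_herm[of u c] by (simp add: fs_model_def)
    have "smooth_on (fs_model c) (\<lambda>y. f (pr (c + y)))"
      using f c unfolding kahler_functions_def smooth_function_def smooth_on_def
      by (simp add: fubini_study_simps o_def)
    from smooth_on_line_real[OF subspace_fs_model this _ uV, of 0 0]
    have "((\<lambda>t. f (pr (c + t *\<^sub>R u))) has_real_derivative dird (\<lambda>y. f (pr (c + y))) 0 u) (at 0)"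
      by (simp add: subspace_0[OF subspace_fs_model])
    then have 1: "((\<lambda>t. f (pr (c + t *\<^sub>R u))) \<longlongrightarrow> f (pr c)) (at 0)"
      using DERIV_isCont isContD by fastforce
    have "f (pr (c + t *\<^sub>R u)) = rayleigh A (c + t *\<^sub>R u)" if "t \<noteq> 0" for t
      by (rule A(2)) (use that in \<open>simp add: herm_simps cu uu\<close>)
    then have "eventually (\<lambda>t. rayleigh A (c + t *\<^sub>R u) = f (pr (c + t *\<^sub>R u))) (at 0)"
      by (simp add: eventually_at_filter)
    moreover have "c \<noteq> 0" using c by auto
    ultimately have "((\<lambda>t. f (pr (c + t *\<^sub>R u))) \<longlongrightarrow> rayleigh A c) (at 0)"
      by (intro Lim_transform_eventually[OF continuous_rayleigh_line[OF A(1)]])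
    then have "f (pr c) = rayleigh A c" using 1 tendsto_unique[OF _ 1] by simp
    moreover have "pr z = pr c"
      using pr_eq_iff[of z c] z c cz by (metis norm_zero zero_neq_one)
    moreover have "rayleigh A c = rayleigh A z"
      unfolding cz by (rule rayleigh_smult[OF A(1)]) (use z in simp)
    ultimately show ?thesis by simp
  qed
  then show ?thesis using that A by metis
qed

lemma pr_cases: obtains z where "z \<noteq> 0" "q = pr z"
proof (rule that)
  show "rep_cproj q \<noteq> 0" using Quotient3_rep_reflp[OF Quotient3_cproj, of q] by simp
  show "q = pr (rep_cproj q)" unfolding pr_def using Quotient3_abs_rep[OF Quotient3_cproj, of q] by simp
qed

lemma rayleigh_homogenized:
  fixes f :: "'m::finite cproj \<Rightarrow> real"
  assumes A: "hermitian A" and f: "\<forall>z. z \<noteq> 0 \<longrightarrow> f (pr z) = rayleigh A z" and u: "norm u = 1"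
  shows "smooth_on (fs_model u) (\<lambda>y. f (pr (u + y)))"
   and "\<And>x v. x \<in> fs_model u \<Longrightarrow> (nsq x) * f (pr (u + x)) = (u + x) \<bullet> A (u + x)"
   and "\<And>x v. x \<in> fs_model u \<Longrightarrow> v \<in> fs_model u \<Longrightarrow>
      dird (\<lambda>y. (nsq y) * f (pr (u + y))) x v = 2 * (A (u + x) \<bullet> v)"
   and "\<And>x v w. x \<in> fs_model u \<Longrightarrow> v \<in> fs_model u \<Longrightarrow> w \<in> fs_model u \<Longrightarrow>
      hess (\<lambda>y. (nsq y) * f (pr (u + y))) x v w = 2 * (A v \<bullet> w)"
proof -
  interpret A: bounded_linear A by (rule hermitian_bounded_linear[OF A])
  let ?V = "fs_model u"
  note V = subspace_fs_model[of u]
  let ?h = "\<lambda>y. (nsq y) * f (pr (u + y))"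
  show h: "(nsq x) * f (pr (u + x)) = (u + x) \<bullet> A (u + x)" if "x \<in> ?V" for x
    using f chart_nonzero[OF u that] chart_norm[OF u that] one_plus_inner_pos[of x]
    by (simp add: rayleigh_def)
  have "(u + x) \<bullet> A (u + x) * inverse (nsq x) = f (pr (u + x))" if "x \<in> ?V" for x
    using one_plus_inner_pos[of x] unfolding h[OF that, symmetric] by simp
  moreover have "smooth_on ?V (\<lambda>x. (u + x) \<bullet> A (u + x) * inverse (nsq x))"
    unfolding inner_add A.add
    by (intro smooth_on_mult smooth_on_inverse_sq V smooth_on_add smooth_on_const smooth_on_inner
         bounded_linear_ident A.bounded_linear_axioms bounded_linear_compose[OF bounded_linear_inner_right]
         bounded_linear_compose[OF bounded_linear_inner_left] smooth_on_bounded_linear)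
  ultimately show "smooth_on ?V (\<lambda>y. f (pr (u + y)))"
    by (rule smooth_on_cong[OF V])
  show d: "dird ?h x v = 2 * (A (u + x) \<bullet> v)" if "x \<in> ?V" "v \<in> ?V" for x v
  proof -
    have "dird ?h x v = dird (\<lambda>y. (u + y) \<bullet> A (u + y)) x v"
      using that h by (intro dird_cong[OF V]) auto
    also have "\<dots> = 2 * (A (u + x) \<bullet> v)"
    proof (rule dird_eqI)
      have 1: "((\<lambda>t. u + (x + t *\<^sub>R v)) has_vector_derivative v) (at 0)"
        by (auto intro!: derivative_eq_intros)
      have 2: "((\<lambda>t. A (u + (x + t *\<^sub>R v))) has_vector_derivative A v) (at 0)"
        by (rule A.has_vector_derivative[OF 1])
      show "((\<lambda>t. (u + (x + t *\<^sub>R v)) \<bullet> A (u + (x + t *\<^sub>R v))) has_vector_derivative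
          2 * (A (u + x) \<bullet> v)) (at 0)"
        using bounded_bilinear.has_vector_derivative[OF bounded_bilinear_inner 1 2]
        by (simp add: hermitian_inner[OF A, of _ v] inner_commute[of v])
    qed
    finally show ?thesis .
  qed
  show "dird (\<lambda>y. dird ?h y w) x v = 2 * (A v \<bullet> w)" if "x \<in> ?V" "v \<in> ?V" "w \<in> ?V" for x v w
  proof -
    have "dird (\<lambda>y. dird ?h y w) x v = dird (\<lambda>y. 2 * (A (u + y) \<bullet> w)) x v"
      using that d by (intro dird_cong[OF V]) auto
    also have "\<dots> = 2 * (A v \<bullet> w)"
    proof (rule dird_eqI)
      have "((\<lambda>t. 2 * (A (u + x) \<bullet> w + t * (A v \<bullet> w))) has_vector_derivative 2 * (A v \<bullet> w)) (at 0)"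
        by (auto intro!: derivative_eq_intros simp flip: has_real_derivative_iff_has_vector_derivative)
      then show "((\<lambda>t. 2 * (A (u + (x + t *\<^sub>R v)) \<bullet> w)) has_vector_derivative 2 * (A v \<bullet> w)) (at 0)"
        by (simp add: A.add A.scaleR inner_add_left add.assoc)
    qed
    finally show ?thesis .
  qed
qed

text \<open>
  For a Rayleigh quotient, \<open>h\<close> is a Hermitian quadratic polynomial, whose Hessian is invariant
  under \<open>i\<close>.
\<close>

theorem kahler_functions_fubini_study:
  "f \<in> kahler_functions fubini_study
    \<longleftrightarrow> (\<exists>A. hermitian A \<and> (\<forall>z. z \<noteq> 0 \<longrightarrow> f (pr z) = rayleigh A z))"
proof
  assume "f \<in> kahler_functions fubini_study"
  then show "\<exists>A. hermitian A \<and> (\<forall>z. z \<noteq> 0 \<longrightarrow> f (pr z) = rayleigh A z)"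
    using kahler_fubini_study_imp_rayleigh by metis
next
  assume "\<exists>A. hermitian A \<and> (\<forall>z. z \<noteq> 0 \<longrightarrow> f (pr z) = rayleigh A z)"
  then obtain A where A: "hermitian A" "\<forall>z. z \<noteq> 0 \<longrightarrow> f (pr z) = rayleigh A z" by auto
  have "lie_metric fubini_study u (ham fubini_study f u) x v w = 0"
    if u: "norm u = 1" and "x \<in> fs_model u" "v \<in> fs_model u" "w \<in> fs_model u" for u x v w
  proof -
    note R = rayleigh_homogenized[OF A u]
    have "A v \<bullet> (\<i> *s w) + A w \<bullet> (\<i> *s v) = 0"
    proof -
      have "A v \<bullet> (\<i> *s w) = v \<bullet> A (\<i> *s w)" by (simp add: hermitian_inner[OF A(1)])
      also have "\<dots> = - (A w \<bullet> (\<i> *s v))"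
        by (simp add: hermitian_smult[OF A(1)] inner_commute[of v] inner_i)
      finally show ?thesis by simp
    qed
    then show ?thesis
      using that by (simp add: fs_lie_metric_eq[OF u R(1)] R(4) fs_model_smult)
  qed
  then show "f \<in> kahler_functions fubini_study"
    using rayleigh_homogenized(1)[OF A]
    by (auto simp: kahler_functions_def smooth_function_def smooth_on_def fubini_study_simps o_def)
qed

text \<open>
  For Hermitian \<open>A\<close> the choice of the representative does not matter, since the quotient is then
  homogeneous of degree \<open>0\<close>.
\<close>

definition rayleigh_fun :: "(complex^'m \<Rightarrow> complex^'m) \<Rightarrow> 'm cproj \<Rightarrow> real" where
  "rayleigh_fun A q = rayleigh A (rep_cproj q)"

lemma rayleigh_fun_pr:
  assumes A: "hermitian A" and z: "z \<noteq> 0"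
  shows "rayleigh_fun A (pr z) = rayleigh A z"
proof -
  define w where "w = rep_cproj (pr z)"
  have w: "w \<noteq> 0" using Quotient3_rep_reflp[OF Quotient3_cproj, of "pr z"] by (simp add: w_def)
  have "pr w = pr z" unfolding pr_def w_def by (rule Quotient3_abs_rep[OF Quotient3_cproj])
  then obtain c where c: "w = c *s z" using pr_eq_iff[OF z w] by auto
  then have "c \<noteq> 0" using w by auto
  then show ?thesis using rayleigh_smult[OF A] c by (simp add: rayleigh_fun_def w_def)
qed

lemma rayleigh_fun_kahler: "hermitian A \<Longrightarrow> rayleigh_fun A \<in> kahler_functions fubini_study"
  using kahler_functions_fubini_study rayleigh_fun_pr by blast

lemma kahler_fubini_study_eq_fs_function:
  assumes "F \<in> kahler_functions fubini_study"
  obtains A where "hermitian A" "F = rayleigh_fun A"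
proof -
  obtain A where A: "hermitian A" "\<And>z. z \<noteq> 0 \<Longrightarrow> F (pr z) = rayleigh A z"
    using kahler_fubini_study_imp_rayleigh[OF assms] by blast
  have "F q = rayleigh_fun A q" for q
    by (rule pr_cases[of q]) (simp add: A rayleigh_fun_pr)
  then show ?thesis using that A(1) by blast
qed

text \<open>
  With \<open>z = u + x\<close> the Hamiltonian field is \<open>- 2i (Az - \<langle>u, Az\<rangle> z)\<close>, which represents the tangent vector
  \<open>- 2i Az\<close> modulo \<open>z\<close>.  In the product of two such vectors the corrections by multiples of \<open>z\<close> contribute a
  real number, and the value depends on \<open>[z]\<close> only, as the description in the bracket requires.
\<close>

lemma pbracket_fubini_study:
  fixes f g :: "'m::finite cproj \<Rightarrow> real"
  assumes A: "hermitian A" and f: "\<forall>z. z \<noteq> 0 \<longrightarrow> f (pr z) = rayleigh A z"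
    and B: "hermitian B" and g: "\<forall>z. z \<noteq> 0 \<longrightarrow> g (pr z) = rayleigh B z"
    and z: "z \<noteq> 0"
  shows "pbracket fubini_study f g (pr z) = 4 * Im (herm (A z) (B z)) / (z \<bullet> z)"
proof -
  have ham: "ham fubini_study f u x = (- 2 * \<i>) *s (A (u + x) - herm u (A (u + x)) *s (u + x))"
    if u: "norm u = 1" and x: "x \<in> fs_model u" and A: "hermitian A"
     and f: "\<forall>z. z \<noteq> 0 \<longrightarrow> f (pr z) = rayleigh A z" for u x f and A :: "complex^'m \<Rightarrow> complex^'m"
  proof -
    note R = rayleigh_homogenized[OF A f u]
    define a where "a = A (u + x)"
    define G where "G = 2 *\<^sub>R (a - herm u a *s u)"
    have uu: "herm u u = 1" using u by (simp add: herm_self dot_square_norm)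
    have G: "G \<in> fs_model u" by (simp add: G_def fs_model_def herm_simps uu)
    have "G \<bullet> v = dird (\<lambda>y. (nsq y) * f (pr (u + y))) x v" if v: "v \<in> fs_model u" for v
    proof -
      have "herm u v = 0" using v by (simp add: fs_model_def)
      then have "G \<bullet> v = 2 * (a \<bullet> v)" unfolding Re_herm[symmetric] by (simp add: G_def herm_simps)
      then show ?thesis using R(3)[OF x v] by (simp add: a_def)
    qed
    from fs_ham_eq[OF u R(1) x G this]
    have ham: "ham fubini_study f u x = (- \<i>) *s (G + herm x G *s x - (2 * ((u + x) \<bullet> a)) *\<^sub>R x)"
      using R(2)[OF x] by (simp add: a_def)
    have "of_real ((u + x) \<bullet> a) = herm u a + herm x a"
      using hermitian_herm_self[OF A, of "u + x"] by (simp add: a_def herm_simps)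
    then have e1: "(2 * ((u + x) \<bullet> a)) *\<^sub>R x = (2 * (herm u a + herm x a)) *s x"
      by (simp only: scaleR_eq_smult of_real_mult of_real_numeral)
    have "herm x u = 0" using x cnj_herm[of u x] by (simp add: fs_model_def)
    then have e2: "herm x G = 2 * herm x a" by (simp add: G_def herm_simps)
    show ?thesis
      unfolding ham e1 e2
      by (simp add: G_def scaleR_eq_smult a_def[symmetric] vec_eq_iff algebra_simps)
  qed
  have ev: "sympl fubini_study u x (ham fubini_study f u x) (ham fubini_study g u x)
     = 4 * Im (herm (A (u + x)) (B (u + x))) / ((u + x) \<bullet> (u + x))"
    if u: "norm u = 1" and x: "x \<in> fs_model u" for u x
  proof -
    define y where "y = u + x"
    define s where "s = nsq x"
    have s: "s > 0" by (simp add: s_def one_plus_inner_pos)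
    have yy: "herm y y = of_real s" using chart_norm[OF u x] by (simp add: y_def s_def herm_self)
    have uy: "herm u y = 1"
      using u x by (simp add: y_def herm_simps fs_model_def herm_self dot_square_norm)
    define X where "X = (- 2 * \<i>) *s (A y - herm u (A y) *s y)"
    define Y where "Y = (- 2 * \<i>) *s (B y - herm u (B y) *s y)"
    have XY: "X \<in> fs_model u" "Y \<in> fs_model u"
      by (simp_all add: X_def Y_def fs_model_def herm_simps uy)
    have "herm X x = herm X y" "herm x Y = herm y Y"
      using XY cnj_herm[of u X] by (auto simp: y_def herm_simps fs_model_def)
    then have "fs_form x X Y = herm X Y / of_real s - herm X y * herm y Y / (of_real s)\<^sup>2"
      by (simp add: fs_form_def s_def)
    also have "\<dots> = 4 * herm (A y) (B y) / of_real s
        - 4 * (herm y (A y) * herm y (B y)) / (of_real s)\<^sup>2"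
    proof -
      have "herm (A y) y = herm y (A y)" using A by (simp add: hermitian_def)
      then show ?thesis
        unfolding X_def Y_def using s
        by (simp add: herm_simps yy field_simps power2_eq_square)
    qed
    also have "\<dots> = of_real (4 / s) * herm (A y) (B y) - of_real (4 * ((y \<bullet> A y) * (y \<bullet> B y)) / s\<^sup>2)"
      unfolding hermitian_herm_self[OF A] hermitian_herm_self[OF B] by simp
    finally have "Im (fs_form x X Y) = 4 * Im (herm (A y) (B y)) / s"
      by (simp only: minus_complex.sel times_complex.sel Im_complex_of_real Re_complex_of_real) simp
    moreover have "ham fubini_study f u x = X" "ham fubini_study g u x = Y"
      unfolding X_def Y_def y_def using ham[OF u x] A B f g by blast+
    ultimately show ?thesis
      using herm_cproj_tangent[OF u x XY] chart_norm[OF u x]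
      by (simp add: fubini_study_simps y_def s_def)
  qed
  have inv: "4 * Im (herm (A w) (B w)) / (w \<bullet> w) = 4 * Im (herm (A z) (B z)) / (z \<bullet> z)"
    if pr: "pr w = pr z" and w: "w \<noteq> 0" for w
  proof -
    obtain c where c: "z = c *s w" using pr_eq_iff[OF w z] pr by auto
    then have c0: "c \<noteq> 0" using z by auto
    have "herm (c *s a) (c *s b) = of_real ((cmod c)\<^sup>2) * herm a b" for a b :: "complex^'m"
      unfolding herm_simps complex_norm_square by simp
    then have "herm (A z) (B z) = of_real ((cmod c)\<^sup>2) * herm (A w) (B w)"
      "z \<bullet> z = (cmod c)\<^sup>2 * (w \<bullet> w)"
      unfolding c hermitian_smult[OF A] hermitian_smult[OF B] Re_herm[symmetric]
      by (simp_all flip: of_real_power)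
    then show ?thesis using c0 by (simp flip: of_real_power)
  qed
  show ?thesis unfolding pbracket_def
  proof (rule the_equality)
    define u where "u = sgn z"
    have u: "norm u = 1" using z by (simp add: u_def norm_sgn)
    then have u0: "u \<noteq> 0" by auto
    have "pr u = pr z"
      using pr_eq_iff[of z u] z u unfolding u_def sgn_div_norm scaleR_eq_smult by (metis norm_zero zero_neq_one)
    then show "\<exists>c\<in>charts fubini_study. \<exists>x\<in>model fubini_study c. param fubini_study c x = pr z \<and>
        4 * Im (herm (A z) (B z)) / (z \<bullet> z) =
        sympl fubini_study c x (ham fubini_study f c x) (ham fubini_study g c x)"
      using u ev[OF u subspace_0[OF subspace_fs_model]] inv[of u] u0
      by (rule_tac bexI[of _ u], rule_tac bexI[of _ 0])
        (auto simp: fubini_study_simps(1-3) subspace_0[OF subspace_fs_model])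
  next
    fix r assume "\<exists>c\<in>charts fubini_study. \<exists>x\<in>model fubini_study c. param fubini_study c x = pr z \<and>
        r = sympl fubini_study c x (ham fubini_study f c x) (ham fubini_study g c x)"
    then obtain u x where "norm u = 1" "x \<in> fs_model u" "pr (u + x) = pr z"
        "r = sympl fubini_study u x (ham fubini_study f u x) (ham fubini_study g u x)"
      by (auto simp: fubini_study_simps(1-3))
    then show "r = 4 * Im (herm (A z) (B z)) / (z \<bullet> z)"
      using ev inv chart_nonzero by metis
  qed
qed

section \<open>The sphere in central projection\<close>

definition tplane :: "real^3 \<Rightarrow> (real^3) set" where
  "tplane p = {x. p \<bullet> x = 0}"

lemma subspace_tplane: "subspace (tplane p)"
  by (auto simp: subspace_def tplane_def inner_add_right)

lemma J_sphere_in: "J_sphere p v \<in> tplane p"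
  by (simp add: J_sphere_def tplane_def dot_cross_self)

lemma J_sphere_linear:
  "J_sphere p (v + w) = J_sphere p v + J_sphere p w" "J_sphere p (v - w) = J_sphere p v - J_sphere p w"
  "J_sphere p (c *\<^sub>R v) = c *\<^sub>R J_sphere p v" "J_sphere p (- v) = - J_sphere p v"
  by (simp_all add: J_sphere_def cross_add_left Cross3.left_diff_distrib cross_mult_left)

lemma bounded_linear_J_sphere: "bounded_linear (J_sphere p)"
  by (simp add: linear_conv_bounded_linear[symmetric] linear_iff J_sphere_linear)

lemma J_sphere_J_sphere:
  assumes "norm p = 1" "v \<in> tplane p"
  shows "J_sphere p (J_sphere p v) = - v"
proof -
  have "cross3 p (cross3 p v) = (p \<bullet> v) *\<^sub>R p - (p \<bullet> p) *\<^sub>R v"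
    by (rule Lagrange)
  then show ?thesis
    using assms by (simp add: J_sphere_def tplane_def dot_square_norm cross_skew[of _ p])
qed

lemma J_sphere_inner: "J_sphere p v \<bullet> w = - (v \<bullet> J_sphere p w)"
  by (simp add: J_sphere_def) (simp add: cross3_simps)

lemma J_sphere_self [simp]: "J_sphere p v \<bullet> v = 0"
  by (simp add: J_sphere_def dot_cross_self)

lemma J_sphere_isometry:
  assumes "norm p = 1" "v \<in> tplane p"
  shows "J_sphere p v \<bullet> J_sphere p w = v \<bullet> w"
  using J_sphere_inner[of p "J_sphere p v" w] J_sphere_J_sphere[OF assms] by simp

text \<open>
  The tangent plane is two-dimensional: \<open>e\<close> and \<open>J e\<close> form an orthonormal basis.
\<close>

lemma tplane_frame:
  assumes p: "norm p = 1"
  obtains e where "e \<in> tplane p" "norm e = 1"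
    "\<And>x. x \<in> tplane p \<Longrightarrow> x = (x \<bullet> e) *\<^sub>R e + (x \<bullet> J_sphere p e) *\<^sub>R J_sphere p e"
proof -
  obtain y where y: "y \<noteq> 0" "orthogonal p y"
    using orthogonal_to_vector_exists[of p] by auto
  define e where "e = sgn y"
  have e: "norm e = 1" "e \<in> tplane p"
    using y by (simp_all add: e_def norm_sgn sgn_div_norm tplane_def orthogonal_def)
  define f where "f = J_sphere p e"
  have ee: "e \<bullet> e = 1" using e by (simp add: dot_square_norm)
  have ff: "f \<bullet> f = 1" unfolding f_def using J_sphere_isometry[OF p e(2), of e] ee by simp
  have ef: "e \<bullet> f = 0" "f \<bullet> e = 0" unfolding f_def using J_sphere_self[of p e] by (simp_all add: inner_commute)
  have "x = (x \<bullet> e) *\<^sub>R e + (x \<bullet> f) *\<^sub>R f" if x: "x \<in> tplane p" for x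
  proof -
    define d where "d = x - (x \<bullet> e) *\<^sub>R e - (x \<bullet> f) *\<^sub>R f"
    have dV: "d \<in> tplane p" unfolding d_def
      using x e f_def J_sphere_in by (auto intro!: subspace_diff subspace_scale subspace_tplane)
    have de: "d \<bullet> e = 0" "d \<bullet> f = 0"
      by (simp_all add: d_def inner_diff_left ee ff ef)
    have "cross3 d f = (d \<bullet> p) *\<^sub>R e - (d \<bullet> e) *\<^sub>R p"
      unfolding f_def J_sphere_def by (rule Lagrange)
    then have "cross3 d f = 0" using dV de by (simp add: tplane_def inner_commute)
    then have "norm d * norm f = 0"
      using norm_cross_dot[of d f] de by simp
    moreover have "norm f = 1" using ff by (simp add: norm_eq_sqrt_inner)
    ultimately have "d = 0" by simp
    then show ?thesis by (simp add: d_def algebra_simps)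
  qed
  then show ?thesis using that[of e] e by (simp add: f_def)
qed

lemma tplane_norm:
  assumes "norm p = 1" "x \<in> tplane p"
  shows "(p + x) \<bullet> (p + x) = nsq x" "norm (p + x) = sqrt (nsq x)"
proof -
  show "(p + x) \<bullet> (p + x) = nsq x"
    using assms by (simp add: inner_add inner_commute norm_eq_1 tplane_def)
  then show "norm (p + x) = sqrt (nsq x)" by (simp add: norm_eq_sqrt_inner)
qed

lemma sphere_par_eq:
  assumes "norm p = 1" "x \<in> tplane p"
  shows "sphere_par p x = inverse (sqrt (nsq x)) *\<^sub>R (p + x)"
  using tplane_norm(2)[OF assms] by (simp add: sphere_par_def sgn_div_norm)

lemma rsqrt_line_derivative:
  fixes x v :: "'e::real_inner"
  shows "((\<lambda>t. inverse (sqrt (nsq (x + t *\<^sub>R v)))) has_real_derivative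
     - (x \<bullet> v) * inverse (sqrt (nsq x)) ^ 3) (at 0)"
proof -
  have "nsq (x + t *\<^sub>R v) = nsq x + 2 * (x \<bullet> v) * t + (v \<bullet> v) * t\<^sup>2" for t
    by (simp add: inner_add inner_commute power2_eq_square algebra_simps)
  moreover have "((\<lambda>t. inverse (sqrt (nsq x + 2 * (x \<bullet> v) * t + (v \<bullet> v) * t\<^sup>2))) has_real_derivative
     - (x \<bullet> v) * inverse (sqrt (nsq x)) ^ 3) (at 0)"
    using one_plus_inner_pos[of x]
    by (auto intro!: derivative_eq_intros simp: field_simps power3_eq_cube power2_eq_square)
  ultimately show ?thesis by (simp only:)
qed

lemma dird_sphere_par:
  assumes p: "norm p = 1" and x: "x \<in> tplane p" and v: "v \<in> tplane p"
  shows "dird (sphere_par p) x v = inverse (sqrt (nsq x)) *\<^sub>R v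
     - ((x \<bullet> v) * inverse (sqrt (nsq x)) ^ 3) *\<^sub>R (p + x)"
proof -
  have "dird (sphere_par p) x v = dird (\<lambda>x. inverse (sqrt (nsq x)) *\<^sub>R (p + x)) x v"
    by (rule dird_cong[OF subspace_tplane x v sphere_par_eq[OF p]])
  also have "\<dots> = inverse (sqrt (nsq x)) *\<^sub>R v
     + (- (x \<bullet> v) * inverse (sqrt (nsq x)) ^ 3) *\<^sub>R (p + x)"
  proof (rule dird_eqI)
    have "((\<lambda>t. p + (x + t *\<^sub>R v)) has_vector_derivative v) (at 0)"
      by (auto intro!: derivative_eq_intros)
    from has_vector_derivative_scaleR[OF rsqrt_line_derivative[of x v] this]
    show "((\<lambda>t. inverse (sqrt (nsq (x + t *\<^sub>R v))) *\<^sub>R (p + (x + t *\<^sub>R v))) has_vector_derivative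
        inverse (sqrt (nsq x)) *\<^sub>R v
     + (- (x \<bullet> v) * inverse (sqrt (nsq x)) ^ 3) *\<^sub>R (p + x)) (at 0)"
      by simp
  qed
  finally show ?thesis by simp
qed

lemma rsqrt_pow:
  fixes x :: "'e::real_inner"
  defines "r \<equiv> inverse (sqrt (nsq x))"
  shows "r * r = inverse (nsq x)" "r > 0" "r * sqrt (nsq x) = 1"
  using one_plus_inner_pos[of x] by (simp_all add: r_def flip: inverse_mult_distrib)

text \<open>
  The area form needs only \<open>det (v, p + x, w) = det (v, p, w)\<close>, as \<open>v\<close>, \<open>x\<close> and \<open>w\<close> lie in a plane.
\<close>

lemma sphere_metric_form:
  assumes p: "norm p = 1" and x: "x \<in> tplane p" and v: "v \<in> tplane p" and w: "w \<in> tplane p"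
  shows "dird (sphere_par p) x v \<bullet> dird (sphere_par p) x w
     = v \<bullet> w / nsq x - (x \<bullet> v) * (x \<bullet> w) / (nsq x)\<^sup>2"
    and "omega_sphere (sphere_par p x) (dird (sphere_par p) x v) (dird (sphere_par p) x w)
     = inverse (sqrt (nsq x)) ^ 3 * (J_sphere p v \<bullet> w)"
proof -
  define s where "s = nsq x"
  define r where "r = inverse (sqrt s)"
  define z where "z = p + x"
  have s: "s > 0" by (simp add: s_def one_plus_inner_pos)
  have rr: "r * r = 1 / s" using rsqrt_pow(1)[of x] by (simp add: r_def s_def field_simps)
  have zz: "z \<bullet> z = s" using tplane_norm(1)[OF p x] by (simp add: z_def s_def)
  have zv: "z \<bullet> v = x \<bullet> v" "z \<bullet> w = x \<bullet> w" "v \<bullet> z = x \<bullet> v"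
    using v w by (simp_all add: z_def tplane_def inner_add inner_commute[of v])
  have T: "dird (sphere_par p) x v = r *\<^sub>R (v - ((x \<bullet> v) / s) *\<^sub>R z)"
     "dird (sphere_par p) x w = r *\<^sub>R (w - ((x \<bullet> w) / s) *\<^sub>R z)"
    unfolding dird_sphere_par[OF p x v] dird_sphere_par[OF p x w] s_def[symmetric] r_def[symmetric] z_def[symmetric]
    using rr by (simp_all add: power3_eq_cube scaleR_diff_right mult.assoc)
  have "(v - ((x \<bullet> v) / s) *\<^sub>R z) \<bullet> (w - ((x \<bullet> w) / s) *\<^sub>R z)
     = v \<bullet> w - (x \<bullet> v) * (x \<bullet> w) / s"
    using s by (simp add: inner_diff zz zv field_simps)
  then have "dird (sphere_par p) x v \<bullet> dird (sphere_par p) x w = (r * r) * (v \<bullet> w - (x \<bullet> v) * (x \<bullet> w) / s)"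
    unfolding T by simp
  then show "dird (sphere_par p) x v \<bullet> dird (sphere_par p) x w
     = v \<bullet> w / nsq x - (x \<bullet> v) * (x \<bullet> w) / (nsq x)\<^sup>2"
    unfolding rr s_def[symmetric] by (simp add: diff_divide_distrib power2_eq_square)
  have 1: "cross3 v x \<bullet> w = 0"
  proof -
    obtain e where e: "\<And>x. x \<in> tplane p \<Longrightarrow> x = (x \<bullet> e) *\<^sub>R e + (x \<bullet> J_sphere p e) *\<^sub>R J_sphere p e"
      using tplane_frame[OF p] by blast
    show ?thesis
      by (subst e[OF x], subst e[OF v], subst e[OF w])
        (simp add: cross_add_left cross_add_right cross_mult_left cross_mult_right inner_add inner_diff
          dot_cross_self cross_skew[of "J_sphere p e" e])
  qed
  have "omega_sphere (sphere_par p x) (dird (sphere_par p) x v) (dird (sphere_par p) x w)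
     = r^3 * (cross3 (v - ((x \<bullet> v) / s) *\<^sub>R z) z \<bullet> (w - ((x \<bullet> w) / s) *\<^sub>R z))"
    unfolding omega_sphere_def J_sphere_def T sphere_par_eq[OF p x] s_def[symmetric] r_def[symmetric] z_def[symmetric]
    by (simp add: cross_mult_left cross_mult_right power3_eq_cube)
  also have "cross3 (v - ((x \<bullet> v) / s) *\<^sub>R z) z \<bullet> (w - ((x \<bullet> w) / s) *\<^sub>R z) = cross3 v z \<bullet> w"
    by (simp add: Cross3.left_diff_distrib cross_mult_left inner_diff_right dot_cross_self)
  also have "\<dots> = cross3 v p \<bullet> w" using 1 by (simp add: z_def cross_add_right inner_add_left)
  finally show "omega_sphere (sphere_par p x) (dird (sphere_par p) x v) (dird (sphere_par p) x w)
     = inverse (sqrt (nsq x)) ^ 3 * (J_sphere p v \<bullet> w)"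
    by (simp add: r_def s_def J_sphere_def)
qed

lemma sphere_kahler_simps:
  "charts (sphere_kahler n) = sphere 0 1" "model (sphere_kahler n) = tplane"
  "param (sphere_kahler n) = (\<lambda>p x. Abs_S2 (sphere_par p x))"
  "metric (sphere_kahler n) p x v w = real n * (dird (sphere_par p) x v \<bullet> dird (sphere_par p) x w)"
  "sympl (sphere_kahler n) p x v w = real n *
       omega_sphere (sphere_par p x) (dird (sphere_par p) x v) (dird (sphere_par p) x w)"
  by (simp_all add: sphere_kahler_def tplane_def fun_eq_iff)

lemma sphere_ham_unique:
  assumes n: "n > 0" and p: "norm p = 1" and x: "x \<in> tplane p" and X: "X \<in> tplane p"
    and eq: "\<And>v. v \<in> tplane p \<Longrightarrow> real n * (inverse (sqrt (nsq x)) ^ 3 * (J_sphere p X \<bullet> v))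
       = dird (\<lambda>y. f (Abs_S2 (sphere_par p y))) x v"
  shows "ham (sphere_kahler n) f p x = X"
  unfolding ham_def sphere_kahler_simps
proof (rule the_equality)
  show "X \<in> tplane p \<and> (\<forall>v\<in>tplane p. real n *
       omega_sphere (sphere_par p x) (dird (sphere_par p) x X) (dird (sphere_par p) x v)
      = dird (f \<circ> (\<lambda>x. Abs_S2 (sphere_par p x))) x v)"
    using X eq sphere_metric_form(2)[OF p x X] by (simp add: o_def)
next
  fix Y assume Y: "Y \<in> tplane p \<and> (\<forall>v\<in>tplane p. real n *
       omega_sphere (sphere_par p x) (dird (sphere_par p) x Y) (dird (sphere_par p) x v)
      = dird (f \<circ> (\<lambda>x. Abs_S2 (sphere_par p x))) x v)"
  define v where "v = J_sphere p (Y - X)"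
  have v: "v \<in> tplane p" unfolding v_def by (rule J_sphere_in)
  have D: "Y - X \<in> tplane p" using Y X subspace_tplane by (auto intro: subspace_diff)
  have "real n * (inverse (sqrt (nsq x)) ^ 3 * (J_sphere p Y \<bullet> v))
      = real n * (inverse (sqrt (nsq x)) ^ 3 * (J_sphere p X \<bullet> v))"
    using Y[THEN conjunct2, rule_format, OF v] eq[OF v] sphere_metric_form(2)[OF p x _ v, of Y] Y
    by (simp add: o_def)
  then have "J_sphere p Y \<bullet> v = J_sphere p X \<bullet> v"
    using n rsqrt_pow(2)[of x] by simp
  then have "v \<bullet> v = 0"
    unfolding v_def J_sphere_linear by (simp add: inner_diff_left)
  then have "(Y - X) \<bullet> (Y - X) = 0"
    using J_sphere_isometry[OF p D] by (simp add: v_def)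
  then show "Y = X" by simp
qed

lemma sqrt_one_plus_inner:
  fixes x :: "'e::real_inner"
  shows "(nsq x) * inverse (sqrt (nsq x)) = sqrt (nsq x)"
  using one_plus_inner_pos[of x] by (simp add: field_simps)

lemma smooth_on_sqrt:
  fixes V :: "'e::euclidean_space set"
  assumes V: "subspace V"
  shows "smooth_on V (\<lambda>y. sqrt (nsq y))"
proof -
  have "smooth_on V (\<lambda>y. (nsq y) * inverse (sqrt (nsq y)))"
    by (intro smooth_on_mult smooth_on_add smooth_on_const smooth_on_inner V bounded_linear_ident smooth_on_rsqrt)
  then show ?thesis by (simp add: sqrt_one_plus_inner)
qed

lemma sqrt_line_derivative:
  fixes x v :: "'e::real_inner"
  shows "((\<lambda>t. sqrt (nsq (x + t *\<^sub>R v))) has_real_derivative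
     (x \<bullet> v) * inverse (sqrt (nsq x))) (at 0)"
proof -
  have "nsq (x + t *\<^sub>R v) = nsq x + 2 * (x \<bullet> v) * t + (v \<bullet> v) * t\<^sup>2" for t
    by (simp add: inner_add inner_commute power2_eq_square algebra_simps)
  moreover have "((\<lambda>t. sqrt (nsq x + 2 * (x \<bullet> v) * t + (v \<bullet> v) * t\<^sup>2)) has_real_derivative
     (x \<bullet> v) * inverse (sqrt (nsq x))) (at 0)"
    using one_plus_inner_pos[of x]
    by (auto intro!: derivative_eq_intros simp: field_simps)
  ultimately show ?thesis by (simp only:)
qed

lemma dird_sqrt_mult:
  fixes \<phi> :: "'e::euclidean_space \<Rightarrow> real"
  assumes V: "subspace V" and \<phi>: "smooth_on V \<phi>" and "x \<in> V" "v \<in> V"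
  shows "dird (\<lambda>y. sqrt (nsq y) * \<phi> y) x v
    = sqrt (nsq x) * dird \<phi> x v + (x \<bullet> v) * inverse (sqrt (nsq x)) * \<phi> x"
proof (rule dird_eqI)
  show "((\<lambda>t. sqrt (nsq (x + t *\<^sub>R v)) * \<phi> (x + t *\<^sub>R v)) has_vector_derivative
      sqrt (nsq x) * dird \<phi> x v + (x \<bullet> v) * inverse (sqrt (nsq x)) * \<phi> x) (at 0)"
    using DERIV_mult[OF sqrt_line_derivative[of x v] smooth_on_line_real[OF assms, of 0]]
    by (simp add: has_real_derivative_iff_has_vector_derivative[symmetric] algebra_simps)
qed

text \<open>
  As for projective space, the field is expressed by the homogenized function, here of degree one:
  \<open>h = sqrt (1 + \<bar>x\<bar>\<^sup>2) f\<close>.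
\<close>

lemma sphere_ham_eq:
  assumes n: "n > 0" and p: "norm p = 1"
    and sm: "smooth_on (tplane p) (\<lambda>y. f (Abs_S2 (sphere_par p y)))"
    and x: "x \<in> tplane p" and B: "B \<in> tplane p"
  defines "h \<equiv> (\<lambda>y. sqrt (nsq y) * f (Abs_S2 (sphere_par p y)))"
  assumes grad: "\<And>v. v \<in> tplane p \<Longrightarrow> B \<bullet> v = dird h x v"
  shows "ham (sphere_kahler n) f p x = (- 1 / real n) *\<^sub>R J_sphere p (nsq x *\<^sub>R B - h x *\<^sub>R x)"
proof (rule sphere_ham_unique[OF n p x])
  show "(- 1 / real n) *\<^sub>R J_sphere p (nsq x *\<^sub>R B - h x *\<^sub>R x) \<in> tplane p"
    by (intro subspace_scale subspace_tplane J_sphere_in)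
next
  fix v assume v: "v \<in> tplane p"
  define s where "s = nsq x"
  have s: "s > 0" by (simp add: s_def one_plus_inner_pos)
  define r where "r = inverse (sqrt s)"
  have rr: "r * (r * s) = 1" "r > 0" "sqrt s * r = 1"
     using rsqrt_pow[of x] s by (simp_all add: r_def s_def field_simps)
  have "s *\<^sub>R B - h x *\<^sub>R x \<in> tplane p" using B x by (intro subspace_diff subspace_scale subspace_tplane)
  note JJ = J_sphere_J_sphere[OF p this]
  have "real n * (r ^ 3 * (J_sphere p ((- 1 / real n) *\<^sub>R J_sphere p (s *\<^sub>R B - h x *\<^sub>R x)) \<bullet> v))
     = r ^ 3 * (s * (B \<bullet> v) - h x * (x \<bullet> v))"
    using n unfolding J_sphere_linear(3) JJ by (simp add: inner_diff_left algebra_simps)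
  also have "\<dots> = r * (r * (r * s)) * (B \<bullet> v) - r ^ 3 * h x * (x \<bullet> v)"
    by (simp add: algebra_simps power3_eq_cube)
  also have "\<dots> = r * (B \<bullet> v) - r ^ 3 * h x * (x \<bullet> v)"
    unfolding rr(1) by simp
  also have "B \<bullet> v = sqrt s * dird (\<lambda>y. f (Abs_S2 (sphere_par p y))) x v
      + (x \<bullet> v) * r * f (Abs_S2 (sphere_par p x))"
    unfolding grad[OF v] h_def dird_sqrt_mult[OF subspace_tplane sm x v] by (simp add: s_def r_def)
  also have "r * (sqrt s * dird (\<lambda>y. f (Abs_S2 (sphere_par p y))) x v
      + (x \<bullet> v) * r * f (Abs_S2 (sphere_par p x))) - r ^ 3 * h x * (x \<bullet> v)
    = (sqrt s * r) * dird (\<lambda>y. f (Abs_S2 (sphere_par p y))) x v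
      + r * r * (1 - r * sqrt s) * ((x \<bullet> v) * f (Abs_S2 (sphere_par p x)))"
    by (simp add: h_def s_def algebra_simps power3_eq_cube)
  also have "\<dots> = dird (\<lambda>y. f (Abs_S2 (sphere_par p y))) x v"
    using rr by (simp add: mult.commute)
  finally show "real n * (inverse (sqrt (nsq x)) ^ 3 *
     (J_sphere p ((- 1 / real n) *\<^sub>R J_sphere p (nsq x *\<^sub>R B - h x *\<^sub>R x)) \<bullet> v))
     = dird (\<lambda>y. f (Abs_S2 (sphere_par p y))) x v"
    by (simp add: r_def s_def)
qed

lemma sphere_metric_deriv:
  fixes x v w \<xi> :: "'e::real_inner"
  shows "((\<lambda>t. v \<bullet> w / (nsq (x + t *\<^sub>R \<xi>))
      - ((x + t *\<^sub>R \<xi>) \<bullet> v) * ((x + t *\<^sub>R \<xi>) \<bullet> w) / (nsq (x + t *\<^sub>R \<xi>))\<^sup>2)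
    has_real_derivative
     - 2 * (x \<bullet> \<xi>) * (v \<bullet> w) / (nsq x)\<^sup>2
      - ((\<xi> \<bullet> v) * (x \<bullet> w) + (x \<bullet> v) * (\<xi> \<bullet> w)) / (nsq x)\<^sup>2
      + 4 * (x \<bullet> \<xi>) * (x \<bullet> v) * (x \<bullet> w) / (nsq x)^3) (at 0)"
proof -
  define s where "s = nsq x"
  have s: "s > 0" by (simp add: s_def one_plus_inner_pos)
  have *: "nsq (x + t *\<^sub>R \<xi>) = s + 2 * (x \<bullet> \<xi>) * t + (\<xi> \<bullet> \<xi>) * t\<^sup>2" for t
    by (simp add: s_def inner_add inner_commute power2_eq_square algebra_simps)
  show ?thesis
    unfolding * unfolding inner_add_left inner_scaleR_left s_def[symmetric] using s
    by (auto intro!: derivative_eq_intros simp: field_simps power2_eq_square power3_eq_cube)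
qed

text \<open>
  Up to a positive factor, this operator represents both the metric in central projection and the
  Hessian of \<open>sqrt (1 + \<bar>x\<bar>\<^sup>2)\<close>.
\<close>

definition gsharp :: "real^3 \<Rightarrow> real^3 \<Rightarrow> real^3" where
  "gsharp x v = v - ((x \<bullet> v) / nsq x) *\<^sub>R x"

lemma gsharp_in: "x \<in> tplane p \<Longrightarrow> v \<in> tplane p \<Longrightarrow> gsharp x v \<in> tplane p"
  unfolding gsharp_def by (intro subspace_diff subspace_scale subspace_tplane)

text \<open>
  The Lie derivative of the metric in an orthonormal frame \<open>e\<close>, \<open>J e\<close>, multiplied by \<open>s\<^sup>3\<close>.  The pairs
  \<open>B\<close>, \<open>Y\<close>, \<open>a\<close>, \<open>b\<close>, \<open>Z\<close>, \<open>W\<close> are the coordinates of the gradient, of the Hamiltonian field without its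
  rotation and factor, of the Hessian applied to \<open>v\<close> and \<open>w\<close>, and of the derivatives of \<open>Y\<close>.
\<close>

lemma lie_polynomial_identity:
  fixes x1 :: real
  assumes s: "s = 1 + x1^2 + x2^2"
    and Y1: "Y1 = s * B1 - h * x1" and Y2: "Y2 = s * B2 - h * x2"
    and Z1: "Z1 = 2 * (x1 * v1 + x2 * v2) * B1 + s * a1 - (B1 * v1 + B2 * v2) * x1 - h * v1"
    and Z2: "Z2 = 2 * (x1 * v1 + x2 * v2) * B2 + s * a2 - (B1 * v1 + B2 * v2) * x2 - h * v2"
    and W1: "W1 = 2 * (x1 * w1 + x2 * w2) * B1 + s * b1 - (B1 * w1 + B2 * w2) * x1 - h * w1"
    and W2: "W2 = 2 * (x1 * w1 + x2 * w2) * B2 + s * b2 - (B1 * w1 + B2 * w2) * x2 - h * w2"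
  shows "- 2 * (Y1 * x2 - Y2 * x1) * (v1 * w1 + v2 * w2) * s
     - ((Y1 * v2 - Y2 * v1) * (x1 * w1 + x2 * w2) + (x1 * v1 + x2 * v2) * (Y1 * w2 - Y2 * w1)) * s
     + 4 * (Y1 * x2 - Y2 * x1) * (x1 * v1 + x2 * v2) * (x1 * w1 + x2 * w2)
     + (Z1 * w2 - Z2 * w1) * s^2 - (Z1 * x2 - Z2 * x1) * (x1 * w1 + x2 * w2) * s
     + (W1 * v2 - W2 * v1) * s^2 - (x1 * v1 + x2 * v2) * (W1 * x2 - W2 * x1) * s
   = (s * (a1 * w2 - a2 * w1) - (x1 * w1 + x2 * w2) * (a1 * x2 - a2 * x1)) * s^2
     + (s * (b1 * v2 - b2 * v1) - (x1 * v1 + x2 * v2) * (b1 * x2 - b2 * x1)) * s^2"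
  unfolding Y1 Y2 Z1 Z2 W1 W2 s by algebra

text \<open>
  Again only the Hessian of \<open>h\<close> survives: a function \<open>h\<close> that is affine in the chart comes from a linear
  function on \<open>\<real>\<^sup>3\<close>, whose Hamiltonian field is a rotation.
\<close>

lemma sphere_lie_metric_eq:
  assumes n: "n > 0" and p: "norm p = 1"
    and sm: "smooth_on (tplane p) (\<lambda>y. f (Abs_S2 (sphere_par p y)))"
    and x: "x \<in> tplane p" and v: "v \<in> tplane p" and w: "w \<in> tplane p"
  defines "h \<equiv> (\<lambda>y. sqrt (nsq y) * f (Abs_S2 (sphere_par p y)))"
  shows "lie_metric (sphere_kahler n) p (ham (sphere_kahler n) f p) x v w
    = hess h x v (J_sphere p (gsharp x w))
      + hess h x w (J_sphere p (gsharp x v))"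
proof -
  define V where "V = tplane p"
  have V: "subspace V" unfolding V_def by (rule subspace_tplane)
  note [simp] = x[folded V_def] v[folded V_def] w[folded V_def]
  have h: "smooth_on V h" unfolding h_def V_def
    by (intro smooth_on_mult smooth_on_sqrt subspace_tplane sm)
  obtain B S where B [rule_format]: "\<forall>x\<in>V. B x \<in> V" "\<forall>x\<in>V. \<forall>v\<in>V. B x \<bullet> v = dird h x v"
    and S [rule_format]: "\<forall>x\<in>V. \<forall>v\<in>V. S x v \<in> V" "\<forall>x\<in>V. \<forall>v\<in>V. \<forall>w\<in>V. S x v \<bullet> w = hess h x v w"
    "\<forall>x\<in>V. \<forall>v\<in>V. ((\<lambda>t. B (x + t *\<^sub>R v)) has_vector_derivative S x v) (at 0)"
    using subspace_gradient[OF V h] .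
  define Y where "Y y = (nsq y) *\<^sub>R B y - h y *\<^sub>R y" for y
  define Z where "Z a = (2 * (x \<bullet> a)) *\<^sub>R B x + (nsq x) *\<^sub>R S x a - (B x \<bullet> a) *\<^sub>R x - h x *\<^sub>R a" for a
  define X where "X y = (- 1 / real n) *\<^sub>R J_sphere p (Y y)" for y
  have ham: "ham (sphere_kahler n) f p y = X y" if y: "y \<in> V" for y
    unfolding X_def Y_def h_def
    using sphere_ham_eq[OF n p sm] B y unfolding V_def h_def by blast
  have XV: "X y \<in> V" for y
    unfolding X_def V_def by (intro subspace_scale subspace_tplane J_sphere_in)
  have YV: "Y x \<in> V" and ZV: "a \<in> V \<Longrightarrow> Z a \<in> V" for a
    unfolding Y_def Z_def
    by (intro subspace_diff[OF V] subspace_add[OF V] subspace_scale[OF V] B(1) S(1); simp)+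
  have metric: "metric (sphere_kahler n) p y a b
      = real n * (a \<bullet> b / nsq y - (y \<bullet> a) * (y \<bullet> b) / (nsq y)\<^sup>2)"
    if "y \<in> V" "a \<in> V" "b \<in> V" for y a b
    using that sphere_metric_form(1)[OF p] by (simp add: sphere_kahler_simps V_def)
  have dX: "dird X x a = (- 1 / real n) *\<^sub>R J_sphere p (Z a)" if a: "a \<in> V" for a
  proof (rule dird_eqI)
    have l: "((\<lambda>t::real. x + t *\<^sub>R a) has_vector_derivative a) (at 0)"
      by (auto intro!: derivative_eq_intros)
    note SB = S(3)[of x a, simplified, OF a]
    have dh: "((\<lambda>t. h (x + t *\<^sub>R a)) has_real_derivative B x \<bullet> a) (at 0)"
      using smooth_on_line_real[OF V h _ a, of x 0] B(2)[of x a] a by simp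
    have ds: "((\<lambda>t. nsq (x + t *\<^sub>R a)) has_real_derivative 2 * (x \<bullet> a)) (at 0)"
    proof -
      have "((\<lambda>t. (x + t *\<^sub>R a) \<bullet> (x + t *\<^sub>R a)) has_real_derivative 2 * (x \<bullet> a)) (at 0)"
        using bounded_bilinear.has_vector_derivative[OF bounded_bilinear_inner l l]
        by (simp add: has_real_derivative_iff_has_vector_derivative inner_commute[of a])
      then show ?thesis by (auto intro!: derivative_eq_intros)
    qed
    have "((\<lambda>t. Y (x + t *\<^sub>R a)) has_vector_derivative
        (nsq x) *\<^sub>R S x a + (2 * (x \<bullet> a)) *\<^sub>R B x - (h x *\<^sub>R a + (B x \<bullet> a) *\<^sub>R x)) (at 0)"
      unfolding Y_def
      using has_vector_derivative_diff[OF has_vector_derivative_scaleR[OF ds SB] has_vector_derivative_scaleR[OF dh l]]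
      by simp
    also have "(nsq x) *\<^sub>R S x a + (2 * (x \<bullet> a)) *\<^sub>R B x - (h x *\<^sub>R a + (B x \<bullet> a) *\<^sub>R x) = Z a"
      by (simp add: Z_def algebra_simps)
    finally have "((\<lambda>t. Y (x + t *\<^sub>R a)) has_vector_derivative Z a) (at 0)" .
    from bounded_linear.has_vector_derivative[OF bounded_linear_compose[OF bounded_linear_scaleR_right
        bounded_linear_J_sphere] this]
    show "((\<lambda>t. X (x + t *\<^sub>R a)) has_vector_derivative (- 1 / real n) *\<^sub>R J_sphere p (Z a)) (at 0)"
      unfolding X_def .
  qed
  obtain e where e: "e \<in> tplane p" "norm e = 1"
    "\<And>x. x \<in> tplane p \<Longrightarrow> x = (x \<bullet> e) *\<^sub>R e + (x \<bullet> J_sphere p e) *\<^sub>R J_sphere p e"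
    using tplane_frame[OF p] by blast
  define c1 where "c1 a = a \<bullet> e" for a
  define c2 where "c2 a = a \<bullet> J_sphere p e" for a
  have Jc: "c1 (J_sphere p a) = - c2 a" "c2 (J_sphere p a) = c1 a" if "a \<in> V" for a
    using that J_sphere_isometry[OF p, of a e] J_sphere_inner[of p a e] by (simp_all add: c1_def c2_def V_def)
  have ip: "a \<bullet> b = c1 a * c1 b + c2 a * c2 b" if "a \<in> V" for a b
    using arg_cong[OF e(3)[of a], of "\<lambda>z. z \<bullet> b"] that
    by (simp add: V_def c1_def c2_def inner_add_left inner_commute[of b])
  have JV: "J_sphere p a \<in> V" for a unfolding V_def by (rule J_sphere_in)
  have clin: "c1 (a - b) = c1 a - c1 b" "c2 (a - b) = c2 a - c2 b" "c1 (a + b) = c1 a + c1 b" "c2 (a + b) = c2 a + c2 b"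
     "c1 (r *\<^sub>R a) = r * c1 a" "c2 (r *\<^sub>R a) = r * c2 a" for a b r
    by (simp_all add: c1_def c2_def inner_add_left inner_diff_left)
  define s where "s = nsq x"
  have s: "s > 0" by (simp add: s_def one_plus_inner_pos)
  have "lie_metric (sphere_kahler n) p (ham (sphere_kahler n) f p) x v w =
    dird (\<lambda>y. real n * (v \<bullet> w / nsq y - (y \<bullet> v) * (y \<bullet> w) / (nsq y)\<^sup>2)) x (X x)
     + real n * (dird X x v \<bullet> w / s - (x \<bullet> dird X x v) * (x \<bullet> w) / s\<^sup>2)
     + real n * (v \<bullet> dird X x w / s - (x \<bullet> v) * (x \<bullet> dird X x w) / s\<^sup>2)"
  proof -
    have "dird (ham (sphere_kahler n) f p) x a = dird X x a" if "a \<in> V" for a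
      using that by (intro dird_cong[OF V]) (auto simp: ham)
    moreover have "dird X x a \<in> V" if "a \<in> V" for a
      unfolding dX[OF that] by (intro subspace_scale[OF V] JV)
    moreover have "dird (\<lambda>y. metric (sphere_kahler n) p y v w) x (X x) =
       dird (\<lambda>y. real n * (v \<bullet> w / nsq y - (y \<bullet> v) * (y \<bullet> w) / (nsq y)\<^sup>2)) x (X x)"
      by (intro dird_cong[OF V]) (auto simp: metric XV)
    ultimately show ?thesis
      unfolding lie_metric_def s_def by (simp add: ham metric)
  qed
  also have "dird (\<lambda>y. real n * (v \<bullet> w / nsq y - (y \<bullet> v) * (y \<bullet> w) / (nsq y)\<^sup>2)) x (X x)
    = real n * (- 2 * (x \<bullet> X x) * (v \<bullet> w) / s\<^sup>2
      - ((X x \<bullet> v) * (x \<bullet> w) + (x \<bullet> v) * (X x \<bullet> w)) / s\<^sup>2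
      + 4 * (x \<bullet> X x) * (x \<bullet> v) * (x \<bullet> w) / s^3)"
    unfolding s_def
    by (rule dird_eqI)
      (use DERIV_cmult[OF sphere_metric_deriv[of v w x "X x"]] in
        \<open>simp add: has_real_derivative_iff_has_vector_derivative\<close>)
  also have "\<dots> + real n * (dird X x v \<bullet> w / s - (x \<bullet> dird X x v) * (x \<bullet> w) / s\<^sup>2)
     + real n * (v \<bullet> dird X x w / s - (x \<bullet> v) * (x \<bullet> dird X x w) / s\<^sup>2)
    = - ((- 2 * (x \<bullet> J_sphere p (Y x)) * (v \<bullet> w) / s\<^sup>2
      - ((J_sphere p (Y x) \<bullet> v) * (x \<bullet> w) + (x \<bullet> v) * (J_sphere p (Y x) \<bullet> w)) / s\<^sup>2
      + 4 * (x \<bullet> J_sphere p (Y x)) * (x \<bullet> v) * (x \<bullet> w) / s^3)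
     + (J_sphere p (Z v) \<bullet> w / s - (x \<bullet> J_sphere p (Z v)) * (x \<bullet> w) / s\<^sup>2)
     + (v \<bullet> J_sphere p (Z w) / s - (x \<bullet> v) * (x \<bullet> J_sphere p (Z w)) / s\<^sup>2))"
  proof -
    have "N * (- 2 * (k * a) * m / q - ((k * b) * w + v * (k * c)) / q + 4 * (k * a) * v * w / q')
       + N * ((k * d) / r - (k * e) * w / q) + N * ((k * g) / r - v * (k * i) / q)
      = (N * k) * ((- 2 * a * m / q - (b * w + v * c) / q + 4 * a * v * w / q')
       + (d / r - e * w / q) + (g / r - v * i / q))" for N k a b c d e g i m v w q q' r :: real
      by (simp add: algebra_simps add_divide_distrib diff_divide_distrib)
    note * = this[of "real n" "- 1 / real n"]
    have "real n * (- 1 / real n) = - 1" using n by simp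
    then show ?thesis
      unfolding dX[OF v[folded V_def]] dX[OF w[folded V_def]] X_def
        inner_scaleR_left inner_scaleR_right * by simp
  qed
  also have "\<dots> = - (
     (- 2 * (c1 (Y x) * c2 x - c2 (Y x) * c1 x) * (c1 v * c1 w + c2 v * c2 w) * s
     - ((c1 (Y x) * c2 v - c2 (Y x) * c1 v) * (c1 x * c1 w + c2 x * c2 w)
        + (c1 x * c1 v + c2 x * c2 v) * (c1 (Y x) * c2 w - c2 (Y x) * c1 w)) * s
     + 4 * (c1 (Y x) * c2 x - c2 (Y x) * c1 x) * (c1 x * c1 v + c2 x * c2 v) * (c1 x * c1 w + c2 x * c2 w)
     + (c1 (Z v) * c2 w - c2 (Z v) * c1 w) * s^2
     - (c1 (Z v) * c2 x - c2 (Z v) * c1 x) * (c1 x * c1 w + c2 x * c2 w) * s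
     + (c1 (Z w) * c2 v - c2 (Z w) * c1 v) * s^2
     - (c1 x * c1 v + c2 x * c2 v) * (c1 (Z w) * c2 x - c2 (Z w) * c1 x) * s) / s^3)"
    using s by (simp add: ip JV Jc YV ZV field_simps power2_eq_square power3_eq_cube)
  also have "\<dots> = - (((s * (c1 (S x v) * c2 w - c2 (S x v) * c1 w)
        - (c1 x * c1 w + c2 x * c2 w) * (c1 (S x v) * c2 x - c2 (S x v) * c1 x)) * s^2
     + (s * (c1 (S x w) * c2 v - c2 (S x w) * c1 v)
        - (c1 x * c1 v + c2 x * c2 v) * (c1 (S x w) * c2 x - c2 (S x w) * c1 x)) * s^2) / s^3)"
    apply (subst lie_polynomial_identity[of s "c1 x" "c2 x" "c1 (Y x)" "c1 (B x)" "h x" "c2 (Y x)" "c2 (B x)"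
       "c1 (Z v)" "c1 v" "c2 v" "c1 (S x v)" "c2 (Z v)" "c2 (S x v)"
       "c1 (Z w)" "c1 w" "c2 w" "c1 (S x w)" "c2 (Z w)" "c2 (S x w)"])
    apply (simp_all add: s_def[symmetric] Y_def Z_def clin)
    apply (simp_all add: s_def ip B power2_eq_square)
    done
  also have "\<dots> = S x v \<bullet> J_sphere p (gsharp x w) + S x w \<bullet> J_sphere p (gsharp x v)"
  proof -
    have gs: "c1 (J_sphere p (gsharp x a)) = - (c2 a - (c1 x * c1 a + c2 x * c2 a) / s * c2 x)"
      "c2 (J_sphere p (gsharp x a)) = c1 a - (c1 x * c1 a + c2 x * c2 a) / s * c1 x"
      if "a \<in> V" for a
      using Jc[of "gsharp x a"] gsharp_in[of x p a] that
      by (simp_all add: V_def[symmetric] s_def ip gsharp_def clin)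
    show ?thesis
      using s by (simp add: ip S gs field_simps power2_eq_square power3_eq_cube)
  qed
  also have "\<dots> = hess h x v (J_sphere p (gsharp x w))
      + hess h x w (J_sphere p (gsharp x v))"
    by (simp add: S(2) JV)
  finally show ?thesis .
qed


lemma dird_sqrt:
  fixes x v :: "'e::real_inner"
  shows "dird (\<lambda>y. sqrt (nsq y)) x v = (x \<bullet> v) * inverse (sqrt (nsq x))"
  using sqrt_line_derivative[of x v]
  by (intro dird_eqI) (simp add: has_real_derivative_iff_has_vector_derivative)

lemma dird2_sqrt:
  assumes "x \<in> tplane p" "v \<in> tplane p"
  shows "hess (\<lambda>y. sqrt (nsq y)) x v w
    = inverse (sqrt (nsq x)) * (gsharp x v \<bullet> w)"
proof (rule dird_eqI)
  define r where "r = inverse (sqrt (nsq x))"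
  have "((\<lambda>t. (x + t *\<^sub>R v) \<bullet> w) has_real_derivative v \<bullet> w) (at 0)"
    unfolding inner_add_left inner_scaleR_left by (auto intro!: derivative_eq_intros)
  from DERIV_mult[OF this rsqrt_line_derivative[of x v]]
  have "((\<lambda>t. ((x + t *\<^sub>R v) \<bullet> w) * inverse (sqrt (nsq (x + t *\<^sub>R v)))) has_real_derivative
     (v \<bullet> w) * r + (- (x \<bullet> v) * r ^ 3) * (x \<bullet> w)) (at 0)"
    by (simp add: r_def)
  moreover have "(v \<bullet> w) * r + (- (x \<bullet> v) * r ^ 3) * (x \<bullet> w) = r * (gsharp x v \<bullet> w)"
    using rsqrt_pow(1)[of x]
    by (simp add: gsharp_def inner_diff_left r_def[symmetric] power3_eq_cube algebra_simps divide_inverse)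
  ultimately show "((\<lambda>t. dird (\<lambda>y. sqrt (nsq y)) (x + t *\<^sub>R v) w) has_vector_derivative
      inverse (sqrt (nsq x)) * (gsharp x v \<bullet> w)) (at 0)"
    unfolding dird_sqrt has_real_derivative_iff_has_vector_derivative[symmetric] r_def by simp
qed

lemma gsharp_pos:
  assumes "v \<noteq> 0" shows "gsharp x v \<bullet> v > 0"
proof -
  define s where "s = nsq x"
  have s: "s > 0" by (simp add: s_def one_plus_inner_pos)
  have "s * (gsharp x v \<bullet> v) = v \<bullet> v + ((x \<bullet> x) * (v \<bullet> v) - (x \<bullet> v)\<^sup>2)"
    using s by (simp add: gsharp_def inner_diff_left s_def[symmetric] field_simps power2_eq_square)
      (simp add: s_def algebra_simps)
  moreover have "(x \<bullet> v)\<^sup>2 \<le> (x \<bullet> x) * (v \<bullet> v)" by (rule Cauchy_Schwarz_ineq)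
  moreover have "v \<bullet> v > 0" using assms by simp
  ultimately have "s * (gsharp x v \<bullet> v) > 0" by linarith
  then show ?thesis using s by (simp add: zero_less_mult_iff)
qed

lemma gsharp_sym: "gsharp x v \<bullet> w = v \<bullet> gsharp x w"
  by (simp add: gsharp_def inner_diff inner_commute)

lemma gsharp_linear:
  "gsharp x (v + w) = gsharp x v + gsharp x w"
  "gsharp x (c *\<^sub>R v) = c *\<^sub>R gsharp x v"
  by (simp_all add: gsharp_def inner_add_right algebra_simps add_divide_distrib)

section \<open>Kaehler functions on the sphere\<close>

text \<open>
  In a plane, \<open>q(v, J M v) = 0\<close> says that the vectors representing \<open>q(v, \<cdot>)\<close> and \<open>M v\<close> are parallel.  If
  this holds for all \<open>v\<close>, then every vector is an eigenvector of the quotient of the two operators,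
  which is therefore a scalar.
\<close>

lemma proportional_of_isotropic:
  fixes q :: "real^3 \<Rightarrow> real^3 \<Rightarrow> real"
  assumes p: "norm p = 1" and x: "x \<in> tplane p"
    and add: "\<And>a b c. a \<in> tplane p \<Longrightarrow> b \<in> tplane p \<Longrightarrow> c \<in> tplane p \<Longrightarrow> q a (b + c) = q a b + q a c"
    and sc: "\<And>a b r. a \<in> tplane p \<Longrightarrow> b \<in> tplane p \<Longrightarrow> q a (r *\<^sub>R b) = r * q a b"
    and sym: "\<And>a b. a \<in> tplane p \<Longrightarrow> b \<in> tplane p \<Longrightarrow> q a b = q b a"
    and iso: "\<And>v. v \<in> tplane p \<Longrightarrow> q v (J_sphere p (gsharp x v)) = 0"
  shows "\<exists>\<mu>. \<forall>v\<in>tplane p. \<forall>w\<in>tplane p. q v w = \<mu> * (gsharp x v \<bullet> w)"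
proof -
  obtain e where e: "e \<in> tplane p" "norm e = 1"
    "\<And>x. x \<in> tplane p \<Longrightarrow> x = (x \<bullet> e) *\<^sub>R e + (x \<bullet> J_sphere p e) *\<^sub>R J_sphere p e"
    using tplane_frame[OF p] by blast
  define f where "f = J_sphere p e"
  have f: "f \<in> tplane p" unfolding f_def by (rule J_sphere_in)
  note sub = subspace_add[OF subspace_tplane] subspace_scale[OF subspace_tplane]
  have expand: "q v w = (v \<bullet> e) * (w \<bullet> e) * q e e + ((v \<bullet> e) * (w \<bullet> f) + (v \<bullet> f) * (w \<bullet> e)) * q e f
     + (v \<bullet> f) * (w \<bullet> f) * q f f" if v: "v \<in> tplane p" and w: "w \<in> tplane p" for v w
  proof -
    have 1: "q a w = (w \<bullet> e) * q a e + (w \<bullet> f) * q a f" if a: "a \<in> tplane p" and w: "w \<in> tplane p" for a w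
    proof -
      have "q a w = q a ((w \<bullet> e) *\<^sub>R e + (w \<bullet> f) *\<^sub>R f)"
        unfolding f_def by (rule arg_cong[OF e(3)[OF w]])
      then show ?thesis
        using add[OF a, of "(w \<bullet> e) *\<^sub>R e" "(w \<bullet> f) *\<^sub>R f"] sc[OF a] e(1) f
        by (simp add: sub)
    qed
    show ?thesis
      using 1[OF v w] 1[OF e(1) v] 1[OF f v] sym[OF v e(1)] sym[OF v f] sym[OF f e(1)]
      by (simp add: algebra_simps)
  qed
  define M where "M a = gsharp x a" for a
  have MV: "M a \<in> tplane p" if "a \<in> tplane p" for a unfolding M_def by (rule gsharp_in[OF x that])
  define m11 where "m11 = M e \<bullet> e"
  define m12 where "m12 = M e \<bullet> f"
  define m22 where "m22 = M f \<bullet> f"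
  have m: "M f \<bullet> e = m12" "M f \<bullet> f = m22" "M e \<bullet> e = m11" "M e \<bullet> f = m12"
    using gsharp_sym[of x f e] inner_commute[of f "M e"]
    by (simp_all add: m11_def m12_def m22_def M_def)
  have Mexp: "M v \<bullet> w = (v \<bullet> e) * (w \<bullet> e) * m11 + ((v \<bullet> e) * (w \<bullet> f) + (v \<bullet> f) * (w \<bullet> e)) * m12
     + (v \<bullet> f) * (w \<bullet> f) * m22" if v: "v \<in> tplane p" and w: "w \<in> tplane p" for v w
  proof -
    have "M v = (v \<bullet> e) *\<^sub>R M e + (v \<bullet> f) *\<^sub>R M f"
      using arg_cong[OF e(3)[OF v], of M] by (simp add: M_def gsharp_linear f_def)
    moreover have "a \<bullet> w = (a \<bullet> e) * (w \<bullet> e) + (a \<bullet> f) * (w \<bullet> f)" for a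
      using arg_cong[OF e(3)[OF w], of "\<lambda>w. a \<bullet> w"] by (simp add: inner_add_right f_def mult.commute)
    ultimately show ?thesis by (simp add: m inner_add_left algebra_simps)
  qed
  have Jc: "J_sphere p a \<bullet> e = - (a \<bullet> f)" "J_sphere p a \<bullet> f = a \<bullet> e" if "a \<in> tplane p" for a
    using that J_sphere_isometry[OF p, of a e] J_sphere_inner[of p a e] by (simp_all add: f_def)
  have ee: "e \<bullet> e = 1" "f \<bullet> f = 1" "e \<bullet> f = 0" "f \<bullet> e = 0"
    using e(2) J_sphere_isometry[OF p e(1), of e] J_sphere_self[of p e]
    by (simp_all add: f_def norm_eq_1 inner_commute)
  have i: "q v (J_sphere p (M v)) = 0" if "v \<in> tplane p" for v using iso[OF that] by (simp add: M_def)
  have "q e f * m11 = q e e * m12"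
    using i[OF e(1)] expand[OF e(1) J_sphere_in[of p "M e"]] Jc[OF MV[OF e(1)]] by (simp add: ee m mult.commute)
  moreover have "q f f * m12 = q e f * m22"
    using i[OF f] expand[OF f J_sphere_in[of p "M f"]] Jc[OF MV[OF f]] by (simp add: ee m mult.commute)
  moreover have "q f f * m11 = q e e * m22"
  proof -
    have ef: "e + f \<in> tplane p" using e(1) f by (intro sub)
    have Mef: "M (e + f) = M e + M f" by (simp add: M_def gsharp_linear)
    have j: "J_sphere p (M (e + f)) \<bullet> e = - (m12 + m22)" "J_sphere p (M (e + f)) \<bullet> f = m11 + m12"
      using Jc[OF MV[OF ef]] by (simp_all add: Mef inner_add_left m)
    have "- (m12 + m22) * q e e + (m11 + m12 - (m12 + m22)) * q e f + (m11 + m12) * q f f = 0"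
      using i[OF ef] expand[OF ef J_sphere_in[of p "M (e + f)"]] unfolding j
      by (simp add: ee inner_add_left)
    then show ?thesis using calculation by (simp add: algebra_simps)
  qed
  moreover have "m11 > 0"
    unfolding m11_def M_def by (rule gsharp_pos) (use e(2) in auto)
  ultimately have "q e e = q e e / m11 * m11" "q e f = q e e / m11 * m12" "q f f = q e e / m11 * m22"
    by (simp_all add: field_simps)
  then obtain k where k: "q e e = k * m11" "q e f = k * m12" "q f f = k * m22" by blast
  have "q v w = k * (M v \<bullet> w)" if "v \<in> tplane p" "w \<in> tplane p" for v w
    unfolding expand[OF that] Mexp[OF that] k by (simp add: algebra_simps)
  then show ?thesis by (auto simp: M_def)
qed

text \<open>
  The Killing condition makes the Hessian \<open>q\<close> of \<open>h\<close> a multiple \<open>\<kappa>\<close> of the Hessian \<open>g\<close> of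
  \<open>\<rho> x = sqrt (1 + \<bar>x\<bar>\<^sup>2)\<close>.  Differentiating \<open>q = \<kappa> g\<close> along \<open>a\<close> and along \<open>v\<close> and comparing by the symmetry
  of third derivatives gives \<open>d\<kappa>(a) g(v, w) = d\<kappa>(v) g(a, w)\<close>.  For \<open>v\<close> orthogonal to \<open>a\<close> with respect to \<open>g\<close>
  and \<open>w = v\<close> this says \<open>d\<kappa>(a) = 0\<close>.  So \<open>\<kappa>\<close> is constant, and \<open>h - \<kappa> \<rho>\<close> is affine.
\<close>

lemma kahler_sphere_local:
  fixes f :: "S2 \<Rightarrow> real"
  assumes n: "n > 0" and f: "f \<in> kahler_functions (sphere_kahler n)" and p: "norm p = 1"
  shows "\<exists>a b. \<forall>x\<in>tplane p. f (Abs_S2 (sphere_par p x)) = a + b \<bullet> sphere_par p x"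
proof -
  define V where "V = tplane p"
  have V: "subspace V" unfolding V_def by (rule subspace_tplane)
  have V0: "0 \<in> V" by (simp add: V subspace_0)
  have JV: "J_sphere p a \<in> V" for a unfolding V_def by (rule J_sphere_in)
  have MV: "gsharp x a \<in> V" if "x \<in> V" "a \<in> V" for x a
    using that gsharp_in by (simp add: V_def)
  have sm: "smooth_on V (\<lambda>y. f (Abs_S2 (sphere_par p y)))"
    using f p unfolding kahler_functions_def smooth_function_def smooth_on_def V_def
    by (simp add: sphere_kahler_simps o_def)
  define h where "h = (\<lambda>y. sqrt (nsq y) * f (Abs_S2 (sphere_par p y)))"
  define \<rho> where "\<rho> = (\<lambda>y::real^3. sqrt (nsq y))"
  have \<rho>: "smooth_on V \<rho>" unfolding \<rho>_def by (rule smooth_on_sqrt[OF V])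
  have h: "smooth_on V h" unfolding h_def by (intro smooth_on_mult smooth_on_sqrt V sm)
  define q where "q x v w = hess h x v w" for x v w
  define g where "g x v w = hess \<rho> x v w" for x v w
  have g: "g x v w = inverse (sqrt (nsq x)) * (gsharp x v \<bullet> w)" if "x \<in> V" "v \<in> V" for x v w
    unfolding g_def \<rho>_def by (rule dird2_sqrt[OF that[unfolded V_def]])
  have gpos: "g x v v > 0" if "x \<in> V" "v \<in> V" "v \<noteq> 0" for x v
    unfolding g[OF that(1,2)] using gsharp_pos[OF that(3), of x] rsqrt_pow(2)[of x] by simp
  have qsym: "q x v w = q x w v" if "x \<in> V" "v \<in> V" "w \<in> V" for x v w
    unfolding q_def by (rule dird_symmetric[OF V h that(1,3,2)])
  have qlin: "q x a (b + c) = q x a b + q x a c" "q x a (r *\<^sub>R b) = r * q x a b"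
    if "x \<in> V" "a \<in> V" "b \<in> V" "c \<in> V" for x a b c r
    using dird_linear[OF V smooth_on_dird[OF h that(2)] that(1,3,4)] that
    by (simp_all add: qsym[of x a] subspace_add[OF V] subspace_scale[OF V]) (simp_all add: q_def)
  have prop0: "\<exists>\<mu>. \<forall>v\<in>V. \<forall>w\<in>V. q x v w = \<mu> * (gsharp x v \<bullet> w)" if x: "x \<in> V" for x
    unfolding V_def
  proof (rule proportional_of_isotropic[OF p x[unfolded V_def]])
    fix v assume v: "v \<in> tplane p"
    have "lie_metric (sphere_kahler n) p (ham (sphere_kahler n) f p) x v v = 0"
      using f p x v unfolding kahler_functions_def by (simp add: sphere_kahler_simps V_def)
    then show "q x v (J_sphere p (gsharp x v)) = 0"
      unfolding sphere_lie_metric_eq[OF n p sm[unfolded V_def] x[unfolded V_def] v v]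
      by (simp add: q_def h_def)
  qed (use qlin[OF x] qsym[OF x] V_def in auto)
  have propor: "\<exists>\<kappa>. \<forall>v\<in>V. \<forall>w\<in>V. q x v w = \<kappa> * g x v w" if x: "x \<in> V" for x
  proof -
    obtain \<mu> where \<mu>: "\<And>v w. v \<in> V \<Longrightarrow> w \<in> V \<Longrightarrow> q x v w = \<mu> * (gsharp x v \<bullet> w)"
      using prop0[OF x] by metis
    then show ?thesis
      using rsqrt_pow(3)[of x] by (intro exI[of _ "\<mu> * sqrt (nsq x)"]) (simp add: g[OF x] mult_ac)
  qed
  obtain e where e: "e \<in> V" "norm e = 1" using tplane_frame[OF p] V_def by metis
  have e0: "e \<noteq> 0" using e(2) by auto
  \<comment> \<open>Reading off the factor in one fixed direction shows that it is differentiable along lines.\<close>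
  define \<kappa> where "\<kappa> x = q x e e / g x e e" for x
  have q\<kappa>: "q x v w = \<kappa> x * g x v w" if "x \<in> V" "v \<in> V" "w \<in> V" for x v w
  proof -
    obtain k where k: "\<And>v w. v \<in> V \<Longrightarrow> w \<in> V \<Longrightarrow> q x v w = k * g x v w" using propor[OF \<open>x \<in> V\<close>] by metis
    have "\<kappa> x = k" using gpos[OF that(1) e(1) e0] k[OF e(1) e(1)] by (simp add: \<kappa>_def)
    then show ?thesis using k that by simp
  qed
  define q' where "q' x a v w = dird (\<lambda>y. q y v w) x a" for x a v w
  define g' where "g' x a v w = dird (\<lambda>y. g y v w) x a" for x a v w
  have qd: "((\<lambda>t. q (x + t *\<^sub>R a) v w) has_real_derivative q' x a v w) (at 0)"
    and gd: "((\<lambda>t. g (x + t *\<^sub>R a) v w) has_real_derivative g' x a v w) (at 0)"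
    if "x \<in> V" "a \<in> V" "v \<in> V" "w \<in> V" for x a v w
    using smooth_on_line_real[OF V smooth_on_dird[OF smooth_on_dird[OF h that(4)] that(3)] that(1,2), of 0]
      smooth_on_line_real[OF V smooth_on_dird[OF smooth_on_dird[OF \<rho> that(4)] that(3)] that(1,2), of 0]
    by (simp_all add: q_def g_def q'_def g'_def)
  have q'sym: "q' x a v w = q' x v a w" and g'sym: "g' x a v w = g' x v a w"
    if "x \<in> V" "a \<in> V" "v \<in> V" "w \<in> V" for x a v w
    using dird_symmetric[OF V smooth_on_dird[OF h that(4)] that(1,3,2)]
      dird_symmetric[OF V smooth_on_dird[OF \<rho> that(4)] that(1,3,2)]
    by (simp_all add: q'_def g'_def q_def g_def)
  have \<kappa>d: "\<exists>k. ((\<lambda>t. \<kappa> (x + t *\<^sub>R a)) has_real_derivative k) (at 0)" if "x \<in> V" "a \<in> V" for x a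
    using DERIV_divide[OF qd[OF that e(1) e(1)] gd[OF that e(1) e(1)]] gpos[OF that(1) e(1) e0]
    by (auto simp: \<kappa>_def)
  have \<kappa>0: "((\<lambda>t. \<kappa> (x + t *\<^sub>R a)) has_real_derivative 0) (at 0)" if x: "x \<in> V" and a: "a \<in> V" for x a
  proof (cases "a = 0")
    case True
    then show ?thesis by simp
  next
    case False
    \<comment> \<open>This vector is orthogonal to \<open>a\<close> with respect to \<open>g\<close>.\<close>
    define v where "v = J_sphere p (gsharp x a)"
    have v: "v \<in> V" unfolding v_def by (rule JV)
    have "gsharp x a \<noteq> 0" using gsharp_pos[OF False, of x] by auto
    then have v0: "v \<noteq> 0"
      using J_sphere_isometry[OF p, of "gsharp x a" "gsharp x a"] MV[OF x a]
      by (auto simp: v_def V_def)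
    have orth: "g x a v = 0" unfolding g[OF x a] v_def using J_sphere_self by (simp add: inner_commute)
    obtain k where k: "((\<lambda>t. \<kappa> (x + t *\<^sub>R a)) has_real_derivative k) (at 0)" using \<kappa>d[OF x a] by blast
    obtain l where l: "((\<lambda>t. \<kappa> (x + t *\<^sub>R v)) has_real_derivative l) (at 0)" using \<kappa>d[OF x v] by blast
    have line: "x + t *\<^sub>R b \<in> V" if "b \<in> V" for t b
      using that x by (intro subspace_add[OF V] subspace_scale[OF V])
    have "q' x a v v = k * g x v v + g' x a v v * \<kappa> x"
      using DERIV_unique[OF qd[OF x a v v]] DERIV_mult[OF k gd[OF x a v v]] q\<kappa>[OF line[OF a] v v]
      by simp
    moreover have "q' x v a v = l * g x a v + g' x v a v * \<kappa> x"
      using DERIV_unique[OF qd[OF x v a v]] DERIV_mult[OF l gd[OF x v a v]] q\<kappa>[OF line[OF v] a v]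
      by simp
    ultimately have "k * g x v v = 0"
      using q'sym[OF x a v v] g'sym[OF x a v v] orth by simp
    then have "k = 0" using gpos[OF x v v0] by simp
    then show ?thesis using k by simp
  qed
  have \<kappa>const: "\<kappa> x = \<kappa> 0" if x: "x \<in> V" for x
  proof -
    have "((\<lambda>t. \<kappa> (t *\<^sub>R x)) has_real_derivative 0) (at t)" for t
    proof -
      have "((\<lambda>s. \<kappa> (t *\<^sub>R x + s *\<^sub>R x)) has_real_derivative 0) (at 0)"
        by (rule \<kappa>0) (use x in \<open>auto intro: subspace_scale[OF V]\<close>)
      then have "((\<lambda>s. \<kappa> ((t + s) *\<^sub>R x)) has_real_derivative 0) (at 0)"
        by (simp add: scaleR_left_distrib)
      then show ?thesis
        using DERIV_shift[of "\<lambda>s. \<kappa> (s *\<^sub>R x)" 0 0 t] by (simp add: add.commute)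
    qed
    from DERIV_isconst_all[OF allI[OF this], of 1 0] show ?thesis by simp
  qed
  define c where "c = \<kappa> 0"
  define h0 where "h0 y = h y + (- c) * \<rho> y" for y
  have h0: "smooth_on V h0" unfolding h0_def by (intro smooth_on_add smooth_on_mult smooth_on_const V h \<rho>)
  have dh0: "dird h0 x v = dird h x v - c * dird \<rho> x v" if "x \<in> V" "v \<in> V" for x v
    unfolding h0_def mult_minus_left add_uminus_conv_diff
    by (rule dird_eqI)
      (use DERIV_diff[OF smooth_on_line_real[OF V h that, of 0] DERIV_cmult[OF smooth_on_line_real[OF V \<rho> that, of 0], of c]]
        in \<open>simp add: has_real_derivative_iff_has_vector_derivative\<close>)
  have ddh0: "hess h0 x v w = 0" if "x \<in> V" "v \<in> V" "w \<in> V" for x v w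
  proof -
    have "hess h0 x v w = dird (\<lambda>y. dird h y w - c * dird \<rho> y w) x v"
      using that dh0 by (intro dird_cong[OF V]) auto
    also have "\<dots> = q x v w - c * g x v w"
      unfolding q_def g_def
      by (rule dird_eqI)
        (use DERIV_diff[OF smooth_on_line_real[OF V smooth_on_dird[OF h that(3)] that(1,2), of 0]
            DERIV_cmult[OF smooth_on_line_real[OF V smooth_on_dird[OF \<rho> that(3)] that(1,2), of 0], of c]]
          in \<open>simp add: has_real_derivative_iff_has_vector_derivative\<close>)
    also have "\<dots> = 0" using q\<kappa>[OF that] \<kappa>const[OF that(1)] by (simp add: c_def)
    finally show ?thesis .
  qed
  have affine: "h0 x = h0 0 + dird h0 0 x" if x: "x \<in> V" for x
  proof -
    have "hess (\<lambda>y. dird h0 y v) x v v = 0" if "x \<in> V" "v \<in> V" for x v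
    proof -
      have "hess (\<lambda>y. dird h0 y v) x v v = dird (\<lambda>y. 0::real) x v"
        using that ddh0 by (intro dird_cong[OF V]) auto
      also have "\<dots> = 0" by (rule dird_eqI) simp
      finally show ?thesis .
    qed
    from quadratic_on_subspace[OF V h0 this x] show ?thesis using ddh0[OF V0 x x] by simp
  qed
  obtain B where "B \<in> V \<and> (\<forall>v\<in>V. B \<bullet> v = dird h0 0 v)"
    by (rule subspace_gradient[OF V h0]) (use V0 in blast)
  then have B: "B \<in> V" "\<And>v. v \<in> V \<Longrightarrow> B \<bullet> v = dird h0 0 v" by auto
  have "f (Abs_S2 (sphere_par p x)) = c + (h0 0 *\<^sub>R p + B) \<bullet> sphere_par p x" if x: "x \<in> V" for x
  proof -
    have "(h0 0 *\<^sub>R p + B) \<bullet> (p + x) = h0 x"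
      using x B(1) B(2)[OF x] affine[OF x] p
      by (simp add: inner_add inner_commute V_def tplane_def norm_eq_1)
    then have "(h0 0 *\<^sub>R p + B) \<bullet> sphere_par p x = inverse (\<rho> x) * h0 x"
      using sphere_par_eq[OF p x[unfolded V_def]] by (simp add: \<rho>_def)
    moreover have "\<rho> x > 0" using one_plus_inner_pos[of x] by (simp add: \<rho>_def)
    moreover have "h0 x = \<rho> x * (f (Abs_S2 (sphere_par p x)) - c)"
      by (simp add: h0_def h_def \<rho>_def algebra_simps)
    ultimately show ?thesis by (simp add: mult.assoc[symmetric])
  qed
  then show ?thesis by (auto simp: V_def)
qed

lemma hemisphere_point:
  assumes p: "norm p = 1" and q: "norm q = 1" and pq: "p \<bullet> q > 0"
  obtains x where "x \<in> tplane p" "sphere_par p x = q"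
proof -
  define x where "x = (1 / (p \<bullet> q)) *\<^sub>R q - p"
  have x: "x \<in> tplane p" using p pq by (simp add: x_def tplane_def inner_diff_right norm_eq_1)
  have "sphere_par p x = sgn ((1 / (p \<bullet> q)) *\<^sub>R q)" by (simp add: sphere_par_def x_def)
  also have "\<dots> = q" using q pq by (simp add: sgn_div_norm)
  finally show ?thesis using that x by blast
qed

lemma norm_Rep_S2 [simp]: "norm (Rep_S2 q) = 1"
  using Rep_S2[of q] by simp

text \<open>
  Replacing \<open>x\<close> by \<open>- x\<close> separates \<open>b \<bullet> x\<close> from the even part \<open>a sqrt (1 + \<bar>x\<bar>\<^sup>2) + b \<bullet> m\<close>, which is
  constant only if \<open>a = 0\<close>.
\<close>

lemma affine_zero_near:
  fixes b m :: "real^3"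
  assumes m: "norm m = 1" and d: "d > 0"
    and z: "\<And>x. x \<in> tplane m \<Longrightarrow> norm x < d \<Longrightarrow> a * sqrt (nsq x) + b \<bullet> (m + x) = 0"
  shows "a = 0 \<and> b = 0"
proof -
  have 0: "a + b \<bullet> m = 0" using z[of 0] d by (simp add: tplane_def)
  have small: "a * sqrt (nsq x) + b \<bullet> m = 0 \<and> b \<bullet> x = 0" if "x \<in> tplane m" "norm x < d" for x
    using z[OF that] z[of "- x"] that by (simp add: tplane_def inner_add_right inner_diff_right)
  obtain e where e: "e \<in> tplane m" "norm e = 1" using tplane_frame[OF m] by metis
  have perp: "b \<bullet> x = 0" if x: "x \<in> tplane m" for x
  proof (cases "x = 0")
    case False
    define y where "y = (d / 2 / norm x) *\<^sub>R x"
    have "y \<in> tplane m" using x by (simp add: y_def tplane_def)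
    moreover have "norm y < d" using False d by (simp add: y_def)
    ultimately have "b \<bullet> y = 0" using small by blast
    then show ?thesis using False d by (simp add: y_def)
  qed simp
  have a: "a = 0"
  proof -
    define y where "y = (d / 2) *\<^sub>R e"
    have "y \<in> tplane m" "norm y < d" using e d by (simp_all add: y_def tplane_def)
    then have "a * sqrt (nsq y) + b \<bullet> m = 0" using small by blast
    then have "a * sqrt (nsq y) = a" using 0 by linarith
    moreover have "y \<bullet> y > 0" using e(2) d by (simp add: y_def norm_eq_1)
    then have "sqrt (nsq y) > sqrt 1" by (intro real_sqrt_less_mono) simp
    ultimately show ?thesis by (metis less_irrefl mult_cancel_left1 real_sqrt_one)
  qed
  have "b - (b \<bullet> m) *\<^sub>R m \<in> tplane m" using m by (simp add: tplane_def inner_diff_right norm_eq_1 inner_commute)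
  then have "b \<bullet> (b - (b \<bullet> m) *\<^sub>R m) = 0" by (rule perp)
  then have "b \<bullet> b = 0" using 0 a by (simp add: inner_diff_right)
  then show ?thesis using a by simp
qed

text \<open>
  Two open hemispheres that are not opposite to each other meet in an open set around the
  midpoint \<open>m\<close> of their centres, and there the affine function is determined.
\<close>

lemma affine_eq_on_lens:
  fixes b b' p p' :: "real^3"
  assumes p: "norm p = 1" "norm p' = 1" and opp: "p \<noteq> - p'"
    and eq: "\<And>q. norm q = 1 \<Longrightarrow> p \<bullet> q > 0 \<Longrightarrow> p' \<bullet> q > 0 \<Longrightarrow> a + b \<bullet> q = a' + b' \<bullet> q"
  shows "a = a' \<and> b = b'"
proof -
  define m where "m = sgn (p + p')"
  have pp: "p + p' \<noteq> 0" using opp by (metis add_eq_0_iff2)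
  have m: "norm m = 1" using pp by (simp add: m_def norm_sgn)
  have c: "p \<bullet> p' > -1"
  proof -
    have "(p + p') \<bullet> (p + p') > 0" using pp by simp
    then show ?thesis using p by (simp add: inner_add inner_commute norm_eq_1)
  qed
  have mp: "p \<bullet> m > 0" "p' \<bullet> m > 0"
    using pp c p by (simp_all add: m_def sgn_div_norm inner_add_right norm_eq_1 inner_commute[of p' p])
  \<comment> \<open>For \<open>\<bar>x\<bar> < d\<close> the vector \<open>m + x\<close> lies in both hemispheres.\<close>
  define d where "d = min (p \<bullet> m) (p' \<bullet> m)"
  have d: "d > 0" using mp by (simp add: d_def)
  have "(a - a') * sqrt (nsq x) + (b - b') \<bullet> (m + x) = 0" if x: "x \<in> tplane m" "norm x < d" for x
  proof -
    define s where "s = sqrt (nsq x)"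
    have s: "s > 0" using one_plus_inner_pos[of x] by (simp add: s_def)
    define q where "q = inverse s *\<^sub>R (m + x)"
    have nq: "norm q = 1" using tplane_norm(2)[OF m x(1)] s by (simp add: q_def s_def)
    have "r \<bullet> q > 0" if "norm r = 1" "r \<bullet> m \<ge> d" for r
    proof -
      have "\<bar>r \<bullet> x\<bar> \<le> norm x" using Cauchy_Schwarz_ineq2[of r x] that by simp
      then have "r \<bullet> (m + x) > 0" using that x by (simp add: inner_add_right)
      then show ?thesis using s by (simp add: q_def)
    qed
    then have "a + b \<bullet> q = a' + b' \<bullet> q" using p nq by (intro eq) (auto simp: d_def)
    then have "s * (a + b \<bullet> q) = s * (a' + b' \<bullet> q)" by simp
    moreover have "s * (v \<bullet> q) = v \<bullet> (m + x)" for v using s by (simp add: q_def)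
    ultimately show ?thesis
      unfolding s_def[symmetric] by (simp add: algebra_simps inner_diff_left)
  qed
  from affine_zero_near[OF m d this] show ?thesis by simp
qed

text \<open>
  The coefficients on overlapping hemispheres agree; opposite hemispheres are compared through a
  third one, centred on the equator.
\<close>

lemma kahler_sphere_imp_affine:
  fixes f :: "S2 \<Rightarrow> real"
  assumes n: "n > 0" and f: "f \<in> kahler_functions (sphere_kahler n)"
  obtains a b where "\<And>q. f q = a + b \<bullet> Rep_S2 q"
proof -
  have "\<exists>a b. \<forall>q. norm q = 1 \<longrightarrow> p \<bullet> q > 0 \<longrightarrow> f (Abs_S2 q) = a + b \<bullet> q" if p: "norm p = 1" for p
    using kahler_sphere_local[OF n f p] hemisphere_point[OF p] by metis
  then obtain a b where ab: "\<And>p q. norm p = 1 \<Longrightarrow> norm q = 1 \<Longrightarrow> p \<bullet> q > 0 \<Longrightarrow> f (Abs_S2 q) = a p + b p \<bullet> q"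
    by metis
  have glue: "a p = a p' \<and> b p = b p'" if "norm p = 1" "norm p' = 1" "p \<noteq> - p'" for p p'
  proof (rule affine_eq_on_lens[OF that])
    fix q :: "real^3" assume "norm q = 1" "p \<bullet> q > 0" "p' \<bullet> q > 0"
    then show "a p + b p \<bullet> q = a p' + b p' \<bullet> q" using ab that by metis
  qed
  obtain p0 :: "real^3" where p0: "norm p0 = 1" using vector_choose_size[of 1] by auto
  obtain e where e: "e \<in> tplane p0" "norm e = 1" using tplane_frame[OF p0] by metis
  have ne: "p0 \<noteq> - e" "e \<noteq> p0"
    using e p0 by (auto simp: tplane_def norm_eq_1)
  have all: "a p = a p0 \<and> b p = b p0" if p: "norm p = 1" for p
  proof (cases "p = - p0")
    case True
    have "a p = a e \<and> b p = b e" by (rule glue[OF p e(2)]) (use True ne in simp)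
    moreover have "a p0 = a e \<and> b p0 = b e" by (rule glue[OF p0 e(2) ne(1)])
    ultimately show ?thesis by simp
  next
    case False
    then show ?thesis by (rule glue[OF p p0])
  qed
  have "f q = a p0 + b p0 \<bullet> Rep_S2 q" for q
  proof -
    have "Rep_S2 q \<bullet> Rep_S2 q > 0" using norm_Rep_S2[of q] unfolding norm_eq_1 by simp
    then show ?thesis
      using ab[of "Rep_S2 q" "Rep_S2 q"] all[of "Rep_S2 q"] by (simp add: Rep_S2_inverse)
  qed
  then show ?thesis using that by blast
qed

lemma norm_sphere_par: "norm p = 1 \<Longrightarrow> x \<in> tplane p \<Longrightarrow> norm (sphere_par p x) = 1"
  using tplane_norm(2)[of p x] one_plus_inner_pos[of x] by (auto simp: sphere_par_def norm_sgn)

lemma affine_homogenized: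
  fixes f :: "S2 \<Rightarrow> real"
  assumes f: "\<And>q. f q = a + b \<bullet> Rep_S2 q" and p: "norm p = 1"
  defines "h \<equiv> (\<lambda>y. sqrt (nsq y) * f (Abs_S2 (sphere_par p y)))"
  shows "smooth_on (tplane p) (\<lambda>y. f (Abs_S2 (sphere_par p y)))"
   and "\<And>x. x \<in> tplane p \<Longrightarrow> h x = a * sqrt (nsq x) + b \<bullet> (p + x)"
   and "\<And>x v. x \<in> tplane p \<Longrightarrow> v \<in> tplane p \<Longrightarrow>
      dird h x v = a * ((x \<bullet> v) * inverse (sqrt (nsq x))) + b \<bullet> v"
   and "\<And>x v w. x \<in> tplane p \<Longrightarrow> v \<in> tplane p \<Longrightarrow> w \<in> tplane p \<Longrightarrow>
      hess h x v w = a * (inverse (sqrt (nsq x)) * (gsharp x v \<bullet> w))"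
proof -
  note V = subspace_tplane[of p]
  have F: "f (Abs_S2 (sphere_par p x)) = a + b \<bullet> (inverse (sqrt (nsq x)) *\<^sub>R (p + x))" if "x \<in> tplane p" for x
    using norm_sphere_par[OF p that] by (simp add: f Abs_S2_inverse sphere_par_eq[OF p that])
  have "smooth_on (tplane p) (\<lambda>x. a + inverse (sqrt (nsq x)) * (b \<bullet> p + b \<bullet> x))"
    by (intro smooth_on_add smooth_on_mult smooth_on_rsqrt smooth_on_const smooth_on_bounded_linear V
        bounded_linear_inner_right)
  then show "smooth_on (tplane p) (\<lambda>y. f (Abs_S2 (sphere_par p y)))"
    by (rule smooth_on_cong[OF V, rotated]) (simp add: F inner_add_right)
  show H: "h x = a * sqrt (nsq x) + b \<bullet> (p + x)" if "x \<in> tplane p" for x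
    using one_plus_inner_pos[of x] by (simp add: h_def F[OF that] algebra_simps)
  show D: "dird h x v = a * ((x \<bullet> v) * inverse (sqrt (nsq x))) + b \<bullet> v"
    if "x \<in> tplane p" "v \<in> tplane p" for x v
  proof -
    have "dird h x v = dird (\<lambda>x. a * sqrt (nsq x) + b \<bullet> (p + x)) x v"
      using that H by (intro dird_cong[OF V]) auto
    also have "\<dots> = a * ((x \<bullet> v) * inverse (sqrt (nsq x))) + b \<bullet> v"
    proof (rule dird_eqI)
      have "((\<lambda>t. b \<bullet> p + (b \<bullet> x + t * (b \<bullet> v))) has_real_derivative b \<bullet> v) (at 0)"
        by (auto intro!: derivative_eq_intros)
      from DERIV_add[OF DERIV_cmult[OF sqrt_line_derivative[of x v], of a] this]
      show "((\<lambda>t. a * sqrt (nsq (x + t *\<^sub>R v)) + b \<bullet> (p + (x + t *\<^sub>R v)))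
        has_vector_derivative a * ((x \<bullet> v) * inverse (sqrt (nsq x))) + b \<bullet> v) (at 0)"
        unfolding inner_add_right[of b] inner_scaleR_right[of b] has_real_derivative_iff_has_vector_derivative .
    qed
    finally show ?thesis .
  qed
  show "hess h x v w = a * (inverse (sqrt (nsq x)) * (gsharp x v \<bullet> w))"
    if "x \<in> tplane p" "v \<in> tplane p" "w \<in> tplane p" for x v w
  proof -
    have "hess h x v w = dird (\<lambda>y. a * dird (\<lambda>y. sqrt (nsq y)) y w + b \<bullet> w) x v"
      using that D by (intro dird_cong[OF V]) (auto simp: dird_sqrt)
    also have "\<dots> = a * (inverse (sqrt (nsq x)) * (gsharp x v \<bullet> w))"
      unfolding dird2_sqrt[OF that(1,2), of w, symmetric]
      by (rule dird_eqI)
       (use DERIV_add[OF DERIV_cmult[OF smooth_on_line_real[OF V smooth_on_dird[OF smooth_on_sqrt[OF V] that(3)] that(1,2), of 0], of a]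
         DERIV_const[of "b \<bullet> w"]] in \<open>simp add: has_real_derivative_iff_has_vector_derivative\<close>)
    finally show ?thesis .
  qed
qed

theorem kahler_functions_sphere:
  assumes n: "n > 0"
  shows "f \<in> kahler_functions (sphere_kahler n) \<longleftrightarrow> (\<exists>a b. \<forall>q. f q = a + b \<bullet> Rep_S2 q)"
proof
  assume "f \<in> kahler_functions (sphere_kahler n)"
  then show "\<exists>a b. \<forall>q. f q = a + b \<bullet> Rep_S2 q" using kahler_sphere_imp_affine[OF n] by metis
next
  assume "\<exists>a b. \<forall>q. f q = a + b \<bullet> Rep_S2 q"
  then obtain a b where f: "\<And>q. f q = a + b \<bullet> Rep_S2 q" by blast
  have "lie_metric (sphere_kahler n) p (ham (sphere_kahler n) f p) x v w = 0"
    if p: "norm p = 1" and x: "x \<in> tplane p" and v: "v \<in> tplane p" and w: "w \<in> tplane p" for p x v w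
  proof -
    note A = affine_homogenized[OF f p]
    have "gsharp x w \<bullet> J_sphere p (gsharp x v) = - (gsharp x v \<bullet> J_sphere p (gsharp x w))"
      using J_sphere_inner[of p "gsharp x v" "gsharp x w"] by (simp add: inner_commute)
    then show ?thesis
      unfolding sphere_lie_metric_eq[OF n p A(1) x v w]
      using A(4)[OF x v J_sphere_in] A(4)[OF x w J_sphere_in] by simp
  qed
  then show "f \<in> kahler_functions (sphere_kahler n)"
    using affine_homogenized(1)[OF f]
    by (auto simp: kahler_functions_def smooth_function_def smooth_on_def sphere_kahler_simps o_def)
qed

lemma triple_product_identity:
  fixes b c p z :: "real^3"
  shows "((z \<bullet> z) *\<^sub>R b - (b \<bullet> z) *\<^sub>R z) \<bullet> cross3 ((z \<bullet> z) *\<^sub>R c - (c \<bullet> z) *\<^sub>R z) p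
     = (z \<bullet> z) * (z \<bullet> p) * (cross3 b c \<bullet> z)"
  by (simp add: cross3_simps)

lemma pbracket_sphere:
  assumes n: "n > 0" and f: "\<And>q. f q = a + b \<bullet> Rep_S2 q" and g: "\<And>q. g q = a' + c \<bullet> Rep_S2 q"
  shows "pbracket (sphere_kahler n) f g q = - (1 / real n) * (cross3 b c \<bullet> Rep_S2 q)"
proof -
  have ev: "sympl (sphere_kahler n) p x (ham (sphere_kahler n) f p x) (ham (sphere_kahler n) g p x)
     = - (1 / real n) * (cross3 b c \<bullet> sphere_par p x)" if p: "norm p = 1" and x: "x \<in> tplane p" for p x
  proof -
    define z where "z = p + x"
    define s where "s = nsq x"
    have s: "s > 0" by (simp add: s_def one_plus_inner_pos)
    define r where "r = inverse (sqrt s)"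
    have rs: "r * (r * s) = 1" "r * sqrt s = 1" "r * s = sqrt s"
      using rsqrt_pow[of x] s sqrt_one_plus_inner[of x] by (simp_all add: r_def s_def field_simps)
    have zz: "z \<bullet> z = s" using tplane_norm(1)[OF p x] by (simp add: z_def s_def)
    have zp: "z \<bullet> p = 1" using p x by (simp add: z_def tplane_def inner_add inner_commute[of x] norm_eq_1)
    define Y where "Y b = (s *\<^sub>R b - (b \<bullet> z) *\<^sub>R z) - (s * (b \<bullet> p) - b \<bullet> z) *\<^sub>R p" for b
    have YV: "Y b \<in> tplane p" for b
      using p zp by (simp add: Y_def tplane_def inner_diff_right norm_eq_1 inner_commute[of p z]
          inner_commute[of p b])
    have ham: "ham (sphere_kahler n) f p x = (- 1 / real n) *\<^sub>R J_sphere p (Y b)"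
      if f: "\<And>q. f q = a + b \<bullet> Rep_S2 q" for f a b
    proof -
      note A = affine_homogenized[OF f p]
      define B where "B = (a * r) *\<^sub>R x + (b - (b \<bullet> p) *\<^sub>R p)"
      have B: "B \<in> tplane p"
        using x p by (simp add: B_def tplane_def inner_add_right inner_diff_right norm_eq_1 inner_commute)
      have grad: "B \<bullet> v = dird (\<lambda>y. sqrt (nsq y) * f (Abs_S2 (sphere_par p y))) x v" if v: "v \<in> tplane p" for v
        using A(3)[OF x v] v by (simp add: B_def inner_add_left inner_diff_left tplane_def r_def s_def)
      have "s *\<^sub>R B - (a * sqrt s + b \<bullet> z) *\<^sub>R x = Y b"
      proof -
        have "s *\<^sub>R B = (a * (r * s)) *\<^sub>R x + s *\<^sub>R (b - (b \<bullet> p) *\<^sub>R p)"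
          by (simp add: B_def scaleR_add_right mult_ac)
        then show ?thesis unfolding rs(3) by (simp add: Y_def z_def algebra_simps)
      qed
      then show ?thesis
        using sphere_ham_eq[where f = f, OF n p A(1) x B grad] A(2)[OF x] by (simp add: s_def z_def)
    qed
    define X1 where "X1 = (- 1 / real n) *\<^sub>R J_sphere p (Y b)"
    define X2 where "X2 = (- 1 / real n) *\<^sub>R J_sphere p (Y c)"
    have XV: "X1 \<in> tplane p" "X2 \<in> tplane p"
      unfolding X1_def X2_def by (intro subspace_scale subspace_tplane J_sphere_in)+
    have "J_sphere p X1 \<bullet> X2 = - ((1 / real n) * (1 / real n)) * (Y b \<bullet> J_sphere p (Y c))"
      unfolding X1_def X2_def J_sphere_linear(3) J_sphere_J_sphere[OF p YV] by simp
    also have "Y b \<bullet> J_sphere p (Y c) = (s *\<^sub>R b - (b \<bullet> z) *\<^sub>R z) \<bullet> cross3 (s *\<^sub>R c - (c \<bullet> z) *\<^sub>R z) p"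
      by (simp add: Y_def J_sphere_def Cross3.left_diff_distrib cross_mult_left inner_diff_left inner_diff_right
          dot_cross_self)
    also have "\<dots> = s * (cross3 b c \<bullet> z)"
      using triple_product_identity[of z b c p] by (simp add: zz zp)
    finally have J: "J_sphere p X1 \<bullet> X2 = - ((1 / real n) * (1 / real n)) * (s * (cross3 b c \<bullet> z))" by simp
    have "sympl (sphere_kahler n) p x X1 X2 = real n * (r ^ 3 * (J_sphere p X1 \<bullet> X2))"
      using sphere_metric_form(2)[OF p x XV] by (simp add: sphere_kahler_simps r_def s_def)
    also have "\<dots> = - (1 / real n) * ((r * (r * s)) * (cross3 b c \<bullet> (r *\<^sub>R z)))"
      using n by (simp add: J power3_eq_cube)
    also have "\<dots> = - (1 / real n) * (cross3 b c \<bullet> (r *\<^sub>R z))"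
      unfolding rs(1) by simp
    also have "r *\<^sub>R z = sphere_par p x"
      by (simp add: sphere_par_eq[OF p x] r_def s_def z_def)
    finally show ?thesis
      unfolding ham[OF f] ham[OF g] X1_def X2_def .
  qed
  show ?thesis unfolding pbracket_def
  proof (rule the_equality)
    define p where "p = Rep_S2 q"
    have p: "norm p = 1" by (simp add: p_def)
    have par: "sphere_par p 0 = p" using p by (simp add: sphere_par_def sgn_div_norm)
    have 0: "0 \<in> tplane p" by (simp add: tplane_def)
    show "\<exists>c'\<in>charts (sphere_kahler n). \<exists>x\<in>model (sphere_kahler n) c'. param (sphere_kahler n) c' x = q \<and>
        - (1 / real n) * (cross3 b c \<bullet> Rep_S2 q) =
        sympl (sphere_kahler n) c' x (ham (sphere_kahler n) f c' x) (ham (sphere_kahler n) g c' x)"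
      using ev[OF p 0] p 0 par
      by (rule_tac bexI[of _ p], rule_tac bexI[of _ 0])
        (auto simp: sphere_kahler_simps(1-3) p_def Rep_S2_inverse)
  next
    fix r assume "\<exists>c'\<in>charts (sphere_kahler n). \<exists>x\<in>model (sphere_kahler n) c'. param (sphere_kahler n) c' x = q \<and>
        r = sympl (sphere_kahler n) c' x (ham (sphere_kahler n) f c' x) (ham (sphere_kahler n) g c' x)"
    then obtain p x where px: "norm p = 1" "x \<in> tplane p" "Abs_S2 (sphere_par p x) = q"
        "r = sympl (sphere_kahler n) p x (ham (sphere_kahler n) f p x) (ham (sphere_kahler n) g p x)"
      by (auto simp: sphere_kahler_simps(1-3))
    have "Rep_S2 q = sphere_par p x"
      using px(3) norm_sphere_par[OF px(1,2)] by (auto simp: Abs_S2_inverse)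
    then show "r = - (1 / real n) * (cross3 b c \<bullet> Rep_S2 q)"
      using ev[OF px(1,2)] px(4) by simp
  qed
qed

section \<open>Vanishing of sesquilinear polynomials\<close>

lemma hermitian_matrix:
  assumes D: "hermitian D"
  shows "D w $ i = (\<Sum>j\<in>UNIV. D (axis j 1) $ i * w $ j)"
proof -
  interpret D: bounded_linear D by (rule hermitian_bounded_linear[OF D])
  have "D w = D (\<Sum>j\<in>UNIV. (w $ j) *s axis j 1)" by (simp add: basis_expansion)
  also have "\<dots> = (\<Sum>j\<in>UNIV. (w $ j) *s D (axis j 1))"
    by (simp add: D.sum hermitian_smult[OF D])
  finally show ?thesis by (simp add: mult.commute)
qed

lemma infinite_unit_circle: "infinite (range cis)"
proof
  assume "finite (range cis)"
  then have "finite (Re ` cis ` {0..pi})" by (meson finite_imageI finite_subset image_mono subset_UNIV)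
  moreover have "Re ` cis ` {0..pi} = cos ` {0..pi}" by (simp add: image_image)
  moreover have "inj_on cos {0..pi}" by (auto intro!: inj_onI cos_inj_pi)
  ultimately have "finite {0..pi}" by (simp add: finite_image_iff)
  then show False using infinite_Icc[of 0 pi] by simp
qed

text \<open>
  With \<open>w = r e\<^sup>i\<^sup>\<beta>\<close> the sum is \<open>e\<^sup>i\<^sup>N\<^sup>\<beta>\<close> times \<open>\<Sum> M\<^sub>k\<^sub>l (cnj w)\<^sup>k w\<^sup>l\<close>.  As a polynomial in \<open>e\<^sup>i\<^sup>\<beta>\<close> it determines the
  part with a given \<open>l - k\<close>, and this part, as a polynomial in \<open>r\<close>, separates the values of \<open>k + l\<close>.
\<close>

lemma double_polynomial_zero:
  fixes M :: "nat \<Rightarrow> nat \<Rightarrow> complex"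
  assumes zero: "\<And>r \<beta>. r \<ge> 0 \<Longrightarrow>
      (\<Sum>k\<le>N. \<Sum>l\<le>N. M k l * of_real r ^ (k + l) * cis \<beta> ^ (N + l - k)) = 0"
    and kl: "k \<le> N" "l \<le> N"
  shows "M k l = 0"
proof -
  define e where "e = N + l - k"
  define c where "c r = (\<Sum>k\<le>N. \<Sum>l\<le>N. if N + l - k = e then M k l * of_real r ^ (k + l) else 0)" for r
  have c0: "c r = 0" if r: "r \<ge> 0" for r
  proof -
    define P where "P = (\<Sum>k\<le>N. \<Sum>l\<le>N. monom (M k l * of_real r ^ (k + l)) (N + l - k))"
    have "range cis \<subseteq> {z. poly P z = 0}"
      using zero[OF r] by (auto simp: P_def poly_sum poly_monom)
    then have "infinite {z. poly P z = 0}" using infinite_unit_circle finite_subset by blast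
    then have "P = 0" using poly_roots_finite by blast
    moreover have "coeff P e = c r" by (simp add: P_def c_def coeff_sum)
    ultimately show ?thesis by simp
  qed
  define R where "R = (\<Sum>k\<le>N. \<Sum>l\<le>N. if N + l - k = e then monom (M k l) (k + l) else 0)"
  have "poly R (of_real r) = c r" for r
    by (auto simp: R_def c_def poly_sum poly_monom intro!: sum.cong)
  then have "of_real ` {0..} \<subseteq> {z. poly R z = 0}" using c0 by auto
  moreover have "infinite (of_real ` {0::real..} :: complex set)"
    by (simp add: finite_image_iff inj_on_def infinite_Ici)
  ultimately have "infinite {z. poly R z = 0}" using finite_subset by blast
  then have "R = 0" using poly_roots_finite by blast
  then have "0 = coeff R (k + l)" by simp
  also have "\<dots> = (\<Sum>k'\<le>N. \<Sum>l'\<le>N. if k' = k \<and> l' = l then M k' l' else 0)"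
    unfolding R_def coeff_sum
  proof (intro sum.cong refl)
    fix k' l' assume "k' \<in> {..N}" "l' \<in> {..N}"
    then have "N + l' - k' = e \<and> k' + l' = k + l \<longleftrightarrow> k' = k \<and> l' = l"
      using kl by (auto simp: e_def)
    then show "coeff (if N + l' - k' = e then monom (M k' l') (k' + l') else 0) (k + l)
       = (if k' = k \<and> l' = l then M k' l' else 0)"
      by auto
  qed
  also have "\<dots> = M k l"
  proof -
    have "(\<Sum>l'\<le>N. if k' = k \<and> l' = l then M k' l' else 0) = (if k' = k then M k' l else 0)" for k'
      using kl by (cases "k' = k") (auto simp: sum.delta)
    then show ?thesis using kl by (simp add: sum.delta)
  qed
  finally show ?thesis ..
qed

lemma sphere_point_surj:
  obtains \<alpha> \<beta> where "\<alpha> \<in> {0..pi}" "\<beta> \<in> {0..2*pi}" "p = sphere_point \<alpha> \<beta>"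
proof -
  define x where "x = Rep_S2 p $ 1"
  define y where "y = Rep_S2 p $ 2"
  define z where "z = Rep_S2 p $ 3"
  have rep: "Rep_S2 p = vector [x, y, z]" by (simp add: x_def y_def z_def vec_eq_iff forall_3)
  have "Rep_S2 p \<bullet> Rep_S2 p = 1" using norm_Rep_S2[of p] by (simp only: norm_eq_1)
  then have xyz: "x\<^sup>2 + y\<^sup>2 + z\<^sup>2 = 1"
    by (simp add: inner_vec_def sum_3 x_def y_def z_def power2_eq_square)
  define \<alpha> where "\<alpha> = arccos x"
  have x1: "x\<^sup>2 \<le> 1" using xyz zero_le_power2[of y] zero_le_power2[of z] by linarith
  then have x2: "-1 \<le> x" "x \<le> 1" by (auto simp: power2_le_iff_abs_le[of 1 x, simplified] abs_le_iff)
  have \<alpha>: "\<alpha> \<in> {0..pi}" "cos \<alpha> = x"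
    using x2 by (auto simp: \<alpha>_def arccos_lbound arccos_ubound)
  have s2: "(sin \<alpha>)\<^sup>2 = y\<^sup>2 + z\<^sup>2" using xyz \<alpha> by (simp add: sin_squared_eq)
  obtain \<beta> where \<beta>: "\<beta> \<in> {0..2*pi}" "y = sin \<alpha> * cos \<beta>" "z = sin \<alpha> * sin \<beta>"
  proof (cases "sin \<alpha> = 0")
    case True
    then have "y = 0" "z = 0" using s2 by (simp_all add: sum_power2_eq_zero_iff)
    then show ?thesis using that[of 0] True by simp
  next
    case False
    then have "(y / sin \<alpha>)\<^sup>2 + (z / sin \<alpha>)\<^sup>2 = 1"
      by (simp add: power_divide s2[symmetric] flip: add_divide_distrib)
    then obtain t where "0 \<le> t" "t < 2*pi" "y / sin \<alpha> = cos t" "z / sin \<alpha> = sin t"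
      using sincos_total_2pi by metis
    then show ?thesis using that[of t] False by (auto simp: field_simps)
  qed
  have "Rep_S2 p = Rep_S2 (sphere_point \<alpha> \<beta>)"
    unfolding Rep_sphere_point rep by (simp add: \<alpha> \<beta>)
  then have "p = sphere_point \<alpha> \<beta>" by (simp add: Rep_S2_inject)
  then show ?thesis using that \<alpha> \<beta> by blast
qed

section \<open>Spin operators\<close>

text \<open>
  The matrix elements of the raising operator of the spin \<open>n/2\<close> representation between the positions
  \<open>k - 1\<close> and \<open>k\<close>.  They vanish at \<open>k = 0\<close> and \<open>k = n + 1\<close>, so that the operators below, which
  refer to neighbouring positions, never see a position outside \<open>{0..n}\<close>.
\<close>

definition ladder :: "nat \<Rightarrow> nat \<Rightarrow> real" where
  "ladder n k = sqrt (real k * (real n + 1 - real k))"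

definition raise_op :: "nat \<Rightarrow> ('m::finite \<Rightarrow> nat) \<Rightarrow> complex^'m \<Rightarrow> complex^'m" where
  "raise_op n \<iota> z = (\<chi> i. of_real (ladder n (\<iota> i)) * z $ inv \<iota> (\<iota> i - 1))"

definition lower_op :: "nat \<Rightarrow> ('m::finite \<Rightarrow> nat) \<Rightarrow> complex^'m \<Rightarrow> complex^'m" where
  "lower_op n \<iota> z = (\<chi> i. of_real (ladder n (Suc (\<iota> i))) * z $ inv \<iota> (Suc (\<iota> i)))"

text \<open>
  The spin operators, scaled by \<open>2/n\<close> so that their spectra lie between \<open>-1\<close> and \<open>1\<close>, in the order of the
  coordinates \<open>x\<close>, \<open>y\<close>, \<open>z\<close>: the \<open>x\<close> axis is the axis of quantization.
\<close>

definition spin1 :: "nat \<Rightarrow> ('m::finite \<Rightarrow> nat) \<Rightarrow> complex^'m \<Rightarrow> complex^'m" where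
  "spin1 n \<iota> z = (\<chi> i. of_real ((2 * real (\<iota> i) - real n) / real n) * z $ i)"

definition spin2 :: "nat \<Rightarrow> ('m::finite \<Rightarrow> nat) \<Rightarrow> complex^'m \<Rightarrow> complex^'m" where
  "spin2 n \<iota> z = of_real (1 / real n) *s (raise_op n \<iota> z + lower_op n \<iota> z)"

definition spin3 :: "nat \<Rightarrow> ('m::finite \<Rightarrow> nat) \<Rightarrow> complex^'m \<Rightarrow> complex^'m" where
  "spin3 n \<iota> z = (\<i> * of_real (1 / real n)) *s (raise_op n \<iota> z - lower_op n \<iota> z)"

lemma ladder_0 [simp]: "ladder n 0 = 0" and ladder_Suc_n [simp]: "ladder n (Suc n) = 0"
  by (simp_all add: ladder_def)

lemma ladder_sq: "k \<le> Suc n \<Longrightarrow> ladder n k * ladder n k = real k * (real n + 1 - real k)"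
  unfolding ladder_def by (intro real_sqrt_mult_self[THEN trans] abs_of_nonneg mult_nonneg_nonneg) auto

text \<open>
  The operator whose Rayleigh quotient extends \<open>q \<mapsto> a + b \<bullet> q\<close>.
\<close>

definition spin_hat :: "nat \<Rightarrow> ('m::finite \<Rightarrow> nat) \<Rightarrow> real \<Rightarrow> real^3 \<Rightarrow> complex^'m \<Rightarrow> complex^'m" where
  "spin_hat n \<iota> a b z = a *\<^sub>R z + (b $ 1) *\<^sub>R spin1 n \<iota> z + (b $ 2) *\<^sub>R spin2 n \<iota> z + (b $ 3) *\<^sub>R spin3 n \<iota> z"

text \<open>
  The modulus of the component of the coherent state at position \<open>k\<close>, up to sign; its square is a
  Bernstein polynomial in \<open>cos\<^sup>2(\<alpha>/2)\<close>, that is, a binomial probability.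
\<close>

definition amp :: "nat \<Rightarrow> real \<Rightarrow> nat \<Rightarrow> real" where
  "amp n \<alpha> k = sqrt (real (n choose k)) * cos (\<alpha> / 2) ^ k * sin (\<alpha> / 2) ^ (n - k)"

text \<open>
  For Hermitian \<open>A\<close> and \<open>B\<close>, \<open>2i Im \<langle>Az, Bz\<rangle> = \<langle>z, [A, B] z\<rangle>\<close>.
\<close>

lemma Im_herm_commutator:
  assumes A: "hermitian A" and B: "hermitian B" and C: "hermitian C"
    and comm: "A (B z) = B (A z) + (\<i> * of_real c) *s C z"
  shows "Im (herm (A z) (B z)) = c / 2 * (z \<bullet> C z)"
proof -
  have "herm (A z) (B z) - cnj (herm (A z) (B z)) = herm z (A (B z)) - herm z (B (A z))"
    using A B by (simp add: cnj_herm hermitian_def)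
  also have "\<dots> = \<i> * of_real (c * (z \<bullet> C z))"
    unfolding comm by (simp add: herm_simps hermitian_herm_self[OF C])
  finally have "Im (herm (A z) (B z) - cnj (herm (A z) (B z))) = c * (z \<bullet> C z)" by simp
  then show ?thesis by simp
qed

context
  fixes n :: nat and \<iota> :: "'m::finite \<Rightarrow> nat"
  assumes \<iota>: "bij_betw \<iota> UNIV {0..n}" and n: "n \<ge> 1"
begin

abbreviation "raise \<equiv> raise_op n \<iota>"
abbreviation "lower \<equiv> lower_op n \<iota>"
abbreviation "S1 \<equiv> spin1 n \<iota>"
abbreviation "S2 \<equiv> spin2 n \<iota>"
abbreviation "S3 \<equiv> spin3 n \<iota>"
abbreviation "\<Psi> \<equiv> Psi n \<iota>"
abbreviation "hat \<equiv> spin_hat n \<iota>"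

lemma index_inv [simp]: "k \<le> n \<Longrightarrow> \<iota> (inv \<iota> k) = k"
  using \<iota> by (metis atLeastAtMost_iff bij_betw_imp_surj_on f_inv_into_f le0)

lemma inv_index [simp]: "inv \<iota> (\<iota> i) = i"
  using \<iota> by (metis bij_betw_imp_inj_on inv_into_f_f UNIV_I)

lemma index_le: "\<iota> i \<le> n"
  using \<iota> by (auto simp: bij_betw_def)

lemma sum_index: "(\<Sum>i\<in>UNIV. G i) = (\<Sum>k\<le>n. G (inv \<iota> k))"
  using sum.reindex_bij_betw[OF \<iota>, of "\<lambda>k. G (inv \<iota> k)"]
  by (simp add: atMost_atLeast0)

lemma herm_index: "herm z w = (\<Sum>k\<le>n. cnj (z $ inv \<iota> k) * w $ inv \<iota> k)"
  unfolding herm_def by (rule sum_index)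

lemma herm_raise: "herm (raise z) w = herm z (lower w)"
proof -
  obtain m where m: "n = Suc m" using n by (cases n) auto
  have "herm (raise z) w
      = (\<Sum>k\<le>n. of_real (ladder n k) * cnj (z $ inv \<iota> (k - 1)) * w $ inv \<iota> k)"
    unfolding herm_index by (rule sum.cong) (auto simp: raise_op_def)
  also have "\<dots> = (\<Sum>k\<le>m. of_real (ladder n (Suc k)) * cnj (z $ inv \<iota> k) * w $ inv \<iota> (Suc k))"
    unfolding m sum.atMost_Suc_shift by (simp flip: m)
  also have "\<dots> = (\<Sum>k\<le>n. of_real (ladder n (Suc k)) * cnj (z $ inv \<iota> k) * w $ inv \<iota> (Suc k))"
    unfolding m sum.atMost_Suc by (simp flip: m)
  also have "\<dots> = herm z (lower w)"
    unfolding herm_index by (rule sum.cong) (auto simp: lower_op_def)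
  finally show ?thesis .
qed

lemma herm_lower: "herm (lower z) w = herm z (raise w)"
  using herm_raise[of w z] cnj_herm by metis

lemma hermitian_spin1: "hermitian (S1)"
  by (auto simp: hermitian_def herm_def spin1_def intro!: sum.cong)

lemma hermitian_spin2: "hermitian (S2)"
  by (auto simp: hermitian_def spin2_def herm_simps herm_raise herm_lower algebra_simps simp del: of_real_divide)

lemma hermitian_spin3: "hermitian (S3)"
  by (auto simp: hermitian_def spin3_def herm_simps herm_raise herm_lower algebra_simps simp del: of_real_divide)

lemma raise_smult: "raise (c *s z) = c *s raise z"
  and lower_smult: "lower (c *s z) = c *s lower z"
  by (simp_all add: raise_op_def lower_op_def vec_eq_iff)

lemma commutator_spin1_raise:
  "S1 (raise z) = raise (S1 z) + of_real (2 / real n) *s raise z"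
proof (subst vec_eq_iff, rule allI)
  fix i
  show "S1 (raise z) $ i
    = (raise (S1 z) + of_real (2 / real n) *s raise z) $ i"
  proof (cases "\<iota> i")
    case 0
    then show ?thesis by (simp add: raise_op_def spin1_def)
  next
    case (Suc k)
    then have "k \<le> n" using index_le[of i] by simp
    then show ?thesis using n Suc
      by (simp add: raise_op_def spin1_def field_simps)
  qed
qed

lemma commutator_spin1_lower:
  "S1 (lower z) = lower (S1 z) - of_real (2 / real n) *s lower z"
proof (subst vec_eq_iff, rule allI)
  fix i
  show "S1 (lower z) $ i
    = (lower (S1 z) - of_real (2 / real n) *s lower z) $ i"
  proof (cases "\<iota> i = n")
    case True
    then show ?thesis by (simp add: lower_op_def spin1_def)
  next
    case False
    then have "Suc (\<iota> i) \<le> n" using index_le[of i] by simp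
    then show ?thesis using n
      by (simp add: lower_op_def spin1_def field_simps)
  qed
qed

lemma commutator_raise_lower:
  "raise (lower z) = lower (raise z) + of_real (real n) *s S1 z"
proof (subst vec_eq_iff, rule allI)
  fix i
  have rl: "raise (lower z) $ i = of_real (ladder n (\<iota> i) * ladder n (\<iota> i)) * z $ i"
  proof (cases "\<iota> i")
    case 0
    then show ?thesis by (simp add: raise_op_def)
  next
    case (Suc k)
    then have "k \<le> n" using index_le[of i] by simp
    then show ?thesis using Suc inv_index[of i] by (simp add: raise_op_def lower_op_def)
  qed
  have lr: "lower (raise z) $ i = of_real (ladder n (Suc (\<iota> i)) * ladder n (Suc (\<iota> i))) * z $ i"
  proof (cases "\<iota> i = n")
    case True
    then show ?thesis by (simp add: lower_op_def)
  next
    case False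
    then have "Suc (\<iota> i) \<le> n" using index_le[of i] by simp
    then show ?thesis by (simp add: raise_op_def lower_op_def)
  qed
  have "ladder n (\<iota> i) * ladder n (\<iota> i)
      = ladder n (Suc (\<iota> i)) * ladder n (Suc (\<iota> i)) + real n * ((2 * real (\<iota> i) - real n) / real n)"
  proof -
    have "real n * ((2 * real (\<iota> i) - real n) / real n) = 2 * real (\<iota> i) - real n"
      using n by simp
    then show ?thesis
      using index_le[of i] by (simp only: ladder_sq le_SucI Suc_le_mono) (simp add: algebra_simps)
  qed
  then show "raise (lower z) $ i
    = (lower (raise z) + of_real (real n) *s S1 z) $ i"
    unfolding vector_add_component rl lr vector_smult_component
    by (simp only: spin1_def vec_lambda_beta of_real_add of_real_mult distrib_right mult.assoc)
qed

text \<open>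
  The commutation relations \<open>[S\<^sub>1, S\<^sub>2] = - (2i/n) S\<^sub>3\<close> and their cyclic permutations.
\<close>

lemma Im_spin12: "Im (herm (S1 z) (S2 z)) = - (1 / real n) * (z \<bullet> S3 z)"
proof -
  have "S1 (S2 z) = S2 (S1 z) + (\<i> * of_real (- 2 / real n)) *s S3 z"
    unfolding spin2_def spin3_def hermitian_smult[OF hermitian_spin1] hermitian_add[OF hermitian_spin1]
      commutator_spin1_raise commutator_spin1_lower
    by (simp add: vec_eq_iff algebra_simps)
  from Im_herm_commutator[OF hermitian_spin1 hermitian_spin2 hermitian_spin3 this] show ?thesis by simp
qed

lemma Im_spin31: "Im (herm (S3 z) (S1 z)) = - (1 / real n) * (z \<bullet> S2 z)"
proof -
  have "S3 (S1 z) = S1 (S3 z) + (\<i> * of_real (- 2 / real n)) *s S2 z"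
  proof -
    have minus: "a - b = a + (-1) *s b" for a b :: "complex^'m" by (simp add: vec_eq_iff)
    show ?thesis
      unfolding spin2_def spin3_def minus hermitian_smult[OF hermitian_spin1] hermitian_add[OF hermitian_spin1]
        commutator_spin1_raise commutator_spin1_lower
      by (simp add: vec_eq_iff algebra_simps)
  qed
  from Im_herm_commutator[OF hermitian_spin3 hermitian_spin1 hermitian_spin2 this] show ?thesis by simp
qed

lemma Im_spin23: "Im (herm (S2 z) (S3 z)) = - (1 / real n) * (z \<bullet> S1 z)"
proof -
  have ra: "raise (v + w) = raise v + raise w"
    "lower (v + w) = lower v + lower w"
    "raise (v - w) = raise v - raise w"
    "lower (v - w) = lower v - lower w" for v w
    by (simp_all add: raise_op_def lower_op_def vec_eq_iff algebra_simps)
  have "S2 (S3 z) = S3 (S2 z) + (\<i> * of_real (- 2 / real n)) *s S1 z"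
    unfolding spin2_def spin3_def raise_smult lower_smult ra commutator_raise_lower
    using n by (simp add: vec_eq_iff field_simps power2_eq_square)
  from Im_herm_commutator[OF hermitian_spin2 hermitian_spin3 hermitian_spin1 this] show ?thesis by simp
qed

lemma hermitian_hat: "hermitian (hat a b)"
  using hermitian_spin1 hermitian_spin2 hermitian_spin3
  by (simp add: hermitian_def spin_hat_def herm_simps)

text \<open>
  The constants and the diagonal terms contribute real numbers, and the others combine to the
  cross product, with the factor \<open>- 1/n\<close> of the bracket on the sphere.
\<close>

lemma Im_herm_hat:
  "Im (herm (hat a b z) (hat a' c z)) = z \<bullet> hat 0 ((- 1 / real n) *\<^sub>R cross3 b c) z"
proof -
  have self: "Im (herm w w) = 0" for w :: "complex^'m" by (simp add: herm_self)
  have swap: "Im (herm v w) = - Im (herm w v)" for v w :: "complex^'m"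
    using cnj_herm[of w v] by (metis cnj.simps(2))
  have H: "Im (herm z (A z)) = 0" "Im (herm (A z) z) = 0" if "hermitian A" for A
    using hermitian_herm_self[OF that, of z] swap[of "A z" z] by simp_all
  note S = H[OF hermitian_spin1] H[OF hermitian_spin2] H[OF hermitian_spin3]
  show ?thesis
    unfolding spin_hat_def
    by (simp add: herm_simps self S Im_spin12 Im_spin23 Im_spin31 inner_add_right cross_components
        swap[of "S2 z" "S1 z"] swap[of "S3 z" "S2 z"]
        swap[of "S1 z" "S3 z"])
      (simp add: algebra_simps add_divide_distrib diff_divide_distrib)
qed

section \<open>Expectation values in the coherent states\<close>

lemma Psi_nth: "k \<le> n \<Longrightarrow> \<Psi> \<alpha> \<beta> $ inv \<iota> k = of_real (amp n \<alpha> k) * cis (\<beta> * real k)"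
  by (simp add: Psi_def Let_def amp_def cis_conv_exp mult.commute)

lemma amp_sq: "k \<le> n \<Longrightarrow> amp n \<alpha> k * amp n \<alpha> k = Bernstein n k ((cos (\<alpha> / 2))\<^sup>2)"
proof -
  have "1 - (cos (\<alpha> / 2))\<^sup>2 = (sin (\<alpha> / 2))\<^sup>2" by (simp add: sin_squared_eq)
  then show ?thesis
    by (simp add: amp_def Bernstein_def power_mult_distrib flip: power_mult power2_eq_square)
      (simp add: power_mult_distrib mult.commute flip: power_mult)
qed

lemma herm_Psi_self: "herm (\<Psi> \<alpha> \<beta>) (\<Psi> \<alpha> \<beta>) = 1"
proof -
  have "herm (\<Psi> \<alpha> \<beta>) (\<Psi> \<alpha> \<beta>) = (\<Sum>k\<le>n. of_real (Bernstein n k ((cos (\<alpha> / 2))\<^sup>2)))"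
    unfolding herm_index
    by (rule sum.cong) (simp_all add: Psi_nth cis_cnj cis_mult mult_ac flip: amp_sq)
  also have "\<dots> = 1" by (simp flip: of_real_sum)
  finally show ?thesis .
qed

lemma herm_Psi_spin1: "\<Psi> \<alpha> \<beta> \<bullet> S1 (\<Psi> \<alpha> \<beta>) = cos \<alpha>"
proof -
  let ?x = "(cos (\<alpha> / 2))\<^sup>2"
  have "herm (\<Psi> \<alpha> \<beta>) (S1 (\<Psi> \<alpha> \<beta>))
     = (\<Sum>k\<le>n. of_real ((2 * real k - real n) / real n * Bernstein n k ?x))"
    unfolding herm_index
    by (rule sum.cong) (simp_all add: spin1_def Psi_nth cis_cnj cis_mult mult_ac flip: amp_sq)
  also have "\<dots> = of_real ((\<Sum>k\<le>n. (2 * (real k * Bernstein n k ?x) - real n * Bernstein n k ?x) / real n))"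
    unfolding of_real_sum by (rule sum.cong) (simp_all add: algebra_simps)
  also have "(\<Sum>k\<le>n. (2 * (real k * Bernstein n k ?x) - real n * Bernstein n k ?x) / real n) = cos \<alpha>"
    using n cos_double_cos[of "\<alpha> / 2"]
    by (simp add: sum_subtractf flip: sum_divide_distrib sum_distrib_left) (simp add: field_simps)
  finally show ?thesis by (simp flip: Re_herm)
qed

text \<open>
  The square roots combine because both \<open>(k + 1) (n choose (k + 1))\<close> and \<open>(n - k) (n choose k)\<close> equal
  \<open>n ((n - 1) choose k)\<close>; the result is a Bernstein polynomial of degree \<open>n - 1\<close>.
\<close>

lemma amp_ladder:
  assumes m: "n = Suc m" and k: "k \<le> m"
  shows "amp n \<alpha> (Suc k) * ladder n (Suc k) * amp n \<alpha> k
    = real n * cos (\<alpha> / 2) * sin (\<alpha> / 2) * Bernstein m k ((cos (\<alpha> / 2))\<^sup>2)"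
proof -
  define c where "c = cos (\<alpha> / 2)"
  define s where "s = sin (\<alpha> / 2)"
  have cs: "1 - c\<^sup>2 = s\<^sup>2" by (simp add: c_def s_def sin_squared_eq)
  have 1: "Suc k * (n choose Suc k) = n * (m choose k)"
    using binomial_absorption[of k n] by (simp add: m)
  have 2: "(n - k) * (n choose k) = n * (m choose k)"
    using binomial_absorb_comp[of n k] by (simp add: m)
  have r1: "real (n choose Suc k) * real (Suc k) = real n * real (m choose k)"
    using arg_cong[OF 1, of real] by (simp only: of_nat_mult mult.commute)
  have r2: "(real n - real k) * real (n choose k) = real n * real (m choose k)"
    using arg_cong[OF 2, of real] k m by (simp only: of_nat_mult) (simp add: of_nat_diff)
  have "sqrt (real (n choose Suc k)) * ladder n (Suc k) * sqrt (real (n choose k))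
     = sqrt ((real n * real (m choose k)) * (real n * real (m choose k)))"
  proof -
    have "real (n choose Suc k) * (real (Suc k) * (real n + 1 - real (Suc k))) * real (n choose k)
      = (real (n choose Suc k) * real (Suc k)) * ((real n - real k) * real (n choose k))"
      by (simp add: mult_ac)
    then show ?thesis
      unfolding r1 r2 ladder_def real_sqrt_mult[symmetric] by (rule arg_cong)
  qed
  then have q: "sqrt (real (n choose Suc k)) * ladder n (Suc k) * sqrt (real (n choose k))
     = real n * real (m choose k)"
    by simp
  have "amp n \<alpha> (Suc k) * ladder n (Suc k) * amp n \<alpha> k
    = (sqrt (real (n choose Suc k)) * ladder n (Suc k) * sqrt (real (n choose k)))
      * (c ^ Suc k * c ^ k) * (s ^ (n - Suc k) * s ^ (n - k))"
    by (simp add: amp_def c_def s_def mult_ac)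
  also have "c ^ Suc k * c ^ k = c * (c\<^sup>2) ^ k"
    by (simp add: power_mult[symmetric] mult_2 power_add)
  also have "s ^ (n - Suc k) * s ^ (n - k) = s * (s\<^sup>2) ^ (m - k)"
    using k by (simp add: m Suc_diff_le power2_eq_square power_mult_distrib)
  finally show ?thesis
    unfolding q by (simp add: Bernstein_def cs flip: c_def s_def)
qed

text \<open>
  By \<open>amp_ladder\<close> the terms are binomial probabilities for \<open>n - 1\<close>, which add up to one.
\<close>

lemma herm_Psi_raise:
  "herm (\<Psi> \<alpha> \<beta>) (raise (\<Psi> \<alpha> \<beta>)) = of_real (real n * sin \<alpha> / 2) * cis (- \<beta>)"
proof -
  obtain m where m: "n = Suc m" using n by (cases n) auto
  let ?x = "(cos (\<alpha> / 2))\<^sup>2"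
  have "herm (\<Psi> \<alpha> \<beta>) (raise (\<Psi> \<alpha> \<beta>))
     = (\<Sum>k\<le>n. cnj (\<Psi> \<alpha> \<beta> $ inv \<iota> k) * (of_real (ladder n k) * \<Psi> \<alpha> \<beta> $ inv \<iota> (k - 1)))"
    unfolding herm_index by (rule sum.cong) (simp_all add: raise_op_def)
  also have "\<dots> = (\<Sum>k\<le>m. cnj (\<Psi> \<alpha> \<beta> $ inv \<iota> (Suc k))
      * (of_real (ladder n (Suc k)) * \<Psi> \<alpha> \<beta> $ inv \<iota> k))"
    unfolding m sum.atMost_Suc_shift by (simp flip: m)
  also have "\<dots> = (\<Sum>k\<le>m. of_real (real n * cos (\<alpha> / 2) * sin (\<alpha> / 2) * Bernstein m k ?x) * cis (- \<beta>))"
  proof (rule sum.cong)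
    fix k assume "k \<in> {..m}"
    then have k: "k \<le> m" "Suc k \<le> n" "k \<le> n" by (auto simp: m)
    have "cnj (\<Psi> \<alpha> \<beta> $ inv \<iota> (Suc k)) * (of_real (ladder n (Suc k)) * \<Psi> \<alpha> \<beta> $ inv \<iota> k)
      = of_real (amp n \<alpha> (Suc k) * ladder n (Suc k) * amp n \<alpha> k) * (cis (- (\<beta> * real (Suc k))) * cis (\<beta> * real k))"
      unfolding Psi_nth[OF k(2)] Psi_nth[OF k(3)] by (simp add: cis_cnj mult_ac)
    also have "cis (- (\<beta> * real (Suc k))) * cis (\<beta> * real k) = cis (- \<beta>)"
      by (simp add: cis_mult algebra_simps)
    finally show "cnj (\<Psi> \<alpha> \<beta> $ inv \<iota> (Suc k)) * (of_real (ladder n (Suc k)) * \<Psi> \<alpha> \<beta> $ inv \<iota> k)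
      = of_real (real n * cos (\<alpha> / 2) * sin (\<alpha> / 2) * Bernstein m k ?x) * cis (- \<beta>)"
      unfolding amp_ladder[OF m k(1)] .
  qed simp
  also have "\<dots> = of_real (real n * cos (\<alpha> / 2) * sin (\<alpha> / 2) * (\<Sum>k\<le>m. Bernstein m k ?x)) * cis (- \<beta>)"
    by (simp only: sum_distrib_left of_real_sum sum_distrib_right)
  also have "real n * cos (\<alpha> / 2) * sin (\<alpha> / 2) * (\<Sum>k\<le>m. Bernstein m k ?x) = real n * sin \<alpha> / 2"
    using sin_double[of "\<alpha> / 2"] by simp
  finally show ?thesis .
qed

lemma herm_Psi_spin2: "\<Psi> \<alpha> \<beta> \<bullet> S2 (\<Psi> \<alpha> \<beta>) = sin \<alpha> * cos \<beta>"
  and herm_Psi_spin3: "\<Psi> \<alpha> \<beta> \<bullet> S3 (\<Psi> \<alpha> \<beta>) = sin \<alpha> * sin \<beta>"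
proof -
  let ?P = "\<Psi> \<alpha> \<beta>"
  have "herm ?P (lower ?P) = cnj (herm ?P (raise ?P))"
    by (simp add: cnj_herm herm_raise)
  then have l: "herm ?P (lower ?P) = of_real (real n * sin \<alpha> / 2) * cis \<beta>"
    by (simp add: herm_Psi_raise cis_cnj)
  show "?P \<bullet> S2 ?P = sin \<alpha> * cos \<beta>" "?P \<bullet> S3 ?P = sin \<alpha> * sin \<beta>"
    unfolding Re_herm[symmetric] spin2_def spin3_def herm_simps l herm_Psi_raise
    using n by (simp_all add: field_simps)
qed

lemma rayleigh_hat_Psi:
  "rayleigh (hat a b) (\<Psi> \<alpha> \<beta>) = a + b \<bullet> vector [cos \<alpha>, sin \<alpha> * cos \<beta>, sin \<alpha> * sin \<beta>]"
proof -
  have "\<Psi> \<alpha> \<beta> \<bullet> \<Psi> \<alpha> \<beta> = 1"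
    using herm_Psi_self[of \<alpha> \<beta>] by (simp flip: Re_herm)
  then show ?thesis
    by (simp add: rayleigh_def spin_hat_def inner_add_right herm_Psi_spin1 herm_Psi_spin2 herm_Psi_spin3
        inner_vec_def[of b] sum_3)
qed

section \<open>The extension and its uniqueness\<close>

text \<open>
  Dividing the components of the coherent state by \<open>sin\<^sup>n(\<alpha>/2)\<close> turns them into \<open>sqrt (n choose k) w\<^sup>k\<close> with
  \<open>w = cot(\<alpha>/2) e\<^sup>i\<^sup>\<beta>\<close>, which takes every complex value.  So \<open>\<Sum> M\<^sub>k\<^sub>l (cnj w)\<^sup>k w\<^sup>l\<close> vanishes identically, where
  \<open>M\<close> is the matrix of \<open>D\<close> scaled by positive factors.
\<close>

lemma hermitian_zero_of_Psi:
  assumes D: "hermitian D"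
    and zero: "\<And>\<alpha> \<beta>. \<alpha> \<in> {0..pi} \<Longrightarrow> \<beta> \<in> {0..2*pi} \<Longrightarrow>
      \<Psi> \<alpha> \<beta> \<bullet> D (\<Psi> \<alpha> \<beta>) = 0"
  shows "D z = 0"
proof -
  define d where "d k l = D (axis (inv \<iota> l) 1) $ inv \<iota> k" for k l
  define M where "M k l = of_real (sqrt (real (n choose k)) * sqrt (real (n choose l))) * d k l" for k l
  have "(\<Sum>k\<le>n. \<Sum>l\<le>n. M k l * of_real r ^ (k + l) * cis \<beta>0 ^ (n + l - k)) = 0"
    if r: "r \<ge> 0" for r \<beta>0
  proof -
    \<comment> \<open>The angle with \<open>cot (\<alpha>/2) = r\<close> is \<open>2t\<close> with \<open>cos t = r/R\<close> and \<open>sin t = 1/R\<close>; it is defined for \<open>r = 0\<close> as well.\<close>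
    define R where "R = sqrt (1 + r\<^sup>2)"
    have R: "R > 0" "R\<^sup>2 = 1 + r\<^sup>2" using zero_le_power2[of r] by (auto simp: R_def add_pos_nonneg)
    have "(r / R)\<^sup>2 + (1 / R)\<^sup>2 = 1"
    proof -
      have "1 + r\<^sup>2 > 0" using R by (metis zero_less_power)
      then show ?thesis by (simp add: power_divide R(2) add.commute flip: add_divide_distrib)
    qed
    then obtain t where t: "0 \<le> t" "t \<le> pi / 2" "r / R = cos t" "1 / R = sin t"
      using sincos_total_pi_half[of "r / R" "1 / R"] r R by auto
    define \<alpha> where "\<alpha> = 2 * t"
    obtain \<beta> where \<beta>: "0 \<le> \<beta>" "\<beta> < 2 * pi" "cos \<beta>0 = cos \<beta>" "sin \<beta>0 = sin \<beta>"
      using sincos_total_2pi[of "cos \<beta>0" "sin \<beta>0"] by auto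
    have cis: "cis \<beta>0 = cis \<beta>" using \<beta> by (simp add: complex_eq_iff)
    let ?P = "\<Psi> \<alpha> \<beta>"
    have amp: "amp n \<alpha> k = sqrt (real (n choose k)) * r ^ k / R ^ n" if "k \<le> n" for k
    proof -
      have "amp n \<alpha> k = sqrt (real (n choose k)) * ((r / R) ^ k * (1 / R) ^ (n - k))"
        by (simp add: amp_def \<alpha>_def t)
      also have "(r / R) ^ k * (1 / R) ^ (n - k) = r ^ k / R ^ n"
        using that by (simp add: power_divide flip: power_add)
      finally show ?thesis by simp
    qed
    have "?P \<bullet> D ?P = 0" by (rule zero) (use t \<beta> in \<open>auto simp: \<alpha>_def\<close>)
    then have "0 = herm ?P (D ?P)" by (simp add: hermitian_herm_self[OF D])
    also have "\<dots> = (\<Sum>k\<le>n. \<Sum>l\<le>n. cnj (?P $ inv \<iota> k) * (d k l * ?P $ inv \<iota> l))"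
      unfolding herm_index hermitian_matrix[OF D, of ?P] sum_index
      by (simp add: sum_distrib_left d_def)
    finally have "0 = of_real (R ^ (2 * n)) * cis \<beta> ^ n *
        (\<Sum>k\<le>n. \<Sum>l\<le>n. cnj (?P $ inv \<iota> k) * (d k l * ?P $ inv \<iota> l))" by simp
    also have "\<dots> = (\<Sum>k\<le>n. \<Sum>l\<le>n. M k l * of_real r ^ (k + l) * cis \<beta>0 ^ (n + l - k))"
      unfolding sum_distrib_left
    proof (intro sum.cong refl)
      fix k l assume "k \<in> {..n}" "l \<in> {..n}"
      then have kl: "k \<le> n" "l \<le> n" by auto
      have 1: "cis \<beta> ^ n * (cnj (cis (\<beta> * real k)) * cis (\<beta> * real l)) = cis \<beta>0 ^ (n + l - k)"
        using kl by (simp add: cis Complex.DeMoivre cis_cnj cis_mult of_nat_diff algebra_simps)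
      have 2: "R ^ (2 * n) * (amp n \<alpha> k * amp n \<alpha> l)
         = (sqrt (real (n choose k)) * sqrt (real (n choose l))) * r ^ (k + l)"
        using R(1) by (simp add: amp kl power_add mult_2)
      have "of_real (R ^ (2 * n)) * cis \<beta> ^ n * (cnj (?P $ inv \<iota> k) * (d k l * ?P $ inv \<iota> l))
        = of_real (R ^ (2 * n) * (amp n \<alpha> k * amp n \<alpha> l)) * d k l
           * (cis \<beta> ^ n * (cnj (cis (\<beta> * real k)) * cis (\<beta> * real l)))"
        unfolding Psi_nth[OF kl(1)] Psi_nth[OF kl(2)] by (simp add: mult_ac)
      also have "\<dots> = M k l * of_real r ^ (k + l) * cis \<beta>0 ^ (n + l - k)"
        unfolding 1 2 by (simp add: M_def mult_ac)
      finally show "of_real (R ^ (2 * n)) * cis \<beta> ^ n * (cnj (?P $ inv \<iota> k) * (d k l * ?P $ inv \<iota> l))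
        = M k l * of_real r ^ (k + l) * cis \<beta>0 ^ (n + l - k)" .
    qed
    finally show ?thesis ..
  qed
  then have M0: "M k l = 0" if "k \<le> n" "l \<le> n" for k l
    using double_polynomial_zero[where M = M and N = n] that by blast
  have "D (axis j 1) $ i = 0" for i j
    using M0[OF index_le[of i] index_le[of j]] index_le[THEN leD]
    by (simp add: M_def d_def inv_index)
  then show ?thesis
    using hermitian_matrix[OF D, of z] by (simp add: vec_eq_iff)
qed

lemma rayleigh_eq_of_Psi:
  assumes A: "hermitian A" and B: "hermitian B"
    and eq: "\<And>\<alpha> \<beta>. \<alpha> \<in> {0..pi} \<Longrightarrow> \<beta> \<in> {0..2*pi} \<Longrightarrow>
      rayleigh A (\<Psi> \<alpha> \<beta>) = rayleigh B (\<Psi> \<alpha> \<beta>)"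
  shows "A z = B z"
proof -
  have D: "hermitian (\<lambda>z. A z - B z)" using A B by (simp add: hermitian_def herm_simps)
  have "\<Psi> \<alpha> \<beta> \<bullet> (A (\<Psi> \<alpha> \<beta>) - B (\<Psi> \<alpha> \<beta>)) = 0"
    if "\<alpha> \<in> {0..pi}" "\<beta> \<in> {0..2*pi}" for \<alpha> \<beta>
    using eq[OF that] Psi_nonzero[OF \<iota>, of \<alpha> \<beta>] by (simp add: rayleigh_def inner_diff_right)
  from hermitian_zero_of_Psi[OF D this, of z] show ?thesis by simp
qed

lemma extension_unique:
  assumes F: "F \<in> kahler_functions fubini_study" and G: "G \<in> kahler_functions fubini_study"
    and eq: "F \<circ> emb n \<iota> = G \<circ> emb n \<iota>"
  shows "F = G"
proof -
  obtain A where A: "hermitian A" "F = rayleigh_fun A" using kahler_fubini_study_eq_fs_function[OF F] .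
  obtain B where B: "hermitian B" "G = rayleigh_fun B" using kahler_fubini_study_eq_fs_function[OF G] .
  have "rayleigh A (\<Psi> \<alpha> \<beta>) = rayleigh B (\<Psi> \<alpha> \<beta>)"
    if "\<alpha> \<in> {0..pi}" "\<beta> \<in> {0..2*pi}" for \<alpha> \<beta>
    using fun_cong[OF eq, of "sphere_point \<alpha> \<beta>"] Psi_nonzero[OF \<iota>, of \<alpha> \<beta>]
    by (simp add: emb_sphere_point[OF \<iota> that] A B rayleigh_fun_pr)
  from rayleigh_eq_of_Psi[OF A(1) B(1) this] have "A = B" by auto
  then show ?thesis using A B by simp
qed

lemma rayleigh_fun_hat_emb: "rayleigh_fun (hat a b) (emb n \<iota> p) = a + b \<bullet> Rep_S2 p"
proof -
  obtain \<alpha> \<beta> where p: "\<alpha> \<in> {0..pi}" "\<beta> \<in> {0..2*pi}" "p = sphere_point \<alpha> \<beta>"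
    by (rule sphere_point_surj)
  show ?thesis
    unfolding p(3) emb_sphere_point[OF \<iota> p(1,2)] Rep_sphere_point
    by (simp add: rayleigh_fun_pr[OF hermitian_hat] Psi_nonzero[OF \<iota>] rayleigh_hat_Psi)
qed

lemma extend_kahler_eqI:
  assumes "F \<in> kahler_functions fubini_study" "F \<circ> emb n \<iota> = f"
  shows "extend_kahler n \<iota> f = F"
  unfolding extend_kahler_def using assms extension_unique by (intro the_equality) auto

lemma extend_kahler_affine:
  assumes "\<And>q. f q = a + b \<bullet> Rep_S2 q"
  shows "extend_kahler n \<iota> f = rayleigh_fun (hat a b)"
  by (rule extend_kahler_eqI)
    (auto simp: rayleigh_fun_kahler hermitian_hat rayleigh_fun_hat_emb assms)

lemma rayleigh_fun_hat_add:
  "rayleigh_fun (hat (r * a + s * a') (r *\<^sub>R b + s *\<^sub>R b')) q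
    = r * rayleigh_fun (hat a b) q + s * rayleigh_fun (hat a' b') q"
proof -
  have "hat (r * a + s * a') (r *\<^sub>R b + s *\<^sub>R b') z = r *\<^sub>R hat a b z + s *\<^sub>R hat a' b' z" for z
    by (simp add: spin_hat_def algebra_simps)
  then show ?thesis by (simp add: rayleigh_fun_def rayleigh_def inner_add_right add_divide_distrib)
qed

lemma rayleigh_fun_hat_bracket:
  "rayleigh_fun (hat 0 ((- 1 / real n) *\<^sub>R cross3 b c)) q
    = 1 / 4 * pbracket fubini_study (rayleigh_fun (hat a b)) (rayleigh_fun (hat a' c)) q"
proof (rule pr_cases[of q])
  fix z assume z: "z \<noteq> 0" and q: "q = pr z"
  note H = hermitian_hat
  show ?thesis
    unfolding q
    using pbracket_fubini_study[where f = "rayleigh_fun (hat a b)" and g = "rayleigh_fun (hat a' c)",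
        OF H _ H _ z, of a b a' c]
    by (simp add: rayleigh_fun_pr[OF H] z Im_herm_hat rayleigh_def)
qed

end

theorem proposition9p7:
  fixes n :: nat and \<iota> :: "'m::finite \<Rightarrow> nat"
  assumes "n \<ge> 1" and "bij_betw \<iota> UNIV {0..n}"
  shows
    "(\<forall>f\<in>kahler_functions (sphere_kahler n).
        \<exists>!F. F \<in> kahler_functions (fubini_study :: (complex^'m, complex^'m, 'm cproj) kahler)
             \<and> F \<circ> emb n \<iota> = f)
     \<and> (\<forall>f\<in>kahler_functions (sphere_kahler n). \<forall>g\<in>kahler_functions (sphere_kahler n). \<forall>a b.
          (\<lambda>p. a * f p + b * g p) \<in> kahler_functions (sphere_kahler n)
          \<and> extend_kahler n \<iota> (\<lambda>p. a * f p + b * g p)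
             = (\<lambda>q. a * extend_kahler n \<iota> f q + b * extend_kahler n \<iota> g q))
     \<and> (\<forall>f\<in>kahler_functions (sphere_kahler n). \<forall>g\<in>kahler_functions (sphere_kahler n).
          pbracket (sphere_kahler n) f g \<in> kahler_functions (sphere_kahler n)
          \<and> extend_kahler n \<iota> (pbracket (sphere_kahler n) f g)
             = (\<lambda>q. 1 / 4 * pbracket fubini_study (extend_kahler n \<iota> f) (extend_kahler n \<iota> g) q))"
proof (intro conjI ballI allI)
  note \<iota> = assms(2) and n = assms(1)
  have n0: "n > 0" using n by simp
  note K = kahler_functions_sphere[OF n0]
  note E = extend_kahler_affine[OF \<iota> n]
  fix f assume "f \<in> kahler_functions (sphere_kahler n)"
  then obtain a b where f: "\<And>q. f q = a + b \<bullet> Rep_S2 q" using K by blast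
  show "\<exists>!F. F \<in> kahler_functions (fubini_study :: (complex^'m, complex^'m, 'm cproj) kahler)
      \<and> F \<circ> emb n \<iota> = f"
  proof (rule ex_ex1I)
    have "rayleigh_fun (spin_hat n \<iota> a b) \<circ> emb n \<iota> = f"
      by (simp add: fun_eq_iff rayleigh_fun_hat_emb[OF \<iota> n] f)
    then show "\<exists>F. F \<in> kahler_functions (fubini_study :: (complex^'m, complex^'m, 'm cproj) kahler)
        \<and> F \<circ> emb n \<iota> = f"
      using rayleigh_fun_kahler[OF hermitian_hat[OF \<iota> n]] by blast
  qed (metis extension_unique[OF \<iota> n])
  fix g assume "g \<in> kahler_functions (sphere_kahler n)"
  then obtain a' b' where g: "\<And>q. g q = a' + b' \<bullet> Rep_S2 q" using K by blast
  {
    fix r s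
    have rs: "r * f q + s * g q = (r * a + s * a') + (r *\<^sub>R b + s *\<^sub>R b') \<bullet> Rep_S2 q" for q
      by (simp add: f g inner_add_left algebra_simps)
    then show "(\<lambda>p. r * f p + s * g p) \<in> kahler_functions (sphere_kahler n)" using K by blast
    show "extend_kahler n \<iota> (\<lambda>p. r * f p + s * g p)
        = (\<lambda>q. r * extend_kahler n \<iota> f q + s * extend_kahler n \<iota> g q)"
      unfolding E[OF rs] E[OF f] E[OF g] by (rule ext) (rule rayleigh_fun_hat_add[OF \<iota> n])
  }
  have br: "pbracket (sphere_kahler n) f g q = 0 + ((- 1 / real n) *\<^sub>R cross3 b b') \<bullet> Rep_S2 q" for q
    using pbracket_sphere[OF n0 f g] by simp
  then show "pbracket (sphere_kahler n) f g \<in> kahler_functions (sphere_kahler n)" using K by blast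
  show "extend_kahler n \<iota> (pbracket (sphere_kahler n) f g)
      = (\<lambda>q. 1 / 4 * pbracket fubini_study (extend_kahler n \<iota> f) (extend_kahler n \<iota> g) q)"
    unfolding E[OF br] E[OF f] E[OF g] by (rule ext) (rule rayleigh_fun_hat_bracket[OF \<iota> n])
qed


end
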